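(* Let $W:\mathbb{R}^2\to[0,\infty)$ be continuous, vanishing at precisely two distinct points $\mathbf{p}_+$ and $\mathbf{p}_-$, and set $F:=\sqrt{W}$. Assume there exist disjoint balls $B_+$ and $B_-$ centered at $\mathbf{p}_+$ and $\mathbf{p}_-$ respectively such that: (1) $W$ is smooth within each ball, with positive definite Hessian at $\mathbf{p}_+$ and at $\mathbf{p}_-$; (2) Assumption A (stated in the context) holds; (3) there is $m_0>0$ such that $F(p)\ge m_0$ for all $p\in\mathbb{R}^2\setminus(B_+\cup B_-)$. Then for every $A_0\in\mathbb{R}$ there exists $\gamma_*\in\mathcal{S}_{A_0}$ with $$E(\gamma_* )=\inf_{\gamma\in\mathcal{S}_{A_0}}E(\gamma).$$
   Context: For a Lipschitz curve $\gamma=(\gamma^{(1)},\gamma^{(2)}):[0,1]\to\mathbb{R}^2$ define $$E(\gamma):=\int_0^1F(\gamma(t))\,|\gamma'(t)|\,dt,\qquad \mathcal{P}(\gamma):=-\int_0^1\gamma^{(2)}(t)\,(\gamma^{(1)})'(t)\,dt .$$ For $A_0\in\mathbb{R}$, $\mathcal{S}_{A_0}$ is the set of all locally Lipschitz $\gamma:[0,1]\to\mathbb{R}^2$ with $\gamma(0)=\mathbf{p}_-$, $\gamma(1)=\mathbf{p}_+$, $\mathcal{P}(\gamma)=A_0$. Assumption A: For every point $\mathbf{p}_0$ in either $B_+\setminus\{\mathbf{p}_+\}$ or $B_-\setminus\{\mathbf{p}_-\}$ and every real number $A$, there exists a minimizer of $E(\gamma)$ over all Lipschitz continuous curves $\gamma:[0,1]\to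 B_+$ (resp. $B_-$) with $\gamma(0)=\mathbf{p}_0$, $\gamma(1)=\mathbf{p}_+$ (resp. $\mathbf{p}_-$) and $\mathcal{P}(\gamma)=A$. Furthermore, the Euclidean arclength of this minimizer can be bounded by a constant depending on $W$, $\mathbf{p}_0$ and $A$. *)

theory Defs
  imports "HOL-Analysis.Analysis"
begin

text \<open>
  Points of the plane have type \<^typ>\<open>real ^ 2\<close>. A curve on \<open>[0,1]\<close> is a function on
  \<^typ>\<open>real\<close> of which only the restriction to \<open>{0..1}\<close> matters: derivatives are taken within
  \<open>{0..1}\<close>. A Lipschitz curve is differentiable almost everywhere, and the value that
  \<^const>\<open>vector_derivative\<close> takes at the remaining points does not affect the integrals.
  The integrands are bounded and measurable for Lipschitz curves and continuous weights, so the
  integral below is the Lebesgue integral.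
\<close>

definition energy :: "(real ^ 2 \<Rightarrow> real) \<Rightarrow> (real \<Rightarrow> real ^ 2) \<Rightarrow> real" where
  "energy F \<gamma> =
     integral {0..1} (\<lambda>t. F (\<gamma> t) * norm (vector_derivative \<gamma> (at t within {0..1})))"

definition signed_area :: "(real \<Rightarrow> real ^ 2) \<Rightarrow> real" where
  "signed_area \<gamma> =
     - integral {0..1} (\<lambda>t. \<gamma> t $ 2 * vector_derivative (\<lambda>s. \<gamma> s $ 1) (at t within {0..1}))"

definition arclength :: "(real \<Rightarrow> real ^ 2) \<Rightarrow> real" where
  "arclength \<gamma> = integral {0..1} (\<lambda>t. norm (vector_derivative \<gamma> (at t within {0..1})))"

definition locally_lipschitz_on :: "real set \<Rightarrow> (real \<Rightarrow> real ^ 2) \<Rightarrow> bool" where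
  "locally_lipschitz_on T \<gamma> \<longleftrightarrow>
     (\<forall>t\<in>T. \<exists>u>0. \<exists>L. L-lipschitz_on (cball t u \<inter> T) \<gamma>)"

definition admissible_curves :: "real ^ 2 \<Rightarrow> real ^ 2 \<Rightarrow> real \<Rightarrow> (real \<Rightarrow> real ^ 2) set" where
  "admissible_curves p q A =
     {\<gamma>. locally_lipschitz_on {0..1} \<gamma> \<and> \<gamma> 0 = p \<and> \<gamma> 1 = q \<and> signed_area \<gamma> = A}"

definition lipschitz_curves_in ::
    "(real ^ 2) set \<Rightarrow> real ^ 2 \<Rightarrow> real ^ 2 \<Rightarrow> real \<Rightarrow> (real \<Rightarrow> real ^ 2) set" where
  "lipschitz_curves_in B p q A =
     {\<gamma>. (\<exists>L. L-lipschitz_on {0..1} \<gamma>) \<and> \<gamma> ` {0..1} \<subseteq> B \<and>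
          \<gamma> 0 = p \<and> \<gamma> 1 = q \<and> signed_area \<gamma> = A}"

text \<open>
  Existence of minimizers inside the well \<open>B\<close> around \<open>p\<close>. The function \<open>C\<close> is the arclength
  bound; it depends on the weight, the starting point and the area, and no uniformity in the
  latter two is required.
\<close>

definition local_minimizers_exist :: "(real ^ 2 \<Rightarrow> real) \<Rightarrow> real ^ 2 \<Rightarrow> (real ^ 2) set \<Rightarrow> bool" where
  "local_minimizers_exist F p B \<longleftrightarrow>
     (\<exists>C :: real ^ 2 \<Rightarrow> real \<Rightarrow> real. \<forall>p\<^sub>0 \<in> B - {p}. \<forall>A.
        \<exists>\<gamma>. is_arg_min (energy F) (\<lambda>\<gamma>. \<gamma> \<in> lipschitz_curves_in B p\<^sub>0 p A) \<gamma> \<and>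
            arclength \<gamma> \<le> C p\<^sub>0 A)"

text \<open>\<open>C\<^sup>k\<close> and \<open>C\<^sup>\<infinity>\<close> functions on an open set, by iterated directional derivatives.\<close>

primrec C_k_on :: "nat \<Rightarrow> (real ^ 2) set \<Rightarrow> (real ^ 2 \<Rightarrow> real) \<Rightarrow> bool" where
  "C_k_on 0 S f \<longleftrightarrow> continuous_on S f"
| "C_k_on (Suc k) S f \<longleftrightarrow>
     (\<forall>x\<in>S. f differentiable (at x)) \<and>
     (\<forall>v. C_k_on k S (\<lambda>x. frechet_derivative f (at x) v))"

definition smooth_on :: "(real ^ 2) set \<Rightarrow> (real ^ 2 \<Rightarrow> real) \<Rightarrow> bool" where
  "smooth_on S f \<longleftrightarrow> (\<forall>k. C_k_on k S f)"

definition partial_deriv :: "2 \<Rightarrow> (real ^ 2 \<Rightarrow> real) \<Rightarrow> real ^ 2 \<Rightarrow> real" where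
  "partial_deriv i f x = frechet_derivative f (at x) (axis i 1)"

definition hessian :: "(real ^ 2 \<Rightarrow> real) \<Rightarrow> real ^ 2 \<Rightarrow> real ^ 2 ^ 2" where
  "hessian f x = (\<chi> i j. partial_deriv i (partial_deriv j f) x)"

definition positive_definite :: "real ^ 2 ^ 2 \<Rightarrow> bool" where
  "positive_definite H \<longleftrightarrow> transpose H = H \<and> (\<forall>v. v \<noteq> 0 \<longrightarrow> v \<bullet> (H *v v) > 0)"

end

theory Submission
  imports Defs "HOL-Complex_Analysis.Great_Picard"
begin

text \<open>
  A minimizing sequence fails to converge only by running up unbounded length, and unbounded length
  at bounded energy is possible only near the two zeros of \<open>F\<close>. What can be lost in the limit is
  therefore some signed area, concentrated at the two wells together with the energy spent on it.
  The local minimizers give this area back at no extra cost.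

  In detail, call an energy \<open>\<kappa>\<close> small if it does not pay for crossing the annulus between the
  circles of radius \<open>\<delta>\<close> and \<open>2 * \<delta>\<close> around a well. A curve of energy \<open>E\<close> is cut into about
  \<open>E / \<kappa>\<close> arcs of small energy \<open>\<kappa>\<close>, and limits are taken arc by arc
  (\<open>subconverges_finite_energy\<close>). A sequence of arcs of bounded length converges after an
  arc-length reparametrization, by the Arzela-Ascoli theorem; energy is lower semicontinuous and
  area is continuous along this sequence (\<open>curves_compactness\<close>). If the lengths are unbounded, then
  the arcs come arbitrarily close to one well \<open>z\<close> while staying within distance \<open>2 * \<delta>\<close> of it.
  There \<open>F\<close> dominates the distance to \<open>z\<close>, because the Hessian of \<open>W = F\<^sup>2\<close> is positive definite,
  so the energy bounds the area. The arcs may be rerouted through \<open>z\<close> at vanishing cost. A piece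
  from a point \<open>x \<noteq> z\<close> to \<open>z\<close> is then replaced by the local minimizer with the limiting area; only
  a piece that both starts and ends at \<open>z\<close> in the limit is left over, as a pure loop
  (\<open>subconverges_near_well\<close>).

  The result is an honest Lipschitz curve between the wells, plus one loop at either well that is
  known only through approximations. Follow the curve from the well until it reaches a small circle,
  at a point \<open>y\<close>. The loop followed by this arc joins the well to \<open>y\<close>, and \<open>y\<close> is not the well, so
  a local minimizer replaces both (\<open>absorb_loop\<close>). Doing this at both ends yields an admissible
  curve whose energy is at most the infimum.

  All estimates rest on the calculus of Lipschitz curves: a Lipschitz function is differentiable
  almost everywhere, it is the integral of its derivative, and integrals of positively homogeneous
  densities along curves do not depend on the parametrization.
\<close>

section \<open>Almost everywhere differentiability of Lipschitz functions\<close>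

lemma increasing_bilipschitz:
  fixes f :: "real \<Rightarrow> real"
  assumes "0 < m" and lo: "\<And>x y. x \<le> y \<Longrightarrow> m * (y - x) \<le> f y - f x"
    and hi: "\<And>x y. x \<le> y \<Longrightarrow> f y - f x \<le> M * (y - x)"
  shows "strict_mono f" "M-lipschitz_on UNIV f"
proof -
  show mono: "strict_mono f"
    unfolding strict_mono_def
  proof (intro allI impI)
    fix x y :: real assume "x < y"
    then have "0 < m * (y - x)" using \<open>0 < m\<close> by simp
    then show "f x < f y" using lo[of x y] \<open>x < y\<close> by linarith
  qed
  show "M-lipschitz_on UNIV f"
  proof (rule lipschitz_onI)
    fix x y
    show "dist (f x) (f y) \<le> M * dist x y"
      using hi[of x y] hi[of y x] strict_mono_less_eq[OF mono, of x y] strict_mono_less_eq[OF mono, of y x]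
      by (cases "x \<le> y") (auto simp: dist_real_def)
  qed (use lo[of 0 1] hi[of 0 1] \<open>0 < m\<close> in auto)
qed

lemma increasing_bilipschitz_inverse:
  fixes f :: "real \<Rightarrow> real"
  assumes "0 < m" and lo: "\<And>x y. x \<le> y \<Longrightarrow> m * (y - x) \<le> f y - f x"
    and hi: "\<And>x y. x \<le> y \<Longrightarrow> f y - f x \<le> M * (y - x)"
  obtains g where "\<And>z. f (g z) = z" "\<And>x. g (f x) = x" "0 < M"
    "\<And>x y. x \<le> y \<Longrightarrow> (1 / M) * (y - x) \<le> g y - g x"
    "\<And>x y. x \<le> y \<Longrightarrow> g y - g x \<le> (1 / m) * (y - x)"
proof -
  note mono = increasing_bilipschitz(1)[OF assms]
  have "0 < M" using lo[of 0 1] hi[of 0 1] \<open>0 < m\<close> by auto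
  have "\<exists>x. f x = z" for z
  proof -
    define t where "t = (\<bar>z\<bar> + \<bar>f 0\<bar>) / m"
    have t: "t \<ge> 0" "m * t = \<bar>z\<bar> + \<bar>f 0\<bar>" using \<open>0 < m\<close> by (simp_all add: t_def)
    then have "f (-t) \<le> z" "z \<le> f t" using lo[of 0 t] lo[of "-t" 0] by auto
    moreover have "continuous_on {-t..t} f"
      using lipschitz_on_continuous_on[OF increasing_bilipschitz(2)[OF assms]] continuous_on_subset by blast
    ultimately show ?thesis using IVT'[of f "-t" z t] t by auto
  qed
  then obtain g where fg: "\<And>z. f (g z) = z" by metis
  have gf: "g (f x) = x" for x using fg[of "f x"] strict_mono_eq[OF mono] by simp
  have gmono: "g x \<le> g y \<longleftrightarrow> x \<le> y" for x y using strict_mono_less_eq[OF mono, of "g x" "g y"] by (simp add: fg)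
  show ?thesis
  proof (rule that[OF fg gf \<open>0 < M\<close>])
    fix x y :: real assume "x \<le> y"
    then show "(1 / M) * (y - x) \<le> g y - g x" "g y - g x \<le> (1 / m) * (y - x)"
      using hi[of "g x" "g y"] lo[of "g x" "g y"] \<open>0 < m\<close> \<open>0 < M\<close> by (simp_all add: gmono fg field_simps)
  qed
qed

text \<open>
  The images of the short intervals with small difference quotient form a Vitali cover of
  \<open>f ` S\<close>. A countable disjoint subfamily covers \<open>f ` S\<close> up to a null set. The preimages of its
  members are disjoint intervals inside \<open>U\<close>, and each member is at most \<open>p\<close> times as long as its
  preimage. Outer measures are expressed through measurable covering sets, as \<open>S\<close> is arbitrary.
\<close>

lemma Vitali_image_bound:
  fixes f :: "real \<Rightarrow> real"
  assumes mono: "strict_mono f" and cont: "continuous_on UNIV f"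
    and U: "open U" "U \<in> lmeasurable" "S \<subseteq> U" and "p > 0"
    and slow: "\<And>x d. x \<in> S \<Longrightarrow> d > 0 \<Longrightarrow> \<exists>y. y \<noteq> x \<and> \<bar>y - x\<bar> < d \<and> (f y - f x) / (y - x) \<le> p"
  obtains V where "V \<in> lmeasurable" "f ` S \<subseteq> V" "measure lebesgue V \<le> p * measure lebesgue U"
proof -
  define K where "K = {(u,v). u < v \<and> {u..v} \<subseteq> U \<and> f v - f u \<le> p * (v - u)}"
  define a where "a = (\<lambda>(u,v). (f u + f v) / 2)"
  define r where "r = (\<lambda>(u,v). (f v - f u) / 2)"
  have cb: "cball (a i) (r i) = {f (fst i) .. f (snd i)}" for i
    unfolding a_def r_def cball_eq_atLeastAtMost by (cases i) (auto simp: field_simps)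
  obtain C where C: "countable C" "C \<subseteq> K"
     "pairwise (\<lambda>i j. disjnt (cball (a i) (r i)) (cball (a j) (r j))) C"
     "negligible (f ` S - (\<Union>i \<in> C. cball (a i) (r i)))"
  proof (rule Vitali_covering_theorem_cballs [of K r "f ` S" a])
    show "0 < r i" if "i \<in> K" for i
      using that mono by (auto simp: K_def r_def strict_mono_def)
    show "\<exists>i. i \<in> K \<and> z \<in> cball (a i) (r i) \<and> r i < d" if z: "z \<in> f ` S" and "0 < d" for z d
    proof -
      obtain x where x: "x \<in> S" "z = f x" using z by blast
      obtain \<rho> where \<rho>: "\<rho> > 0" "ball x \<rho> \<subseteq> U"
        using U x openE by blast
      obtain y where y: "y \<noteq> x" "\<bar>y - x\<bar> < min \<rho> (d / p)" "(f y - f x) / (y - x) \<le> p"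
        using slow[OF x(1), of "min \<rho> (d / p)"] \<rho> \<open>p > 0\<close> \<open>0 < d\<close> by auto
      define u v where "u = min x y" and "v = max x y"
      have uv: "u < v" "v - u = \<bar>y - x\<bar>" using y by (auto simp: u_def v_def)
      have quot: "f v - f u \<le> p * (v - u)"
        using y by (cases "x < y") (auto simp: u_def v_def field_simps)
      have "{u..v} \<subseteq> ball x \<rho>"
        using y by (auto simp: u_def v_def dist_real_def)
      then have K: "(u,v) \<in> K" using uv quot \<rho> by (auto simp: K_def)
      have "f u \<le> f x" "f x \<le> f v"
        using mono by (auto simp: u_def v_def strict_mono_less_eq)
      then have "z \<in> cball (a (u,v)) (r (u,v))" using x by (auto simp: cb)
      moreover have "r (u,v) < d"
      proof -
        have "p * (v - u) < d" using y uv \<open>p > 0\<close> by (simp add: field_simps)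
        then show ?thesis using quot \<open>0 < d\<close> by (auto simp: r_def)
      qed
      ultimately show ?thesis using K by blast
    qed
  qed
  let ?J = "\<lambda>i. {fst i..snd i}"
  have disj: "disjnt (?J i) (?J j)" if "i \<in> C" "j \<in> C" "i \<noteq> j" for i j
  proof -
    have "disjnt {f (fst i) .. f (snd i)} {f (fst j) .. f (snd j)}"
      using C(3) that by (auto simp: pairwise_def cb)
    then have "\<not> (f (fst i) \<le> f x \<and> f x \<le> f (snd i) \<and> f (fst j) \<le> f x \<and> f x \<le> f (snd j))" for x
      unfolding disjnt_iff atLeastAtMost_iff by blast
    then show ?thesis
      unfolding strict_mono_less_eq[OF mono] disjnt_iff atLeastAtMost_iff by blast
  qed
  have bound: "measure lebesgue (\<Union>i\<in>D. cball (a i) (r i)) \<le> p * measure lebesgue U"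
    if "D \<subseteq> C" "finite D" for D
  proof -
    have "measure lebesgue (\<Union>i\<in>D. cball (a i) (r i)) \<le> (\<Sum>i\<in>D. measure lebesgue (cball (a i) (r i)))"
      using that by (intro measure_UNION_le) auto
    also have "\<dots> \<le> (\<Sum>i\<in>D. p * measure lebesgue (?J i))"
    proof (rule sum_mono)
      fix i assume "i \<in> D"
      then have "i \<in> K" using that C by auto
      then show "measure lebesgue (cball (a i) (r i)) \<le> p * measure lebesgue (?J i)"
        using mono by (auto simp: cb K_def strict_mono_less_eq)
    qed
    also have "\<dots> = p * (\<Sum>i\<in>D. measure lebesgue (?J i))"
      by (simp add: sum_distrib_left)
    also have "(\<Sum>i\<in>D. measure lebesgue (?J i)) = measure lebesgue (\<Union>i\<in>D. ?J i)"
    proof (intro measure_finite_Union[symmetric])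
      show "disjoint_family_on ?J D"
        unfolding disjoint_family_on_def using disj that by (metis disjnt_def subsetD)
    qed (use that in \<open>auto simp: emeasure_lborel_Icc_eq\<close>)
    also have "\<dots> \<le> measure lebesgue U"
    proof (intro measure_mono_fmeasurable)
      show "(\<Union>i\<in>D. ?J i) \<subseteq> U" using that C(2) unfolding K_def by fastforce
      show "(\<Union>i\<in>D. ?J i) \<in> sets lebesgue" using that by (intro sets.finite_UN) auto
    qed (use U in auto)
    finally show ?thesis using \<open>p > 0\<close> by simp
  qed
  let ?W = "\<Union>i\<in>C. cball (a i) (r i)"
  have W: "?W \<in> lmeasurable" "measure lebesgue ?W \<le> p * measure lebesgue U"
    using fmeasurable_UN_bound[OF C(1) _ bound] measure_UN_bound[OF C(1) _ bound] by auto
  have N: "f ` S - ?W \<in> null_sets lebesgue"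
    using C(4) by (simp add: negligible_iff_null_sets)
  show ?thesis
  proof (rule that[of "?W \<union> (f ` S - ?W)"])
    show "?W \<union> (f ` S - ?W) \<in> lmeasurable"
      using W(1) N by (metis fmeasurable.Un fmeasurableI_null_sets)
    show "measure lebesgue (?W \<union> (f ` S - ?W)) \<le> p * measure lebesgue U"
      using W N by (metis measure_Un_null_set fmeasurableD)
  qed auto
qed

lemma lmeasurable_open_cover:
  fixes S :: "real set"
  assumes "S \<in> lmeasurable" "e > 0"
  obtains U where "open U" "S \<subseteq> U" "U \<in> lmeasurable" "measure lebesgue U \<le> measure lebesgue S + e"
proof -
  obtain T where T: "open T" "S \<subseteq> T" "T - S \<in> lmeasurable" "emeasure lebesgue (T - S) < ennreal e"
    using sets_lebesgue_outer_open[of S e] assms by (metis fmeasurableD)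
  have eq: "T = S \<union> (T - S)" using T by auto
  have "T \<in> lmeasurable" using eq T assms by (metis fmeasurable.Un)
  moreover have "measure lebesgue T \<le> measure lebesgue S + measure lebesgue (T - S)"
    using eq T assms by (metis measure_Un_le fmeasurableD)
  moreover have "measure lebesgue (T - S) \<le> e"
    using T assms by (simp add: emeasure_eq_measure2 ennreal_less_iff)
  ultimately show ?thesis using that T by fastforce
qed

text \<open>
  Going from \<open>S\<close> to \<open>f ` S\<close> multiplies the outer measure by at most \<open>p\<close>. The inverse of \<open>f\<close> has
  difference quotients of at most \<open>1 / q\<close> at arbitrarily small scales, so coming back multiplies it
  by at most \<open>1 / q\<close>. As \<open>p < q\<close>, the outer measure of \<open>S\<close> is zero.
\<close>

lemma negligible_quotient_gap:
  fixes f :: "real \<Rightarrow> real"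
  assumes "0 < m" and lo: "\<And>x y. x \<le> y \<Longrightarrow> m * (y - x) \<le> f y - f x"
    and hi: "\<And>x y. x \<le> y \<Longrightarrow> f y - f x \<le> M * (y - x)"
    and pq: "0 < p" "p < q" and "bounded S"
    and slow: "\<And>x d. x \<in> S \<Longrightarrow> d > 0 \<Longrightarrow> \<exists>y. y \<noteq> x \<and> \<bar>y - x\<bar> < d \<and> (f y - f x) / (y - x) \<le> p"
    and fast: "\<And>x d. x \<in> S \<Longrightarrow> d > 0 \<Longrightarrow> \<exists>y. y \<noteq> x \<and> \<bar>y - x\<bar> < d \<and> (f y - f x) / (y - x) \<ge> q"
  shows "negligible S"
proof -
  note mono = increasing_bilipschitz(1)[OF assms(1-3)] and lip = increasing_bilipschitz(2)[OF assms(1-3)]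
  obtain g where fg: "\<And>z. f (g z) = z" and gf: "\<And>x. g (f x) = x" and "0 < M"
    and g: "\<And>x y. x \<le> y \<Longrightarrow> (1 / M) * (y - x) \<le> g y - g x" "\<And>x y. x \<le> y \<Longrightarrow> g y - g x \<le> (1 / m) * (y - x)"
    using increasing_bilipschitz_inverse[OF assms(1-3)] by blast
  have "0 < 1 / M" using \<open>0 < M\<close> by simp
  note gmono = increasing_bilipschitz(1)[OF this g] and glip = increasing_bilipschitz(2)[OF this g]
  note cont = lipschitz_on_continuous_on[OF lip] and gcont = lipschitz_on_continuous_on[OF glip]
  have up: "\<bar>f y - f x\<bar> \<le> M * \<bar>y - x\<bar>" for x y
    using lipschitz_onD[OF lip, of y x] by (simp add: dist_real_def)
  have gslow: "\<exists>w. w \<noteq> z \<and> \<bar>w - z\<bar> < d \<and> (g w - g z) / (w - z) \<le> 1 / q" if z: "z \<in> f ` S" and "d > 0" for z d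
  proof -
    obtain x where x: "x \<in> S" "z = f x" using z by blast
    obtain y where y: "y \<noteq> x" "\<bar>y - x\<bar> < d / M" "(f y - f x) / (y - x) \<ge> q"
      using fast[OF x(1), of "d / M"] \<open>d > 0\<close> \<open>0 < M\<close> by auto
    have "f y \<noteq> f x" using y mono by (simp add: strict_mono_eq)
    moreover have "\<bar>f y - f x\<bar> < d"
    proof -
      have "M * \<bar>y - x\<bar> < d" using y \<open>0 < M\<close> by (simp add: field_simps)
      then show ?thesis using up[of y x] by linarith
    qed
    moreover have "(y - x) / (f y - f x) \<le> 1 / q"
    proof -
      have "inverse ((f y - f x) / (y - x)) \<le> inverse q"
        using y pq by (intro le_imp_inverse_le) auto
      then show ?thesis by (simp add: inverse_eq_divide)
    qed
    ultimately show ?thesis using x by (intro exI[of _ "f y"]) (auto simp: gf)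
  qed
  define A where "A = {measure lebesgue U | U. open U \<and> U \<in> lmeasurable \<and> S \<subseteq> U}"
  define \<mu> where "\<mu> = Inf A"
  have A0: "bdd_below A" by (rule bdd_belowI[of _ 0]) (auto simp: A_def)
  have Ane: "A \<noteq> {}"
  proof -
    obtain R where "S \<subseteq> ball 0 R" using \<open>bounded S\<close> bounded_subset_ballD by blast
    then have "measure lebesgue (ball (0::real) R) \<in> A" unfolding A_def using lmeasurable_ball by blast
    then show ?thesis by blast
  qed
  \<comment> \<open>one round trip through \<open>f\<close> and its inverse, with error \<open>e\<close> in each choice of an open cover\<close>
  have step: "\<mu> \<le> (p * (\<mu> + e) + e) / q + e" if "e > 0" for e
  proof -
    obtain U where U: "open U" "U \<in> lmeasurable" "S \<subseteq> U" "measure lebesgue U < \<mu> + e"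
      using cInf_lessD[OF Ane, of "\<mu> + e"] \<open>e > 0\<close> by (auto simp: \<mu>_def A_def)
    obtain V where V: "V \<in> lmeasurable" "f ` S \<subseteq> V" "measure lebesgue V \<le> p * measure lebesgue U"
      using Vitali_image_bound[OF mono cont U(1-3) pq(1) slow] by blast
    obtain V' where V': "open V'" "V \<subseteq> V'" "V' \<in> lmeasurable" "measure lebesgue V' \<le> measure lebesgue V + e"
      using lmeasurable_open_cover[OF V(1) \<open>e > 0\<close>] by blast
    have "f ` S \<subseteq> V'" "0 < 1 / q" using V V' pq by auto
    then obtain U2 where U2: "U2 \<in> lmeasurable" "g ` f ` S \<subseteq> U2"
       "measure lebesgue U2 \<le> (1 / q) * measure lebesgue V'"
      using Vitali_image_bound[OF gmono gcont V'(1) V'(3) _ _ gslow] by blast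
    obtain U3 where U3: "open U3" "U2 \<subseteq> U3" "U3 \<in> lmeasurable" "measure lebesgue U3 \<le> measure lebesgue U2 + e"
      using lmeasurable_open_cover[OF U2(1) \<open>e > 0\<close>] by blast
    have "S \<subseteq> U3" using U2 U3 by (auto simp: image_image gf)
    then have "\<mu> \<le> measure lebesgue U3"
      unfolding \<mu>_def using U3 by (intro cInf_lower A0) (unfold A_def, blast)
    also have "\<dots> \<le> (1/q) * measure lebesgue V' + e" using U2 U3 by linarith
    also have "\<dots> \<le> (1/q) * (p * (\<mu> + e) + e) + e"
    proof -
      have "p * measure lebesgue U \<le> p * (\<mu> + e)" using U pq by simp
      then have "measure lebesgue V' \<le> p * (\<mu> + e) + e" using V V' by linarith
      then show ?thesis using pq by (simp add: divide_right_mono)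
    qed
    finally show ?thesis by simp
  qed
  have "((\<lambda>e. (p * (\<mu> + e) + e) / q + e) \<longlongrightarrow> (p * (\<mu> + 0) + 0) / q + 0) (at_right 0)"
    using pq by (intro tendsto_intros) auto
  moreover have "\<forall>\<^sub>F e in at_right 0. \<mu> \<le> (p * (\<mu> + e) + e) / q + e"
    using eventually_at_right_less[of "0::real"] by eventually_elim (rule step)
  ultimately have "\<mu> \<le> p * \<mu> / q"
    using tendsto_lowerbound[of "\<lambda>e. (p * (\<mu> + e) + e) / q + e" _ "at_right 0" \<mu>] by simp
  then have "(q - p) * \<mu> \<le> 0" using pq by (simp add: field_simps)
  then have "\<mu> \<le> 0" using pq by (simp add: mult_le_0_iff)
  show ?thesis
    unfolding negligible_outer
  proof (intro allI impI)
    fix e :: real assume "e > 0"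
    then have "Inf A < e" using \<open>\<mu> \<le> 0\<close> by (simp add: \<mu>_def)
    then show "\<exists>T. S \<subseteq> T \<and> T \<in> lmeasurable \<and> measure lebesgue T < e"
      using cInf_lessD[OF Ane] by (auto simp: A_def)
  qed
qed

text \<open>
  Adding a steep linear function makes all difference quotients lie in \<open>{m..3 * m}\<close>. Where the
  quotients have no limit, two rationals separate their lower from their upper limit, and for
  each such pair \<open>negligible_quotient_gap\<close> applies.
\<close>

lemma lipschitz_real_ae_differentiable:
  fixes f :: "real \<Rightarrow> real"
  assumes "L-lipschitz_on UNIV f"
  shows "negligible {x. \<not> f differentiable (at x)}"
proof -
  define m where "m = L + 1"
  have "m > 0" using lipschitz_on_nonneg[OF assms] by (simp add: m_def)
  have L: "\<bar>f y - f x\<bar> \<le> m * \<bar>y - x\<bar>" for x y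
    using lipschitz_onD[OF assms, of y x] lipschitz_on_nonneg[OF assms]
    by (auto simp: m_def dist_real_def algebra_simps)
  define g where "g = (\<lambda>x. f x + 2 * m * x)"
  have lo: "m * (y - x) \<le> g y - g x" and hi: "g y - g x \<le> 3 * m * (y - x)" if "x \<le> y" for x y
    using L[of y x] that by (auto simp: g_def algebra_simps abs_if split: if_splits)
  define Q where "Q = (\<lambda>x y. (g y - g x) / (y - x))"
  have Qb: "m \<le> Q x y \<and> Q x y \<le> 3 * m" if "y \<noteq> x" for x y
  proof (cases "x < y")
    case True
    then show ?thesis using lo[of x y] hi[of x y] by (auto simp: Q_def field_simps)
  next
    case False
    then have "y < x" using that by auto
    then show ?thesis using lo[of y x] hi[of y x] by (auto simp: Q_def field_simps)
  qed
  \<comment> \<open>the points with quotients below \<open>p\<close> and quotients above \<open>q\<close> at all scales\<close>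
  define E where "E = (\<lambda>p q. {x. (\<forall>d>0. \<exists>y. y \<noteq> x \<and> \<bar>y - x\<bar> < d \<and> Q x y \<le> p) \<and>
                              (\<forall>d>0. \<exists>y. y \<noteq> x \<and> \<bar>y - x\<bar> < d \<and> Q x y \<ge> q)})"
  have negE: "negligible (E p q)" if "p < q" for p q
  proof (cases "p > 0")
    case True
    have "negligible (E p q \<inter> {-real n..real n})" for n
      by (rule negligible_quotient_gap[OF \<open>m > 0\<close> lo hi True \<open>p < q\<close>])
         (auto simp: E_def Q_def intro: bounded_subset[OF bounded_closed_interval])
    then have "negligible (\<Union>n. E p q \<inter> {-real n..real n})"
      by (intro negligible_countable_Union) auto
    moreover have "E p q \<subseteq> (\<Union>n. E p q \<inter> {-real n..real n})"
    proof
      fix x assume "x \<in> E p q"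
      moreover obtain n where "\<bar>x\<bar> \<le> real n" using real_arch_simple by blast
      ultimately show "x \<in> (\<Union>n. E p q \<inter> {-real n..real n})" by (auto simp: abs_le_iff intro!: exI[of _ n])
    qed
    ultimately show ?thesis using negligible_subset by blast
  next
    case False
    have "E p q = {}"
    proof (safe, goal_cases)
      case (1 x)
      then obtain y where "y \<noteq> x" "Q x y \<le> p" by (auto simp: E_def dest!: spec[of _ "1::real"])
      then show ?case using Qb[of y x] False \<open>m > 0\<close> by auto
    qed
    then show ?thesis by simp
  qed
  have conv: "g differentiable (at x)" if x: "\<And>p q. p \<in> \<rat> \<Longrightarrow> q \<in> \<rat> \<Longrightarrow> p < q \<Longrightarrow> x \<notin> E p q" for x
  proof -
    define P where "P = {c. \<forall>\<^sub>F y in at x. Q x y < c}"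
    define l where "l = Inf P"
    have "\<forall>\<^sub>F y in at x. Q x y < 3 * m + 1"
      unfolding eventually_at using Qb by (intro exI[of _ 1]) (force simp: add_pos_pos)
    then have Pne: "P \<noteq> {}" by (auto simp: P_def)
    have Pb: "bdd_below P"
    proof (rule bdd_belowI[of _ m])
      fix c assume "c \<in> P"
      then have "\<forall>\<^sub>F y in at x. Q x y < c \<and> y \<noteq> x"
        by (auto simp: P_def eventually_conj_iff eventually_neq_at_within)
      then obtain y where "Q x y < c" "y \<noteq> x"
        using eventually_happens'[of "at x"] by auto
      then show "m \<le> c" using Qb[of y x] by linarith
    qed
    have "(Q x \<longlongrightarrow> l) (at x)"
    proof (rule order_tendstoI)
      fix c assume "l < c"
      then obtain c' where "c' \<in> P" "c' < c" using cInf_lessD[OF Pne] by (auto simp: l_def)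
      then show "\<forall>\<^sub>F y in at x. Q x y < c" by (auto simp: P_def elim: eventually_mono)
    next
      fix c assume "c < l"
      show "\<forall>\<^sub>F y in at x. c < Q x y"
      proof (rule ccontr)
        assume freq: "\<not> (\<forall>\<^sub>F y in at x. c < Q x y)"
        obtain p where p: "p \<in> \<rat>" "c < p" "p < l" using Rats_dense_in_real[OF \<open>c < l\<close>] by blast
        obtain q where q: "q \<in> \<rat>" "p < q" "q < l" using Rats_dense_in_real[OF \<open>p < l\<close>] by blast
        have "q \<notin> P" using q Pb cInf_lower[of q P] by (auto simp: l_def)
        then have freq2: "\<not> (\<forall>\<^sub>F y in at x. Q x y < q)" by (simp add: P_def)
        have "x \<in> E p q"
          using freq freq2 p unfolding E_def eventually_at dist_real_def
          by (simp add: not_less) (meson less_imp_le not_less order_trans)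
        then show False using x p q by auto
      qed
    qed
    then have "(g has_field_derivative l) (at x)"
      by (simp add: has_field_derivative_iff Q_def)
    then show ?thesis using field_differentiable_def field_differentiable_imp_differentiable by blast
  qed
  have "f differentiable (at x)" if "g differentiable (at x)" for x
  proof -
    have "(\<lambda>x. g x - 2 * m * x) differentiable (at x)"
      using that by (intro derivative_intros) auto
    then show ?thesis by (simp add: g_def)
  qed
  then have "{x. \<not> f differentiable (at x)} \<subseteq> (\<Union>(p,q) \<in> {(p,q). p \<in> \<rat> \<and> q \<in> \<rat> \<and> p < q}. E p q)"
    using conv by blast
  moreover have "negligible (\<Union>(p,q) \<in> {(p,q). p \<in> \<rat> \<and> q \<in> \<rat> \<and> p < q}. E p q)"
  proof (rule negligible_countable_Union)
    have "countable ((\<rat>::real set) \<times> (\<rat>::real set))" by (simp add: countable_rat)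
    then have "countable {(p,q). p \<in> (\<rat>::real set) \<and> q \<in> (\<rat>::real set) \<and> p < q}"
      by (rule countable_subset[rotated]) auto
    then show "countable ((\<lambda>(p, q). E p q) ` {(p, q). p \<in> \<rat> \<and> q \<in> \<rat> \<and> p < q})" by simp
  qed (auto intro: negE)
  ultimately show ?thesis using negligible_subset by blast
qed

section \<open>Integrals of densities along Lipschitz curves\<close>

definition lipschitz_curve :: "(real \<Rightarrow> 'a::metric_space) \<Rightarrow> bool" where
  "lipschitz_curve g \<longleftrightarrow> (\<exists>L. L-lipschitz_on UNIV g)"

text \<open>
  A Lipschitz curve fails to be differentiable only on a null set, so the arbitrary vector that
  stands for the derivative there does not affect the integral.
\<close>

definition action :: "('a::real_normed_vector \<Rightarrow> 'a \<Rightarrow> real) \<Rightarrow> (real \<Rightarrow> 'a) \<Rightarrow> real \<Rightarrow> real \<Rightarrow> real" where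
  "action \<Phi> g a b = integral {a..b} (\<lambda>t. \<Phi> (g t) (vector_derivative g (at t)))"

abbreviation path_length :: "(real \<Rightarrow> 'a::real_normed_vector) \<Rightarrow> real \<Rightarrow> real \<Rightarrow> real" where
  "path_length \<equiv> action (\<lambda>x v. norm v)"

text \<open>
  Positive homogeneity in the velocity makes the action invariant under increasing
  reparametrizations.
\<close>

definition lagrangian :: "('a::real_normed_vector \<Rightarrow> 'a \<Rightarrow> real) \<Rightarrow> bool" where
  "lagrangian \<Phi> \<longleftrightarrow> continuous_on UNIV (\<lambda>(x, v). \<Phi> x v) \<and>
                    (\<forall>x v c. c \<ge> 0 \<longrightarrow> \<Phi> x (c *\<^sub>R v) = c * \<Phi> x v)"

lemma lipschitz_curve_continuous: "lipschitz_curve g \<Longrightarrow> continuous_on S g"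
  unfolding lipschitz_curve_def by (metis continuous_on_subset lipschitz_on_continuous_on subset_UNIV)

lemma lipschitz_curve_obtains:
  assumes "lipschitz_curve g"
  obtains L where "L > 0" "L-lipschitz_on UNIV g"
proof -
  obtain K where "K-lipschitz_on UNIV g" using assms by (auto simp: lipschitz_curve_def)
  then have "(\<bar>K\<bar> + 1)-lipschitz_on UNIV g" by (rule lipschitz_on_le) auto
  then show ?thesis using that[of "\<bar>K\<bar> + 1"] by auto
qed

lemma lipschitz_curve_ae_differentiable:
  fixes g :: "real \<Rightarrow> 'a::euclidean_space"
  assumes "lipschitz_curve g"
  shows "negligible {t. \<not> g differentiable (at t)}"
proof -
  obtain L where L: "L-lipschitz_on UNIV g" using assms by (auto simp: lipschitz_curve_def)
  have "negligible {t. \<not> (\<lambda>x. g x \<bullet> i) differentiable (at t)}" if i: "i \<in> Basis" for i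
  proof (rule lipschitz_real_ae_differentiable)
    show "L-lipschitz_on UNIV (\<lambda>x. g x \<bullet> i)"
    proof (rule lipschitz_onI)
      fix x y :: real
      have "dist (g x \<bullet> i) (g y \<bullet> i) = \<bar>(g x - g y) \<bullet> i\<bar>"
        by (simp add: dist_real_def inner_diff_left)
      also have "\<dots> \<le> norm (g x - g y)" using i by (rule Basis_le_norm)
      also have "\<dots> \<le> L * dist x y" using lipschitz_onD[OF L, of x y] by (simp add: dist_norm)
      finally show "dist (g x \<bullet> i) (g y \<bullet> i) \<le> L * dist x y" .
    qed (rule lipschitz_on_nonneg[OF L])
  qed
  then have "negligible (\<Union>i\<in>Basis. {t. \<not> (\<lambda>x. g x \<bullet> i) differentiable (at t)})"
    by (intro negligible_Union) auto
  moreover have "{t. \<not> g differentiable (at t)} \<subseteq> (\<Union>i\<in>Basis. {t. \<not> (\<lambda>x. g x \<bullet> i) differentiable (at t)})"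
    by (subst differentiable_componentwise_within) auto
  ultimately show ?thesis using negligible_subset by blast
qed

lemma has_vector_derivative_difference_quotient:
  fixes g :: "real \<Rightarrow> 'a::real_normed_vector"
  assumes "(g has_vector_derivative d) (at t)"
  shows "((\<lambda>y. (1 / (y - t)) *\<^sub>R (g y - g t)) \<longlongrightarrow> d) (at t)"
proof -
  have "((\<lambda>y. norm ((g y - g t) - (y - t) *\<^sub>R d) / norm (y - t)) \<longlongrightarrow> 0) (at t)"
    using assms unfolding has_vector_derivative_def has_derivative_iff_norm by simp
  then have "((\<lambda>y. norm ((1 / (y - t)) *\<^sub>R (g y - g t) - d)) \<longlongrightarrow> 0) (at t)"
  proof (rule Lim_transform_eventually)
    have "norm ((g y - g t) - (y - t) *\<^sub>R d) / norm (y - t) = norm ((1 / (y - t)) *\<^sub>R (g y - g t) - d)" if "y \<noteq> t" for y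
    proof -
      have "(1 / (y - t)) *\<^sub>R (g y - g t) - d = (1 / (y - t)) *\<^sub>R ((g y - g t) - (y - t) *\<^sub>R d)"
        using that by (simp add: scaleR_diff_right)
      then show ?thesis by (simp del: scaleR_diff_right)
    qed
    then show "\<forall>\<^sub>F y in at t. norm ((g y - g t) - (y - t) *\<^sub>R d) / norm (y - t) = norm ((1 / (y - t)) *\<^sub>R (g y - g t) - d)"
      by (auto simp: eventually_at intro!: exI[of _ 1])
  qed
  then show ?thesis by (simp add: Lim_null[of _ d] tendsto_norm_zero_iff)
qed

lemma negligible_lipschitz_image:
  fixes h :: "real \<Rightarrow> real"
  assumes "negligible N" and "B-lipschitz_on UNIV h"
  shows "negligible (h ` N)"
proof (rule negligible_locally_Lipschitz_image[OF _ assms(1)])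
  fix x assume "x \<in> N"
  show "\<exists>T B. open T \<and> x \<in> T \<and> (\<forall>y\<in>N \<inter> T. norm (h y - h x) \<le> B * norm (y - x))"
    using lipschitz_onD[OF assms(2)] by (intro exI[of _ UNIV] exI[of _ B]) (auto simp: dist_norm)
qed simp

lemma norm_vector_derivative_le_lipschitz:
  fixes g :: "real \<Rightarrow> 'a::real_normed_vector"
  assumes L: "L-lipschitz_on UNIV g" and d: "g differentiable (at t)"
  shows "norm (vector_derivative g (at t)) \<le> L"
proof -
  have "(g has_vector_derivative vector_derivative g (at t)) (at t)"
    using d vector_derivative_works by blast
  then have "((\<lambda>y. (1 / (y - t)) *\<^sub>R (g y - g t)) \<longlongrightarrow> vector_derivative g (at t)) (at t)"
    by (rule has_vector_derivative_difference_quotient)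
  then have "((\<lambda>y. norm ((1 / (y - t)) *\<^sub>R (g y - g t))) \<longlongrightarrow> norm (vector_derivative g (at t))) (at t)"
    by (rule tendsto_norm)
  moreover have "\<forall>\<^sub>F y in at t. norm ((1 / (y - t)) *\<^sub>R (g y - g t)) \<le> L"
    unfolding eventually_at
  proof (intro exI[of _ 1] conjI ballI impI)
    fix y assume "y \<noteq> t \<and> dist y t < 1"
    then show "norm ((1 / (y - t)) *\<^sub>R (g y - g t)) \<le> L"
      using lipschitz_onD[OF L, of y t]
      by (simp add: dist_norm pos_divide_le_eq del: scaleR_diff_right)
  qed simp
  ultimately show ?thesis using tendsto_upperbound by (metis trivial_limit_at)
qed

lemma integral_diff_negligible:
  fixes f :: "'n::euclidean_space \<Rightarrow> 'a::banach"
  assumes "negligible N"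
  shows "integral (S - N) f = integral S f" "f integrable_on (S - N) \<longleftrightarrow> f integrable_on S"
proof -
  have *: "(f has_integral y) (S - N) \<longleftrightarrow> (f has_integral y) S" for y
    by (rule has_integral_spike_set_eq) (auto intro: negligible_subset[OF assms])
  then show "f integrable_on (S - N) \<longleftrightarrow> f integrable_on S" by (auto simp: integrable_on_def)
  show "integral (S - N) f = integral S f" using * unfolding integral_def integrable_on_def by auto
qed

lemma integral_le_off_negligible:
  fixes f g :: "real \<Rightarrow> real"
  assumes "negligible N" "f integrable_on S" "g integrable_on S" "\<And>x. x \<in> S - N \<Longrightarrow> f x \<le> g x"
  shows "integral S f \<le> integral S g"
  using integral_le[of f "S - N" g, unfolded integral_diff_negligible[OF assms(1)], OF assms(2-4)] .

lemma continuous_on_quotient_density: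
  fixes g :: "real \<Rightarrow> 'a::real_normed_vector" and \<Phi> :: "'a \<Rightarrow> 'a \<Rightarrow> real"
  assumes g: "continuous_on UNIV g" and \<Phi>: "continuous_on UNIV (\<lambda>(x, v). \<Phi> x v)"
  shows "continuous_on S (\<lambda>t. \<Phi> (g t) (k *\<^sub>R (g (t + h) - g t)))"
proof -
  have 1: "continuous_on S (\<lambda>t. g (t + h))" "continuous_on S g"
    by (auto intro!: continuous_intros continuous_on_compose2[OF g] continuous_on_subset[OF g])
  have "continuous_on S (\<lambda>t. (\<lambda>(x, v). \<Phi> x v) (g t, k *\<^sub>R (g (t + h) - g t)))"
    by (rule continuous_on_compose2[OF \<Phi>]) (auto intro!: continuous_intros 1)
  then show ?thesis by simp
qed

lemma differentiable_quotient_LIMSEQ: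
  fixes g :: "real \<Rightarrow> 'a::real_normed_vector"
  assumes "g differentiable (at t)"
  shows "(\<lambda>n. real (Suc n) *\<^sub>R (g (t + 1 / real (Suc n)) - g t)) \<longlonglongrightarrow> vector_derivative g (at t)"
proof -
  have "(g has_vector_derivative vector_derivative g (at t)) (at t)"
    using assms vector_derivative_works by blast
  then have "((\<lambda>y. (1 / (y - t)) *\<^sub>R (g y - g t)) \<longlongrightarrow> vector_derivative g (at t)) (at t)"
    by (rule has_vector_derivative_difference_quotient)
  moreover have "filterlim (\<lambda>n. t + 1 / real (Suc n)) (at t) sequentially"
    unfolding filterlim_at
    using tendsto_add[OF tendsto_const LIMSEQ_inverse_real_of_nat, of t]
    by (auto simp: inverse_eq_divide)
  ultimately have "((\<lambda>n. (1 / (t + 1 / real (Suc n) - t)) *\<^sub>R (g (t + 1 / real (Suc n)) - g t)) \<longlongrightarrow> vector_derivative g (at t)) sequentially"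
    by (rule filterlim_compose)
  then show ?thesis by simp
qed

text \<open>
  Difference quotients of a Lipschitz curve are bounded by the Lipschitz constant and converge
  almost everywhere, so dominated convergence applies. This shows integrability, and it expresses
  the action through values of the curve alone, which survives pointwise limits of curves.
\<close>

lemma action_difference_quotients:
  fixes g :: "real \<Rightarrow> 'a::euclidean_space"
  assumes g: "lipschitz_curve g" and \<Phi>: "continuous_on UNIV (\<lambda>(x, v). \<Phi> x v)"
  shows "(\<lambda>t. \<Phi> (g t) (vector_derivative g (at t))) absolutely_integrable_on {a..b}"
    and "(\<lambda>n. integral {a..b} (\<lambda>t. \<Phi> (g t) (real (Suc n) *\<^sub>R (g (t + 1 / real (Suc n)) - g t)))) \<longlonglongrightarrow> action \<Phi> g a b"
proof -
  obtain L where L: "L > 0" "L-lipschitz_on UNIV g" using lipschitz_curve_obtains[OF g] .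
  define N where "N = {t. \<not> g differentiable (at t)}"
  have N: "negligible N" unfolding N_def by (rule lipschitz_curve_ae_differentiable[OF g])
  define q where "q = (\<lambda>n t. real (Suc n) *\<^sub>R (g (t + 1 / real (Suc n)) - g t))"
  define f where "f = (\<lambda>n t. \<Phi> (g t) (q n t))"
  define l where "l = (\<lambda>t. \<Phi> (g t) (vector_derivative g (at t)))"
  have qL: "norm (q n t) \<le> L" for n t
    using lipschitz_onD[OF L(2), of "t + 1 / real (Suc n)" t]
    by (auto simp: q_def dist_norm pos_le_divide_eq mult.commute simp del: of_nat_Suc scaleR_diff_right)
  have "compact (g ` {a..b} \<times> cball (0::'a) L)"
    by (intro compact_Times compact_continuous_image lipschitz_curve_continuous[OF g]) auto
  then have "bounded ((\<lambda>(x, v). \<Phi> x v) ` (g ` {a..b} \<times> cball (0::'a) L))"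
    by (intro compact_imp_bounded compact_continuous_image continuous_on_subset[OF \<Phi>]) auto
  then obtain C where C: "\<And>x v. x \<in> g ` {a..b} \<Longrightarrow> norm v \<le> L \<Longrightarrow> \<bar>\<Phi> x v\<bar> \<le> C"
    unfolding bounded_iff by force
  have fint: "f n integrable_on {a..b}" for n
    unfolding f_def q_def
    by (rule integrable_continuous_real, rule continuous_on_quotient_density[where g = g, OF lipschitz_curve_continuous[OF g] \<Phi>])
  have conv: "(\<lambda>n. f n t) \<longlonglongrightarrow> l t" if "t \<in> {a..b} - N" for t
  proof -
    have "(\<lambda>n. q n t) \<longlonglongrightarrow> vector_derivative g (at t)"
      unfolding q_def using that by (intro differentiable_quotient_LIMSEQ) (auto simp: N_def)
    then have "(\<lambda>n. (g t, q n t)) \<longlonglongrightarrow> (g t, vector_derivative g (at t))"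
      by (intro tendsto_intros)
    then have "(\<lambda>n. (\<lambda>(x, v). \<Phi> x v) (g t, q n t)) \<longlonglongrightarrow> (\<lambda>(x, v). \<Phi> x v) (g t, vector_derivative g (at t))"
      by (rule continuous_on_tendsto_compose[OF \<Phi>]) auto
    then show ?thesis by (simp add: f_def l_def)
  qed
  have fC: "norm (f n t) \<le> C" if "t \<in> {a..b} - N" for n t
    using that qL C by (auto simp: f_def)
  have fint': "f n integrable_on ({a..b} - N)" for n
    using fint integral_diff_negligible(2)[OF N] by blast
  have Cint: "(\<lambda>t. C) integrable_on ({a..b} - N)"
    using integral_diff_negligible(2)[OF N, of "\<lambda>t. C"] by (simp add: integrable_const_ivl)
  note dom = dominated_convergence[OF fint' Cint fC conv]
  have "l absolutely_integrable_on ({a..b} - N)"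
  proof (rule absolutely_integrable_integrable_bound[OF _ dom(1) Cint])
    fix t assume t: "t \<in> {a..b} - N"
    then have "norm (vector_derivative g (at t)) \<le> L"
      by (intro norm_vector_derivative_le_lipschitz[OF L(2)]) (auto simp: N_def)
    then show "norm (l t) \<le> C" using t C by (auto simp: l_def)
  qed
  then have "l absolutely_integrable_on {a..b}"
    unfolding absolutely_integrable_on_def using integral_diff_negligible(2)[OF N] by blast
  then show "(\<lambda>t. \<Phi> (g t) (vector_derivative g (at t))) absolutely_integrable_on {a..b}"
    by (simp add: l_def)
  show "(\<lambda>n. integral {a..b} (\<lambda>t. \<Phi> (g t) (real (Suc n) *\<^sub>R (g (t + 1 / real (Suc n)) - g t)))) \<longlonglongrightarrow> action \<Phi> g a b"
    using dom(2) unfolding action_def integral_diff_negligible(1)[OF N] f_def l_def q_def .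
qed

lemma lagrangian_norm: "lagrangian (\<lambda>x v. norm v)"
  unfolding lagrangian_def by (auto simp: case_prod_unfold intro!: continuous_intros)

lemma lagrangian_continuous: "lagrangian \<Phi> \<Longrightarrow> continuous_on UNIV (\<lambda>(x, v). \<Phi> x v)"
  by (simp add: lagrangian_def)

lemma action_integrable:
  fixes g :: "real \<Rightarrow> 'a::euclidean_space" and \<Phi> :: "'a \<Rightarrow> 'a \<Rightarrow> real"
  assumes "lipschitz_curve g" and "continuous_on UNIV (\<lambda>(x, v). \<Phi> x v)"
  shows "(\<lambda>t. \<Phi> (g t) (vector_derivative g (at t))) integrable_on {a..b}"
  using action_difference_quotients(1)[OF assms] absolutely_integrable_on_def by blast

text \<open>
  The integral telescopes into the difference of the averages of \<open>f\<close> over short intervals that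
  start at \<open>b\<close> and at \<open>a\<close>.
\<close>

lemma integral_shift_quotient_LIMSEQ:
  fixes f :: "real \<Rightarrow> real"
  assumes f: "continuous_on UNIV f" and "a \<le> b"
  shows "(\<lambda>n. integral {a..b} (\<lambda>t. real (Suc n) * (f (t + 1 / real (Suc n)) - f t))) \<longlonglongrightarrow> f b - f a"
proof -
  define A where "A = (\<lambda>x. integral {a-1..x} f)"
  have cf: "continuous_on S f" for S using f continuous_on_subset by blast
  have int: "f integrable_on {x..y}" for x y using integrable_continuous_real[OF cf] .
  have dA: "(A has_vector_derivative f x) (at x within UNIV)" if "x \<in> {a..b}" for x
  proof -
    have "(A has_real_derivative f x) (at x within {a-1..b+1})"
      unfolding A_def using that by (intro integral_has_real_derivative cf) auto
    moreover have "at x within {a-1..b+1} = at x"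
      using that by (intro at_within_interior) auto
    ultimately show ?thesis by (simp add: has_real_derivative_iff_has_vector_derivative)
  qed
  have lim: "(\<lambda>n. real (Suc n) *\<^sub>R (A (x + 1 / real (Suc n)) - A x)) \<longlonglongrightarrow> f x" if "x \<in> {a..b}" for x
    using differentiable_quotient_LIMSEQ[of A x] dA[OF that]
    by (metis differentiableI_vector vector_derivative_at)
  have split: "integral {x..y} f = A y - A x" if "a \<le> x" "x \<le> y" for x y
    using Henstock_Kurzweil_Integration.integral_combine[of "a-1" x y f] that int by (auto simp: A_def)
  have eq: "integral {a..b} (\<lambda>t. real (Suc n) * (f (t + 1 / real (Suc n)) - f t))
          = real (Suc n) *\<^sub>R (A (b + 1 / real (Suc n)) - A b) - real (Suc n) *\<^sub>R (A (a + 1 / real (Suc n)) - A a)" for n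
  proof -
    define h where "h = 1 / real (Suc n)"
    have h: "h > 0" by (simp add: h_def)
    have sh: "integral {a..b} (\<lambda>t. f (t + h)) = integral {a+h..b+h} f"
      using integral_shift[OF cf, of a b h] by (simp add: o_def)
    have i1: "(\<lambda>t. f (t + h)) integrable_on {a..b}"
      by (intro integrable_continuous_real continuous_on_compose2[OF f]) (auto intro!: continuous_intros)
    have "integral {a..b} (\<lambda>t. real (Suc n) * (f (t + h) - f t)) = real (Suc n) * (integral {a+h..b+h} f - integral {a..b} f)"
      using i1 int by (simp add: integral_diff sh)
    also have "\<dots> = real (Suc n) * (A (b+h) - A (a+h) - (A b - A a))"
      using split[of "a+h" "b+h"] split[of a b] h \<open>a \<le> b\<close> by simp
    finally show ?thesis by (simp add: h_def algebra_simps)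
  qed
  show ?thesis unfolding eq using \<open>a \<le> b\<close> by (intro tendsto_diff lim) auto
qed

text \<open>
  Both sides are the limit of the same integrals of difference quotients.
\<close>

lemma lipschitz_FTC:
  fixes f :: "real \<Rightarrow> real"
  assumes "lipschitz_curve f" "a \<le> b"
  shows "integral {a..b} (\<lambda>t. vector_derivative f (at t)) = f b - f a"
proof -
  have "(\<lambda>n. integral {a..b} (\<lambda>t. real (Suc n) *\<^sub>R (f (t + 1 / real (Suc n)) - f t))) \<longlonglongrightarrow> action (\<lambda>x v. v) f a b"
    by (rule action_difference_quotients(2)[OF assms(1), where \<Phi> = "\<lambda>x v. v"])
       (auto simp: case_prod_unfold intro!: continuous_intros)
  moreover have "(\<lambda>n. integral {a..b} (\<lambda>t. real (Suc n) *\<^sub>R (f (t + 1 / real (Suc n)) - f t))) \<longlonglongrightarrow> f b - f a"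
    using integral_shift_quotient_LIMSEQ[OF lipschitz_curve_continuous[OF assms(1)] assms(2)] by simp
  ultimately show ?thesis unfolding action_def using LIMSEQ_unique by blast
qed

lemma lipschitz_curve_inner:
  fixes g :: "real \<Rightarrow> 'a::real_inner"
  assumes "lipschitz_curve g" shows "lipschitz_curve (\<lambda>t. g t \<bullet> u)"
proof -
  obtain L where L: "L-lipschitz_on UNIV g" using assms by (auto simp: lipschitz_curve_def)
  have "(L * norm u)-lipschitz_on UNIV (\<lambda>t. g t \<bullet> u)"
  proof (rule lipschitz_onI)
    fix x y :: real
    have "dist (g x \<bullet> u) (g y \<bullet> u) = \<bar>(g x - g y) \<bullet> u\<bar>"
      by (simp add: dist_real_def inner_diff_left)
    also have "\<dots> \<le> norm (g x - g y) * norm u" by (rule Cauchy_Schwarz_ineq2)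
    also have "\<dots> \<le> (L * dist x y) * norm u"
      using lipschitz_onD[OF L, of x y] by (intro mult_right_mono) (auto simp: dist_norm)
    finally show "dist (g x \<bullet> u) (g y \<bullet> u) \<le> L * norm u * dist x y" by (simp add: mult_ac)
  qed (use lipschitz_on_nonneg[OF L] in auto)
  then show ?thesis by (auto simp: lipschitz_curve_def)
qed

lemma vector_derivative_inner:
  fixes g :: "real \<Rightarrow> 'a::real_inner"
  assumes "g differentiable (at t)"
  shows "vector_derivative (\<lambda>t. g t \<bullet> u) (at t) = vector_derivative g (at t) \<bullet> u"
proof -
  have "(g has_vector_derivative vector_derivative g (at t)) (at t)"
    using assms vector_derivative_works by blast
  then have "((\<lambda>t. g t \<bullet> u) has_vector_derivative vector_derivative g (at t) \<bullet> u) (at t)"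
    by (rule bounded_linear.has_vector_derivative[OF bounded_linear_inner_left])
  then show ?thesis by (rule vector_derivative_at)
qed

text \<open>
  The fundamental theorem is applied to the component of the curve in the direction
  \<open>g b - g a\<close>.
\<close>

lemma dist_le_length:
  fixes g :: "real \<Rightarrow> 'a::euclidean_space"
  assumes g: "lipschitz_curve g" and "a \<le> b"
  shows "norm (g b - g a) \<le> path_length g a b"
proof -
  define u where "u = g b - g a"
  have ci: "continuous_on UNIV (\<lambda>(x::'a, v::'a). norm v)" "continuous_on UNIV (\<lambda>(x::'a, v::'a). v \<bullet> u)"
    by (auto simp: case_prod_unfold intro!: continuous_intros)
  have "u \<bullet> u = integral {a..b} (\<lambda>t. vector_derivative (\<lambda>t. g t \<bullet> u) (at t))"
    using lipschitz_FTC[OF lipschitz_curve_inner[OF g] \<open>a \<le> b\<close>, of u]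
    by (simp add: u_def inner_diff_left)
  also have "\<dots> = integral {a..b} (\<lambda>t. vector_derivative g (at t) \<bullet> u)"
    by (rule integral_spike[OF lipschitz_curve_ae_differentiable[OF g]])
       (auto simp: vector_derivative_inner)
  also have "\<dots> \<le> integral {a..b} (\<lambda>t. norm (vector_derivative g (at t)) * norm u)"
    using action_integrable[OF g ci(1)] action_integrable[OF g ci(2)]
    by (intro integral_le integrable_on_mult_left) (auto intro: norm_cauchy_schwarz)
  also have "\<dots> = path_length g a b * norm u"
    by (simp add: action_def)
  finally have "norm u * norm u \<le> path_length g a b * norm u"
    by (simp add: power2_norm_eq_inner[symmetric] power2_eq_square)
  moreover have "path_length g a b \<ge> 0"
    unfolding action_def by (rule integral_nonneg[OF action_integrable[OF g ci(1)]]) auto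
  ultimately show ?thesis
    unfolding u_def[symmetric] by (cases "u = 0") auto
qed

lemma action_combine:
  fixes g :: "real \<Rightarrow> 'a::euclidean_space"
  assumes "lipschitz_curve g" "continuous_on UNIV (\<lambda>(x, v). \<Phi> x v)" "a \<le> b" "b \<le> c"
  shows "action \<Phi> g a c = action \<Phi> g a b + action \<Phi> g b c"
  unfolding action_def
  using Henstock_Kurzweil_Integration.integral_combine[OF assms(3,4) action_integrable[OF assms(1,2)]] by simp

lemma action_cong:
  assumes "\<And>t. t \<in> {a<..<b} \<Longrightarrow> g t = \<beta> t"
  shows "action \<Phi> g a b = action \<Phi> \<beta> a b"
  unfolding action_def
proof (rule integral_spike[of "{a, b}"])
  fix t assume "t \<in> {a..b} - {a, b}"
  then have t: "t \<in> {a<..<b}" by auto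
  have "vector_derivative g (at t) = vector_derivative \<beta> (at t)"
  proof (rule vector_derivative_cong_eq)
    show "\<forall>\<^sub>F s in nhds t. s \<in> UNIV \<longrightarrow> g s = \<beta> s"
      using eventually_nhds_in_open[OF open_greaterThanLessThan t] assms by (auto elim: eventually_mono)
  qed (use assms t in auto)
  then show "\<Phi> (\<beta> t) (vector_derivative \<beta> (at t)) = \<Phi> (g t) (vector_derivative g (at t))"
    using assms t by simp
qed auto

text \<open>
  The change of variables is carried out on the set where \<open>h\<close> is differentiable at \<open>t\<close> and \<open>g\<close> is
  differentiable at \<open>h t\<close>, where the chain rule holds. The lower bound on the growth of \<open>h\<close> makes
  its inverse Lipschitz, and hence the remaining parameters a null set.
\<close>

lemma action_reparam:
  fixes g :: "real \<Rightarrow> 'a::euclidean_space" and h :: "real \<Rightarrow> real"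
  assumes g: "lipschitz_curve g" and \<Phi>: "lagrangian \<Phi>"
    and m: "0 < m" "\<And>x y. x \<le> y \<Longrightarrow> m * (y - x) \<le> h y - h x" "\<And>x y. x \<le> y \<Longrightarrow> h y - h x \<le> M * (y - x)"
    and "c \<le> d"
  shows "action \<Phi> (g \<circ> h) c d = action \<Phi> g (h c) (h d)"
proof -
  have \<Phi>c: "continuous_on UNIV (\<lambda>(x, v). \<Phi> x v)" and \<Phi>h: "\<And>x v c. c \<ge> 0 \<Longrightarrow> \<Phi> x (c *\<^sub>R v) = c * \<Phi> x v"
    using \<Phi> by (auto simp: lagrangian_def)
  note mono = increasing_bilipschitz(1)[OF m] and lip = increasing_bilipschitz(2)[OF m]
  have h: "lipschitz_curve h" using lip by (auto simp: lipschitz_curve_def)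
  have hinj: "inj h" using strict_mono_eq[OF mono] by (auto intro: injI)
  have himg: "h ` {c..d} = {h c..h d}"
  proof
    show "h ` {c..d} \<subseteq> {h c..h d}" using strict_mono_less_eq[OF mono] by auto
    show "{h c..h d} \<subseteq> h ` {c..d}"
      using IVT'[of h c _ d] lipschitz_curve_continuous[OF h, of "{c..d}"] \<open>c \<le> d\<close> by force
  qed
  define N where "N = {t. \<not> g differentiable (at t)}"
  define D where "D = {t. \<not> h differentiable (at t)}"
  have N: "negligible N" unfolding N_def by (rule lipschitz_curve_ae_differentiable[OF g])
  have D: "negligible D" unfolding D_def by (rule lipschitz_curve_ae_differentiable[OF h])
  define P where "P = h -` N"
  have P: "negligible P"
  proof -
    obtain k where fg: "\<And>z. h (k z) = z" and gf: "\<And>x. k (h x) = x" and "0 < M"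
      and k: "\<And>x y. x \<le> y \<Longrightarrow> (1 / M) * (y - x) \<le> k y - k x" "\<And>x y. x \<le> y \<Longrightarrow> k y - k x \<le> (1 / m) * (y - x)"
      using increasing_bilipschitz_inverse[OF m] by blast
    have "0 < 1 / M" using \<open>0 < M\<close> by simp
    from increasing_bilipschitz(2)[OF this k] have "negligible (k ` N)"
      by (rule negligible_lipschitz_image[OF N])
    moreover have "P \<subseteq> k ` N" by (force simp: P_def gf intro: image_eqI[of _ k, OF gf[symmetric]])
    ultimately show ?thesis using negligible_subset by blast
  qed
  have MP: "negligible (D \<union> P)" using D P by (rule negligible_Un)
  define S where "S = {c..d} - (D \<union> P)"
  define h' where "h' = (\<lambda>t. vector_derivative h (at t))"
  define f where "f = (\<lambda>s. \<Phi> (g s) (vector_derivative g (at s)))"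
  have hM: "negligible (h ` D)" by (rule negligible_lipschitz_image[OF D lip])
  have hP: "negligible (h ` P)" using N by (rule negligible_subset) (auto simp: P_def)
  have hMP: "negligible (h ` (D \<union> P))" using negligible_Un[OF hM hP] by (simp add: image_Un)
  have hS: "h ` S = {h c..h d} - h ` (D \<union> P)"
    unfolding S_def himg[symmetric] using image_set_diff[OF hinj] by metis
  have der: "(h has_field_derivative h' t) (at t within S)" if "t \<in> S" for t
  proof -
    have "h differentiable (at t)" using that by (auto simp: S_def D_def)
    then have "(h has_vector_derivative h' t) (at t)" unfolding h'_def using vector_derivative_works by blast
    then show ?thesis
      by (simp add: has_real_derivative_iff_has_vector_derivative has_vector_derivative_at_within)
  qed
  have h'pos: "h' t \<ge> 0" if "t \<in> S" for t
  proof -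
    have d: "h differentiable (at t)" using that by (auto simp: S_def D_def)
    have "0 \<le> real (Suc n) *\<^sub>R (h (t + 1 / real (Suc n)) - h t)" for n
      using strict_mono_less_eq[OF mono] by simp
    then show ?thesis
      unfolding h'_def using differentiable_quotient_LIMSEQ[OF d] by (intro LIMSEQ_le_const) auto
  qed
  have Sset: "S \<in> sets lebesgue"
    unfolding S_def using negligible_imp_sets[OF MP] by auto
  have fabs: "f absolutely_integrable_on {h c..h d}"
    unfolding f_def by (rule action_difference_quotients(1)[OF g \<Phi>c])
  then have "f absolutely_integrable_on (h ` S)"
    unfolding absolutely_integrable_on_def hS using integral_diff_negligible(2)[OF hMP] by blast
  moreover have "integral (h ` S) f = action \<Phi> g (h c) (h d)"
    unfolding hS integral_diff_negligible(1)[OF hMP] action_def f_def ..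
  ultimately have "integral S (\<lambda>x. \<bar>h' x\<bar> * f (h x)) = action \<Phi> g (h c) (h d)"
    using has_absolute_integral_change_of_variables_1'[OF Sset der, of f "action \<Phi> g (h c) (h d)"] hinj
    by (simp add: inj_on_subset)
  moreover have "integral S (\<lambda>x. \<bar>h' x\<bar> * f (h x)) = integral S (\<lambda>t. \<Phi> ((g \<circ> h) t) (vector_derivative (g \<circ> h) (at t)))"
  proof (rule integral_cong)
    fix t assume t: "t \<in> S"
    then have "h differentiable (at t)" "g differentiable (at (h t))"
      by (auto simp: S_def D_def P_def N_def)
    then have "vector_derivative (g \<circ> h) (at t) = h' t *\<^sub>R vector_derivative g (at (h t))"
      unfolding h'_def by (rule vector_derivative_chain_at)
    then show "\<bar>h' t\<bar> * f (h t) = \<Phi> ((g \<circ> h) t) (vector_derivative (g \<circ> h) (at t))"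
      using h'pos[OF t] by (simp add: \<Phi>h f_def)
  qed
  ultimately show ?thesis
    unfolding S_def integral_diff_negligible(1)[OF MP] action_def by simp
qed

lemma action_reflect:
  fixes g :: "real \<Rightarrow> 'a::euclidean_space"
  assumes g: "lipschitz_curve g"
  shows "action \<Phi> (\<lambda>t. g (-t)) (-b) (-a) = action (\<lambda>x v. \<Phi> x (-v)) g a b"
proof -
  define N where "N = {t. \<not> g differentiable (at t)}"
  have N: "negligible N" unfolding N_def by (rule lipschitz_curve_ae_differentiable[OF g])
  have "negligible (uminus ` N)" by (rule negligible_lipschitz_image[OF N, of 1]) (auto simp: lipschitz_on_def dist_real_def)
  then have "action \<Phi> (\<lambda>t. g (-t)) (-b) (-a) = integral {-b..-a} (\<lambda>t. \<Phi> (g (-t)) (- vector_derivative g (at (-t))))"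
    unfolding action_def
  proof (rule integral_spike)
    fix t assume "t \<in> {-b..-a} - uminus ` N"
    then have "-t \<notin> N" by force
    then have "g differentiable (at (-t))" by (simp add: N_def)
    then have "vector_derivative (g \<circ> uminus) (at t) = vector_derivative uminus (at t) *\<^sub>R vector_derivative g (at (-t))"
      by (intro vector_derivative_chain_at) (auto intro!: derivative_intros)
    moreover have "vector_derivative uminus (at t) = (-1::real)"
      by (rule vector_derivative_at) (auto intro!: derivative_eq_intros)
    ultimately show "\<Phi> (g (-t)) (- vector_derivative g (at (-t))) = \<Phi> (g (-t)) (vector_derivative (\<lambda>t. g (-t)) (at t))"
      by (simp add: o_def)
  qed
  also have "\<dots> = action (\<lambda>x v. \<Phi> x (-v)) g a b"
    unfolding action_def by (rule Henstock_Kurzweil_Integration.integral_reflect_real)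
  finally show ?thesis .
qed

section \<open>Lower semicontinuity and compactness\<close>

definition clamp01 :: "real \<Rightarrow> real" where "clamp01 t = min 1 (max 0 t)"

text \<open>
  Curves are parametrized by \<open>{0..1}\<close> and continued by constants, so that shifted arguments and
  reparametrizations of the whole line make sense.
\<close>

definition curve :: "(real \<Rightarrow> 'a::metric_space) \<Rightarrow> bool" where
  "curve g \<longleftrightarrow> lipschitz_curve g \<and> (\<forall>t. g t = g (clamp01 t))"

lemma clamp01_simps [simp]: "t \<in> {0..1} \<Longrightarrow> clamp01 t = t" "t \<le> 0 \<Longrightarrow> clamp01 t = 0" "t \<ge> 1 \<Longrightarrow> clamp01 t = 1"
  "0 \<le> clamp01 t" "clamp01 t \<le> 1" "clamp01 (clamp01 t) = clamp01 t"
  by (auto simp: clamp01_def)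

lemma clamp01_mono: "s \<le> t \<Longrightarrow> clamp01 s \<le> clamp01 t"
  by (auto simp: clamp01_def)

lemma clamp01_diff: "s \<le> t \<Longrightarrow> clamp01 t - clamp01 s \<le> t - s"
  by (auto simp: clamp01_def)

lemma lipschitz_clamp01: "1-lipschitz_on UNIV clamp01"
  by (auto simp: lipschitz_on_def clamp01_def dist_real_def)

lemma curve_clamp01: "curve g \<Longrightarrow> g (clamp01 t) = g t"
  unfolding curve_def by metis

lemma curve_lipschitz: "curve g \<Longrightarrow> lipschitz_curve g"
  by (simp add: curve_def)

lemma curveI:
  assumes "L-lipschitz_on {0..1} g"
  shows "curve (g \<circ> clamp01)"
proof -
  have "L-lipschitz_on (clamp01 ` UNIV) g"
    using assms by (rule lipschitz_on_subset) auto
  then have "(L * 1)-lipschitz_on UNIV (g \<circ> clamp01)"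
    by (intro lipschitz_on_compose lipschitz_clamp01)
  then show ?thesis by (auto simp: curve_def lipschitz_curve_def)
qed

lemma length_le_lipschitz:
  fixes g :: "real \<Rightarrow> 'a::euclidean_space"
  assumes L: "L-lipschitz_on UNIV g" and "a \<le> b"
  shows "path_length g a b \<le> L * (b - a)"
proof -
  have g: "lipschitz_curve g" using L by (auto simp: lipschitz_curve_def)
  define N where "N = {t. \<not> g differentiable (at t)}"
  have N: "negligible N" unfolding N_def by (rule lipschitz_curve_ae_differentiable[OF g])
  have "integral {a..b} (\<lambda>t. norm (vector_derivative g (at t))) \<le> integral {a..b} (\<lambda>t. L)"
    by (rule integral_le_off_negligible[OF N action_integrable[OF g lagrangian_continuous[OF lagrangian_norm]]])
       (auto simp: N_def norm_vector_derivative_le_lipschitz[OF L] integrable_const_ivl)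
  then show ?thesis unfolding action_def using \<open>a \<le> b\<close> by (simp add: mult.commute)
qed

lemma lagrangian_zero: "lagrangian \<Phi> \<Longrightarrow> \<Phi> x 0 = 0"
  unfolding lagrangian_def by (metis mult_zero_left order_refl scaleR_zero_left)

lemma action_constant:
  assumes "lagrangian \<Phi>" and "\<And>t. t \<in> {a<..<b} \<Longrightarrow> g t = x"
  shows "action \<Phi> g a b = 0"
proof -
  have "action \<Phi> g a b = action \<Phi> (\<lambda>t. x) a b" by (rule action_cong) (use assms in auto)
  then show ?thesis by (simp add: action_def lagrangian_zero[OF assms(1)])
qed

text \<open>
  Jensen's inequality in the velocity. A density that is linear in the velocity satisfies it
  together with its negative, so lower semicontinuity of the action becomes continuity for it.
\<close>

definition convex_lagrangian :: "('a::euclidean_space \<Rightarrow> 'a \<Rightarrow> real) \<Rightarrow> bool" where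
  "convex_lagrangian \<Phi> \<longleftrightarrow> lagrangian \<Phi> \<and>
     (\<forall>x a b g. lipschitz_curve g \<longrightarrow> a \<le> b \<longrightarrow>
        \<Phi> x (g b - g a) \<le> integral {a..b} (\<lambda>t. \<Phi> x (vector_derivative g (at t))))"

text \<open>
  Let \<open>e t\<close> be the action up to time \<open>t\<close>. By Jensen's inequality the difference quotient at \<open>t\<close>
  costs at most \<open>(e (t + h) - e t) / h\<close>, up to the oscillation \<open>\<epsilon>\<close> of the density over a time
  step. The average of this quotient over \<open>{0..1}\<close> telescopes; since \<open>e\<close> is constant after
  time \<open>1\<close>, it differs from \<open>e 1\<close> only through the values of \<open>e\<close> on \<open>{0..h}\<close>.
\<close>

lemma shift_quotient_le_action:
  fixes g :: "real \<Rightarrow> 'a::euclidean_space" and \<Phi> :: "'a \<Rightarrow> 'a \<Rightarrow> real"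
  assumes cvx: "convex_lagrangian \<Phi>"
    and L: "\<Lambda>-lipschitz_on UNIV g" and const: "\<And>t. t \<ge> 1 \<Longrightarrow> g t = g 1"
    and R: "\<And>t. norm (g t) \<le> R"
    and C: "\<And>x v. norm x \<le> R \<Longrightarrow> norm v \<le> \<Lambda> \<Longrightarrow> \<bar>\<Phi> x v\<bar> \<le> C"
    and mod: "\<And>x y v. norm x \<le> R \<Longrightarrow> norm y \<le> R \<Longrightarrow> norm v \<le> \<Lambda> \<Longrightarrow> dist x y \<le> \<Lambda> * h \<Longrightarrow> \<Phi> x v \<le> \<Phi> y v + \<epsilon>"
    and h: "0 < h"
  shows "integral {0..1} (\<lambda>t. \<Phi> (g t) ((1/h) *\<^sub>R (g (t + h) - g t))) \<le> action \<Phi> g 0 1 + C * h + \<epsilon>"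
proof -
  have \<Phi>: "lagrangian \<Phi>" using cvx by (simp add: convex_lagrangian_def)
  have g: "lipschitz_curve g" using L by (auto simp: lipschitz_curve_def)
  have \<Phi>c: "continuous_on UNIV (\<lambda>(x, v). \<Phi> x v)" and \<Phi>h: "\<And>x v c. c \<ge> 0 \<Longrightarrow> \<Phi> x (c *\<^sub>R v) = c * \<Phi> x v"
    using \<Phi> by (auto simp: lagrangian_def)
  have \<Phi>xc: "continuous_on UNIV (\<lambda>(y::'a, v). \<Phi> x v)" for x
  proof -
    have "continuous_on UNIV (\<lambda>z::'a \<times> 'a. (x, snd z))" by (intro continuous_intros)
    from continuous_on_compose2[OF \<Phi>c this] show ?thesis by (simp add: case_prod_unfold)
  qed
  define N where "N = {t. \<not> g differentiable (at t)}"
  have N: "negligible N" unfolding N_def by (rule lipschitz_curve_ae_differentiable[OF g])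
  note int = action_integrable[OF g \<Phi>c]
  define e where "e = (\<lambda>t. action \<Phi> g 0 t)"
  have vL: "norm (vector_derivative g (at t)) \<le> \<Lambda>" if "t \<notin> N" for t
    using norm_vector_derivative_le_lipschitz[OF L] that by (auto simp: N_def)
  \<comment> \<open>\<open>\<Phi> (g t)\<close> is replaced by \<open>\<Phi> (g s)\<close> under the integral, which costs \<open>\<epsilon>\<close> per unit of time\<close>
  have step: "\<Phi> (g t) (g (t + h) - g t) \<le> e (t + h) - e t + \<epsilon> * h" if t: "t \<ge> 0" for t
  proof -
    have "\<Phi> (g t) (g (t + h) - g t) \<le> integral {t..t+h} (\<lambda>s. \<Phi> (g t) (vector_derivative g (at s)))"
      using cvx g h by (simp add: convex_lagrangian_def)
    also have "\<dots> \<le> integral {t..t+h} (\<lambda>s. \<Phi> (g s) (vector_derivative g (at s)) + \<epsilon>)"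
    proof (rule integral_le_off_negligible[OF N action_integrable[OF g \<Phi>xc]])
      show "(\<lambda>s. \<Phi> (g s) (vector_derivative g (at s)) + \<epsilon>) integrable_on {t..t+h}"
        by (intro integrable_add int integrable_const_ivl)
      fix s assume s: "s \<in> {t..t+h} - N"
      have "dist (g t) (g s) \<le> \<Lambda> * dist t s" using lipschitz_onD[OF L] by auto
      also have "\<dots> \<le> \<Lambda> * h"
        using s h lipschitz_on_nonneg[OF L] by (intro mult_left_mono) (auto simp: dist_real_def)
      finally show "\<Phi> (g t) (vector_derivative g (at s)) \<le> \<Phi> (g s) (vector_derivative g (at s)) + \<epsilon>"
        using mod R vL s by auto
    qed
    also have "\<dots> = action \<Phi> g t (t+h) + \<epsilon> * h"
      unfolding action_def using h by (subst integral_add[OF int integrable_const_ivl]) auto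
    also have "action \<Phi> g t (t+h) = e (t + h) - e t"
      using action_combine[OF g \<Phi>c, of 0 t "t+h"] t h by (simp add: e_def)
    finally show ?thesis .
  qed
  have ebound: "\<bar>e t\<bar> \<le> C * t" if "t \<ge> 0" for t
  proof -
    have b: "- C \<le> \<Phi> (g s) (vector_derivative g (at s))" "\<Phi> (g s) (vector_derivative g (at s)) \<le> C"
      if "s \<in> {0..t} - N" for s
      using C[OF R vL, of s s] that by (auto simp: abs_le_iff)
    show ?thesis
      using integral_le_off_negligible[where S = "{0..t}", OF N int integrable_const_ivl b(2)]
        integral_le_off_negligible[where S = "{0..t}", OF N integrable_const_ivl int b(1)] that
      by (simp add: e_def action_def abs_le_iff mult.commute)
  qed
  have C0: "C \<ge> 0" using ebound[of 1] by auto
  have econt: "continuous_on {0..T} e" for T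
    unfolding e_def action_def by (rule indefinite_integral_continuous_1[OF int])
  have eint: "e integrable_on {a..b}" if "0 \<le> a" for a b
    by (rule integrable_continuous_real) (use that econt[of b] in \<open>auto intro: continuous_on_subset\<close>)
  have e1: "e t = e 1" if "t \<ge> 1" for t
  proof -
    have "action \<Phi> g 1 t = 0" by (rule action_constant[OF \<Phi>, of _ _ _ "g 1"], rule const, simp)
    then show ?thesis using action_combine[OF g \<Phi>c, of 0 1 t] that by (simp add: e_def)
  qed
  have sh: "integral {0..1} (\<lambda>t. e (t + h)) = integral {h..1+h} e"
    using integral_shift[of 0 h 1 e] continuous_on_subset[OF econt[of "1+h"], of "{h..1+h}"] h by (simp add: o_def)
  have shint: "(\<lambda>t. e (t + h)) integrable_on {0..1}"
    by (rule integrable_continuous_real, rule continuous_on_compose2[OF econt[of "1+h"]])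
       (use h in \<open>auto intro!: continuous_intros\<close>)
  have "integral {h..1+h} e + integral {0..h} e = integral {0..1+h} e"
    using Henstock_Kurzweil_Integration.integral_combine[of 0 h "1+h" e] h eint by auto
  moreover have "integral {0..1} e + integral {1..1+h} e = integral {0..1+h} e"
    using Henstock_Kurzweil_Integration.integral_combine[of 0 1 "1+h" e] h eint by auto
  moreover have "integral {1..1+h} e = h * e 1"
  proof -
    have "integral {1..1+h} e = integral {1..1+h} (\<lambda>t. e 1)"
      by (rule integral_cong, rule e1, simp)
    then show ?thesis using h by simp
  qed
  moreover have "- (C * h * h) \<le> integral {0..h} e"
  proof -
    have "integral {0..h} (\<lambda>t. - (C * h)) \<le> integral {0..h} e"
    proof (rule integral_le)
      fix t assume t: "t \<in> {0..h}"
      have "C * t \<le> C * h" using t C0 by (intro mult_left_mono) auto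
      then show "- (C * h) \<le> e t" using ebound[of t] t by auto
    qed (use eint in \<open>auto intro: integrable_const_ivl\<close>)
    then show ?thesis using h by (simp add: mult_ac)
  qed
  ultimately have tele: "integral {0..1} (\<lambda>t. e (t + h)) - integral {0..1} e \<le> h * e 1 + C * h * h"
    unfolding sh by linarith
  have "integral {0..1} (\<lambda>t. \<Phi> (g t) ((1/h) *\<^sub>R (g (t + h) - g t)))
      \<le> integral {0..1} (\<lambda>t. (1/h) * (e (t + h) - e t + \<epsilon> * h))"
  proof (rule integral_le)
    show "(\<lambda>t. \<Phi> (g t) ((1/h) *\<^sub>R (g (t + h) - g t))) integrable_on {0..1}"
      by (rule integrable_continuous_real, rule continuous_on_quotient_density[where g = g, OF lipschitz_curve_continuous[OF g] \<Phi>c])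
    show "(\<lambda>t. (1/h) * (e (t + h) - e t + \<epsilon> * h)) integrable_on {0..1}"
      by (intro integrable_on_mult_right integrable_add integrable_diff shint eint integrable_const_ivl) auto
    fix t :: real assume "t \<in> {0..1}"
    then show "\<Phi> (g t) ((1/h) *\<^sub>R (g (t + h) - g t)) \<le> (1/h) * (e (t + h) - e t + \<epsilon> * h)"
      using step[of t] h by (subst \<Phi>h) (auto simp: divide_right_mono)
  qed
  also have "\<dots> = (1/h) * (integral {0..1} (\<lambda>t. e (t + h)) - integral {0..1} e + \<epsilon> * h)"
    using shint eint[of 0 1]
    by (subst integral_mult_right, subst integral_add, (auto intro: integrable_diff)[2], subst integral_diff) auto
  also have "\<dots> \<le> (1/h) * (h * e 1 + C * h * h + \<epsilon> * h)"
    using tele h by (intro mult_left_mono) auto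
  also have "\<dots> = action \<Phi> g 0 1 + C * h + \<epsilon>"
    using h by (simp add: e_def field_simps)
  finally show ?thesis .
qed

text \<open>
  For a fixed shift \<open>h\<close> the averaged difference quotients converge with the curves, and
  \<open>shift_quotient_le_action\<close> bounds them by the actions uniformly along the sequence. Then \<open>h\<close>
  tends to zero.
\<close>

lemma action_lower_semicontinuous:
  fixes \<beta> :: "nat \<Rightarrow> real \<Rightarrow> 'a::euclidean_space" and \<Phi> :: "'a \<Rightarrow> 'a \<Rightarrow> real"
  assumes cvx: "convex_lagrangian \<Phi>"
    and L: "\<And>j. \<Lambda>-lipschitz_on UNIV (\<beta> j)" and const: "\<And>j t. t \<ge> 1 \<Longrightarrow> \<beta> j t = \<beta> j 1"
    and R: "\<And>j t. norm (\<beta> j t) \<le> R"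
    and lim: "\<And>t. (\<lambda>j. \<beta> j t) \<longlonglongrightarrow> \<alpha> t"
    and \<alpha>: "lipschitz_curve \<alpha>"
    and E: "(\<lambda>j. action \<Phi> (\<beta> j) 0 1) \<longlonglongrightarrow> E"
  shows "action \<Phi> \<alpha> 0 1 \<le> E"
proof -
  have \<Phi>c: "continuous_on UNIV (\<lambda>(x, v). \<Phi> x v)"
    using cvx by (auto simp: convex_lagrangian_def lagrangian_def)
  have L0: "\<Lambda> \<ge> 0" using lipschitz_on_nonneg[OF L[of 0]] .
  let ?K = "cball (0::'a) R \<times> cball (0::'a) \<Lambda>"
  have K: "compact ?K" by (intro compact_Times compact_cball)
  have \<Phi>K: "continuous_on ?K (\<lambda>(x, v). \<Phi> x v)" using \<Phi>c continuous_on_subset by blast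
  have "bounded ((\<lambda>(x, v). \<Phi> x v) ` ?K)"
    by (intro compact_imp_bounded compact_continuous_image \<Phi>K K)
  then obtain C where C: "\<And>x v. norm x \<le> R \<Longrightarrow> norm v \<le> \<Lambda> \<Longrightarrow> \<bar>\<Phi> x v\<bar> \<le> C"
    unfolding bounded_iff by force
  have uc: "uniformly_continuous_on ?K (\<lambda>(x, v). \<Phi> x v)"
    by (rule compact_uniformly_continuous[OF \<Phi>K K])
  show ?thesis
  proof (rule field_le_epsilon)
    fix \<epsilon> :: real assume "\<epsilon> > 0"
    obtain d where d: "d > 0" "\<And>z w. z \<in> ?K \<Longrightarrow> w \<in> ?K \<Longrightarrow> dist w z < d \<Longrightarrow>
          dist ((\<lambda>(x, v). \<Phi> x v) w) ((\<lambda>(x, v). \<Phi> x v) z) < \<epsilon>"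
      using uc \<open>\<epsilon> > 0\<close> unfolding uniformly_continuous_on_def by metis
    define h where "h = (\<lambda>n. 1 / real (Suc n))"
    have h0: "h n > 0" for n by (simp add: h_def)
    have hlim: "h \<longlonglongrightarrow> 0" unfolding h_def using LIMSEQ_inverse_real_of_nat by (simp add: inverse_eq_divide)
    define A where "A = (\<lambda>g n. integral {0..1} (\<lambda>t. \<Phi> (g t) ((1/h n) *\<^sub>R (g (t + h n) - g t))))"
    have quotL: "norm ((1/h n) *\<^sub>R (\<beta> j (t + h n) - \<beta> j t)) \<le> \<Lambda>" for j n t
      using lipschitz_onD[OF L[of j], of "t + h n" t] h0[of n]
      by (auto simp: dist_norm pos_divide_le_eq simp del: scaleR_diff_right)
    have A1: "A (\<beta> j) n \<le> action \<Phi> (\<beta> j) 0 1 + C * h n + \<epsilon>" if n: "\<Lambda> * h n < d" for j n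
      unfolding A_def
    proof (rule shift_quotient_le_action[OF cvx L const R C _ h0])
      fix x y v :: 'a assume xy: "norm x \<le> R" "norm y \<le> R" "norm v \<le> \<Lambda>" "dist x y \<le> \<Lambda> * h n"
      have "dist (x, v) (y, v) = dist x y" by (simp add: dist_Pair_Pair)
      then have "dist (\<Phi> x v) (\<Phi> y v) < \<epsilon>"
        using d(2)[of "(y, v)" "(x, v)"] xy n by auto
      then show "\<Phi> x v \<le> \<Phi> y v + \<epsilon>" by (auto simp: dist_real_def)
    qed
    have A2: "(\<lambda>j. A (\<beta> j) n) \<longlonglongrightarrow> A \<alpha> n" for n
      unfolding A_def
    proof (rule dominated_convergence(2)[where h = "\<lambda>t. C"])
      show "(\<lambda>t. \<Phi> (\<beta> j t) ((1/h n) *\<^sub>R (\<beta> j (t + h n) - \<beta> j t))) integrable_on {0..1}" for j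
        by (rule integrable_continuous_real, rule continuous_on_quotient_density[where g = "\<beta> j", OF lipschitz_on_continuous_on[OF L] \<Phi>c])
    next
      fix j :: nat and t :: real assume "t \<in> {0..1}"
      show "norm (\<Phi> (\<beta> j t) ((1/h n) *\<^sub>R (\<beta> j (t + h n) - \<beta> j t))) \<le> C"
        using C[OF R quotL] by simp
    next
      fix t :: real assume "t \<in> {0..1}"
      have "(\<lambda>j. (\<beta> j t, (1/h n) *\<^sub>R (\<beta> j (t + h n) - \<beta> j t))) \<longlonglongrightarrow> (\<alpha> t, (1/h n) *\<^sub>R (\<alpha> (t + h n) - \<alpha> t))"
        by (intro tendsto_intros lim)
      from continuous_on_tendsto_compose[OF \<Phi>c this]
      show "(\<lambda>j. \<Phi> (\<beta> j t) ((1/h n) *\<^sub>R (\<beta> j (t + h n) - \<beta> j t))) \<longlonglongrightarrow> \<Phi> (\<alpha> t) ((1/h n) *\<^sub>R (\<alpha> (t + h n) - \<alpha> t))"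
        by simp
    qed (rule integrable_const_ivl)
    have A3: "A \<alpha> n \<le> E + C * h n + \<epsilon>" if n: "\<Lambda> * h n < d" for n
    proof (rule LIMSEQ_le[OF A2])
      show "(\<lambda>j. action \<Phi> (\<beta> j) 0 1 + C * h n + \<epsilon>) \<longlonglongrightarrow> E + C * h n + \<epsilon>"
        by (intro tendsto_intros E)
    qed (use A1[OF n] in auto)
    have "(\<lambda>n. \<Lambda> * h n) \<longlonglongrightarrow> \<Lambda> * 0" by (intro tendsto_intros hlim)
    then have "\<forall>\<^sub>F n in sequentially. \<Lambda> * h n < d" using d(1) by (auto dest: order_tendstoD)
    then have ev: "\<forall>\<^sub>F n in sequentially. A \<alpha> n \<le> E + C * h n + \<epsilon>" by eventually_elim (rule A3)
    have "(\<lambda>n. A \<alpha> n) \<longlonglongrightarrow> action \<Phi> \<alpha> 0 1"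
      using action_difference_quotients(2)[OF \<alpha> \<Phi>c, of 0 1] by (simp add: A_def h_def)
    moreover have "(\<lambda>n. E + C * h n + \<epsilon>) \<longlonglongrightarrow> E + C * 0 + \<epsilon>"
      by (intro tendsto_intros hlim)
    ultimately show "action \<Phi> \<alpha> 0 1 \<le> E + \<epsilon>"
      using tendsto_le[OF _ _ _ ev] by fastforce
  qed
qed

text \<open>
  The new parameter is the arc length plus a small multiple of the old parameter. The multiple
  makes the parameter change bi-Lipschitz, so that \<open>action_reparam\<close> applies even where the curve
  stands still.
\<close>

lemma curve_constant_speed:
  fixes g :: "real \<Rightarrow> 'a::euclidean_space"
  assumes g: "curve g" and len: "path_length g 0 1 < \<Lambda>"
  obtains \<beta> where "curve \<beta>" "\<Lambda>-lipschitz_on UNIV \<beta>" "\<beta> 0 = g 0" "\<beta> 1 = g 1"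
    "\<And>\<Phi>. lagrangian \<Phi> \<Longrightarrow> action \<Phi> \<beta> 0 1 = action \<Phi> g 0 1"
proof -
  have gl: "lipschitz_curve g" using g by (rule curve_lipschitz)
  note nc = lagrangian_continuous[OF lagrangian_norm]
  define l where "l = path_length g 0 1"
  define v where "v = (\<lambda>t. path_length g 0 (clamp01 t))"
  obtain L where L: "L > 0" "L-lipschitz_on UNIV g" using lipschitz_curve_obtains[OF gl] .
  have vdiff: "v t - v s = path_length g (clamp01 s) (clamp01 t)" if "s \<le> t" for s t
    using action_combine[OF gl nc, of 0 "clamp01 s" "clamp01 t"] clamp01_mono[OF that] by (simp add: v_def)
  have vup: "v t - v s \<le> L * (t - s)" if "s \<le> t" for s t
  proof -
    have "v t - v s \<le> L * (clamp01 t - clamp01 s)"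
      using vdiff[OF that] length_le_lipschitz[OF L(2) clamp01_mono[OF that]] by simp
    also have "\<dots> \<le> L * (t - s)" using clamp01_diff[OF that] L by (intro mult_left_mono) auto
    finally show ?thesis .
  qed
  have vlow: "norm (g t - g s) \<le> v t - v s" if "s \<le> t" for s t
    using dist_le_length[OF gl clamp01_mono[OF that]] vdiff[OF that] curve_clamp01[OF g] by simp
  have l0: "0 \<le> l" using dist_le_length[OF gl, of 0 1] norm_ge_zero[of "g 1 - g 0"] unfolding l_def by linarith
  define m where "m = (\<Lambda> - l) / \<Lambda>"
  have \<Lambda>: "\<Lambda> > 0" using l0 len by (simp add: l_def)
  have m0: "m > 0" using len \<Lambda> by (simp add: m_def l_def)
  define s where "s = (\<lambda>t. m * t + v t / \<Lambda>)"
  define M where "M = m + L / \<Lambda>"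
  have slow: "m * (y - x) \<le> s y - s x" if "x \<le> y" for x y
  proof -
    have "0 \<le> v y - v x" using vlow[OF that] norm_ge_zero[of "g y - g x"] by linarith
    then have "0 \<le> (v y - v x) / \<Lambda>" using \<Lambda> by simp
    then show ?thesis by (simp add: s_def algebra_simps diff_divide_distrib)
  qed
  have sup: "s y - s x \<le> M * (y - x)" if "x \<le> y" for x y
  proof -
    have "(v y - v x) / \<Lambda> \<le> (L * (y - x)) / \<Lambda>" using vup[OF that] \<Lambda> by (intro divide_right_mono) auto
    then show ?thesis by (simp add: s_def M_def algebra_simps diff_divide_distrib add_divide_distrib)
  qed
  note smono = increasing_bilipschitz(1)[OF m0 slow sup]
  have s0: "s 0 = 0" by (simp add: s_def v_def action_def)
  have s1: "s 1 = 1" using \<Lambda> by (simp add: s_def v_def m_def l_def[symmetric] field_simps)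
  obtain h where sh: "\<And>z. s (h z) = z" and hs: "\<And>x. h (s x) = x" and M0: "0 < M"
    and hb: "\<And>x y. x \<le> y \<Longrightarrow> (1 / M) * (y - x) \<le> h y - h x" "\<And>x y. x \<le> y \<Longrightarrow> h y - h x \<le> (1 / m) * (y - x)"
    using increasing_bilipschitz_inverse[OF m0 slow sup] by blast
  have hmono: "h x \<le> h y \<longleftrightarrow> x \<le> y" for x y using strict_mono_less_eq[OF smono, of "h x" "h y"] by (simp add: sh)
  have h0: "h 0 = 0" and h1: "h 1 = 1" using hs[of 0] hs[of 1] s0 s1 by auto
  have \<beta>le: "norm (g (h y) - g (h x)) \<le> \<Lambda> * (y - x)" if "x \<le> y" for x y
  proof -
    have "norm (g (h y) - g (h x)) \<le> v (h y) - v (h x)" using vlow that by (simp add: hmono)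
    also have "\<dots> = \<Lambda> * (s (h y) - s (h x) - m * (h y - h x))" using \<Lambda> by (simp add: s_def field_simps)
    also have "\<dots> \<le> \<Lambda> * (s (h y) - s (h x))"
      using \<Lambda> m0 that by (intro mult_left_mono) (auto simp: hmono)
    finally show ?thesis by (simp add: sh)
  qed
  have \<beta>lip: "\<Lambda>-lipschitz_on UNIV (g \<circ> h)"
  proof (rule lipschitz_onI)
    fix x y
    show "dist ((g \<circ> h) x) ((g \<circ> h) y) \<le> \<Lambda> * dist x y"
      using \<beta>le[of x y] \<beta>le[of y x] by (cases "x \<le> y") (auto simp: dist_norm norm_minus_commute abs_if)
  qed (use \<Lambda> in simp)
  have \<beta>cl: "(g \<circ> h) t = (g \<circ> h) (clamp01 t)" for t
  proof -
    have "clamp01 (h t) = clamp01 (h (clamp01 t))"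
      using hmono[of t 0] hmono[of 1 t] h0 h1 by (cases "t \<le> 0"; cases "t \<ge> 1") auto
    then show ?thesis using curve_clamp01[OF g] by (metis comp_apply)
  qed
  show ?thesis
  proof (rule that)
    show "curve (g \<circ> h)" unfolding curve_def lipschitz_curve_def using \<beta>lip \<beta>cl by blast
    show "\<Lambda>-lipschitz_on UNIV (g \<circ> h)" by (rule \<beta>lip)
    show "action \<Phi> (g \<circ> h) 0 1 = action \<Phi> g 0 1" if "lagrangian \<Phi>" for \<Phi>
      using action_reparam[OF gl that _ hb, of 0 1] M0 h0 h1 by simp
  qed (simp_all add: h0 h1)
qed

text \<open>
  After reparametrization by \<open>curve_constant_speed\<close> the curves have a common Lipschitz constant,
  so the Arzela-Ascoli theorem gives a uniformly convergent subsequence.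
\<close>

lemma curves_compactness:
  fixes g :: "nat \<Rightarrow> real \<Rightarrow> 'a::euclidean_space"
  assumes g: "\<And>j. curve (g j)" and len: "\<And>j. path_length (g j) 0 1 \<le> \<Lambda>"
    and start: "\<And>j. norm (g j 0) \<le> R"
  obtains \<alpha> k where "strict_mono (k :: nat \<Rightarrow> nat)" "curve \<alpha>"
    "(\<lambda>j. g (k j) 0) \<longlonglongrightarrow> \<alpha> 0" "(\<lambda>j. g (k j) 1) \<longlonglongrightarrow> \<alpha> 1"
    "\<And>\<Phi> E. convex_lagrangian \<Phi> \<Longrightarrow>
       (\<lambda>j. action \<Phi> (g (k j)) 0 1) \<longlonglongrightarrow> E \<Longrightarrow> action \<Phi> \<alpha> 0 1 \<le> E"
proof -
  define K where "K = \<Lambda> + 1"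
  have "\<exists>\<beta>. curve \<beta> \<and> K-lipschitz_on UNIV \<beta> \<and> \<beta> 0 = g j 0 \<and> \<beta> 1 = g j 1 \<and>
        (\<forall>\<Phi>. lagrangian \<Phi> \<longrightarrow> action \<Phi> \<beta> 0 1 = action \<Phi> (g j) 0 1)" for j
  proof -
    have "path_length (g j) 0 1 < K" using len[of j] by (simp add: K_def)
    from curve_constant_speed[OF g this] show ?thesis by metis
  qed
  then obtain \<beta> where \<beta>: "\<And>j. curve (\<beta> j)" "\<And>j. K-lipschitz_on UNIV (\<beta> j)"
     "\<And>j. \<beta> j 0 = g j 0" "\<And>j. \<beta> j 1 = g j 1"
     "\<And>j \<Phi>. lagrangian \<Phi> \<Longrightarrow> action \<Phi> (\<beta> j) 0 1 = action \<Phi> (g j) 0 1"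
    by metis
  have K0: "K \<ge> 0" using lipschitz_on_nonneg[OF \<beta>(2)] .
  have bd: "norm (\<beta> j t) \<le> R + K" for j t
  proof -
    have "dist (\<beta> j (clamp01 t)) (\<beta> j 0) \<le> K * dist (clamp01 t) 0" using lipschitz_onD[OF \<beta>(2)] by blast
    also have "\<dots> \<le> K * 1" using K0 by (intro mult_left_mono) auto
    finally have "norm (\<beta> j t - \<beta> j 0) \<le> K" using curve_clamp01[OF \<beta>(1)] by (simp add: dist_norm)
    then show ?thesis using norm_triangle_sub[of "\<beta> j t" "\<beta> j 0"] start[of j] \<beta>(3)[of j] by simp
  qed
  obtain l k where gk: "continuous_on {0..1} l" "strict_mono (k :: nat \<Rightarrow> nat)"
     "\<And>e. 0 < e \<Longrightarrow> \<exists>N. \<forall>n x. n \<ge> N \<and> x \<in> {0..1} \<longrightarrow> norm (\<beta> (k n) x - l x) < e"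
  proof (rule Arzela_Ascoli[of "{0..1::real}" \<beta> "R + K"])
    fix x e :: real assume "x \<in> {0..1}" "0 < e"
    show "\<exists>d. 0 < d \<and> (\<forall>n y. y \<in> {0..1} \<and> norm (x - y) < d \<longrightarrow> norm (\<beta> n x - \<beta> n y) < e)"
    proof (intro exI[of _ "e / (K + 1)"] conjI allI impI)
      show "0 < e / (K + 1)" using \<open>0 < e\<close> K0 by simp
      fix n y assume y: "y \<in> {0..1} \<and> norm (x - y) < e / (K + 1)"
      have "norm (\<beta> n x - \<beta> n y) \<le> K * norm (x - y)"
        using lipschitz_onD[OF \<beta>(2), of x y n] by (simp add: dist_norm)
      also have "\<dots> \<le> (K + 1) * norm (x - y)" by (intro mult_right_mono) auto
      also have "\<dots> < e" using y K0 by (simp add: field_simps)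
      finally show "norm (\<beta> n x - \<beta> n y) < e" .
    qed
  qed (use bd in auto)
  define \<alpha> where "\<alpha> = l \<circ> clamp01"
  have lim: "(\<lambda>j. \<beta> (k j) t) \<longlonglongrightarrow> \<alpha> t" for t
  proof (rule LIMSEQ_I)
    fix e :: real assume "0 < e"
    from gk(3)[OF this] obtain N where "\<forall>n x. n \<ge> N \<and> x \<in> {0..1} \<longrightarrow> norm (\<beta> (k n) x - l x) < e" by blast
    then have "\<forall>n\<ge>N. norm (\<beta> (k n) (clamp01 t) - l (clamp01 t)) < e" by simp
    then show "\<exists>N. \<forall>n\<ge>N. norm (\<beta> (k n) t - \<alpha> t) < e"
      using curve_clamp01[OF \<beta>(1)] by (auto simp: \<alpha>_def)
  qed
  have \<alpha>lip: "K-lipschitz_on UNIV \<alpha>"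
  proof (rule lipschitz_onI[OF _ K0])
    fix x y :: real
    have "(\<lambda>j. dist (\<beta> (k j) x) (\<beta> (k j) y)) \<longlonglongrightarrow> dist (\<alpha> x) (\<alpha> y)" by (intro tendsto_intros lim)
    then show "dist (\<alpha> x) (\<alpha> y) \<le> K * dist x y"
      by (rule LIMSEQ_le_const2) (use lipschitz_onD[OF \<beta>(2)] in auto)
  qed
  then have \<alpha>c: "curve \<alpha>" by (auto simp: curve_def lipschitz_curve_def \<alpha>_def)
  show ?thesis
  proof (rule that[OF gk(2) \<alpha>c])
    show "(\<lambda>j. g (k j) 0) \<longlonglongrightarrow> \<alpha> 0" "(\<lambda>j. g (k j) 1) \<longlonglongrightarrow> \<alpha> 1"
      using lim[of 0] lim[of 1] by (simp_all add: \<beta>)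
    fix \<Phi> :: "'a \<Rightarrow> 'a \<Rightarrow> real" and E
    assume cvx: "convex_lagrangian \<Phi>" and E: "(\<lambda>j. action \<Phi> (g (k j)) 0 1) \<longlonglongrightarrow> E"
    have \<Phi>: "lagrangian \<Phi>" using cvx by (simp add: convex_lagrangian_def)
    show "action \<Phi> \<alpha> 0 1 \<le> E"
    proof (rule action_lower_semicontinuous[OF cvx \<beta>(2) _ bd lim])
      show "\<beta> (k i) t = \<beta> (k i) 1" if "t \<ge> 1" for i t
        using curve_clamp01[OF \<beta>(1), of "k i" t] that by simp
      show "(\<lambda>j. action \<Phi> (\<beta> (k j)) 0 1) \<longlonglongrightarrow> E" using E by (simp add: \<beta>(5)[OF \<Phi>])
    qed (use \<alpha>lip in \<open>auto simp: lipschitz_curve_def\<close>)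
  qed
qed

section \<open>Energy and signed area of plane curves\<close>

definition energy_density :: "(real ^ 2 \<Rightarrow> real) \<Rightarrow> real ^ 2 \<Rightarrow> real ^ 2 \<Rightarrow> real" where
  "energy_density F x v = F x * norm v"

definition area_density :: "real ^ 2 \<Rightarrow> real ^ 2 \<Rightarrow> real" where
  "area_density x v = - (x $ 2 * v $ 1)"

lemma lagrangian_energy_density:
  assumes "continuous_on UNIV F"
  shows "lagrangian (energy_density F)"
proof -
  have "continuous_on UNIV (\<lambda>z::(real^2) \<times> (real^2). F (fst z))"
    by (rule continuous_on_compose2[OF assms]) (auto intro!: continuous_intros)
  then show ?thesis
    unfolding lagrangian_def energy_density_def by (auto simp: case_prod_unfold intro!: continuous_intros)
qed

lemma lagrangian_area_density: "lagrangian area_density" "lagrangian (\<lambda>x v. - area_density x v)"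
  unfolding lagrangian_def area_density_def by (auto simp: case_prod_unfold intro!: continuous_intros)

lemma integral_vector_derivative_component:
  fixes g :: "real \<Rightarrow> real ^ 2"
  assumes g: "lipschitz_curve g" and "a \<le> b"
  shows "integral {a..b} (\<lambda>t. vector_derivative g (at t) $ i) = g b $ i - g a $ i"
proof -
  have "integral {a..b} (\<lambda>t. vector_derivative g (at t) $ i)
      = integral {a..b} (\<lambda>t. vector_derivative (\<lambda>t. g t \<bullet> axis i 1) (at t))"
    by (rule integral_spike[OF lipschitz_curve_ae_differentiable[OF g]])
       (use vector_derivative_inner[of g _ "axis i 1"] in \<open>simp add: inner_axis\<close>)
  then show ?thesis
    using lipschitz_FTC[OF lipschitz_curve_inner[OF g] \<open>a \<le> b\<close>, of "axis i 1"] by (simp add: inner_axis)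
qed

lemma convex_lagrangian_energy_density:
  assumes "continuous_on UNIV F" "\<And>x. F x \<ge> 0"
  shows "convex_lagrangian (energy_density F)"
  unfolding convex_lagrangian_def
proof (intro conjI allI impI)
  fix x :: "real ^ 2" and a b :: real and g :: "real \<Rightarrow> real ^ 2"
  assume "lipschitz_curve g" "a \<le> b"
  then show "energy_density F x (g b - g a) \<le> integral {a..b} (\<lambda>t. energy_density F x (vector_derivative g (at t)))"
    using mult_left_mono[OF dist_le_length assms(2)] by (simp add: energy_density_def action_def)
qed (rule lagrangian_energy_density[OF assms(1)])

lemma convex_lagrangian_area_density:
  "convex_lagrangian area_density" "convex_lagrangian (\<lambda>x v. - area_density x v)"
  using integral_vector_derivative_component[of _ _ _ 1]
  by (simp_all add: convex_lagrangian_def lagrangian_area_density) (simp_all add: area_density_def)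

lemma action_minus: "action (\<lambda>x v. - \<Phi> x v) g a b = - action \<Phi> g a b"
  by (simp add: action_def)

text \<open>
  One-sided and two-sided derivatives agree inside \<open>{0..1}\<close>, and the end points form a null
  set.
\<close>

lemma energy_eq_action: "energy F g = action (energy_density F) (g \<circ> clamp01) 0 1"
proof -
  have "action (energy_density F) (g \<circ> clamp01) 0 1 = action (energy_density F) g 0 1"
    by (rule action_cong) auto
  also have "\<dots> = energy F g"
    unfolding action_def energy_def energy_density_def
  proof (rule integral_spike[of "{0, 1}"])
    fix t :: real assume "t \<in> {0..1} - {0, 1}"
    then have "at t within {0..1} = at t" by (intro at_within_interior) auto
    then show "F (g t) * norm (vector_derivative g (at t within {0..1})) = F (g t) * norm (vector_derivative g (at t))"
      by simp
  qed auto
  finally show ?thesis ..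
qed

lemma signed_area_eq_action:
  fixes g :: "real \<Rightarrow> real ^ 2"
  assumes "L-lipschitz_on {0..1} g"
  shows "signed_area g = action area_density (g \<circ> clamp01) 0 1"
proof -
  let ?\<beta> = "g \<circ> clamp01"
  have \<beta>: "lipschitz_curve ?\<beta>" using curveI[OF assms] by (rule curve_lipschitz)
  define N where "N = {t. \<not> ?\<beta> differentiable (at t)}"
  have N: "negligible (N \<union> {0, 1})"
    unfolding N_def using lipschitz_curve_ae_differentiable[OF \<beta>] by simp
  have "integral {0..1} (\<lambda>t. g t $ 2 * vector_derivative (\<lambda>s. g s $ 1) (at t within {0..1}))
      = integral {0..1} (\<lambda>t. ?\<beta> t $ 2 * vector_derivative ?\<beta> (at t) $ 1)"
  proof (rule integral_spike[OF N])
    fix t assume t: "t \<in> {0..1} - (N \<union> {0, 1})"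
    then have "at t within {0..1} = at t" by (intro at_within_interior) auto
    moreover have "vector_derivative (\<lambda>s. g s $ 1) (at t) = vector_derivative (\<lambda>s. ?\<beta> s \<bullet> axis 1 1) (at t)"
    proof (rule vector_derivative_cong_eq)
      have "t \<in> {0<..<1}" using t by auto
      from eventually_nhds_in_open[OF open_greaterThanLessThan this]
      show "\<forall>\<^sub>F s in nhds t. s \<in> UNIV \<longrightarrow> g s $ 1 = ?\<beta> s \<bullet> axis 1 1"
        by eventually_elim (simp add: inner_axis)
    qed (use t in \<open>auto simp: inner_axis\<close>)
    moreover have "vector_derivative (\<lambda>s. ?\<beta> s \<bullet> axis 1 1) (at t) = vector_derivative ?\<beta> (at t) $ 1"
      using t by (subst vector_derivative_inner) (auto simp: N_def inner_axis)
    ultimately show "?\<beta> t $ 2 * vector_derivative ?\<beta> (at t) $ 1 = g t $ 2 * vector_derivative (\<lambda>s. g s $ 1) (at t within {0..1})"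
      using t by simp
  qed
  then show ?thesis
    unfolding signed_area_def action_def area_density_def by simp
qed

definition subcurve :: "real \<Rightarrow> real \<Rightarrow> (real \<Rightarrow> 'a) \<Rightarrow> real \<Rightarrow> 'a" where
  "subcurve u v g t = g (u + (v - u) * clamp01 t)"

definition reverse_curve :: "(real \<Rightarrow> 'a) \<Rightarrow> real \<Rightarrow> 'a" where
  "reverse_curve g t = g (1 - t)"

definition join_curves :: "(real \<Rightarrow> 'a) \<Rightarrow> (real \<Rightarrow> 'a) \<Rightarrow> real \<Rightarrow> 'a" where
  "join_curves g \<beta> t = (if t \<le> 1/2 then g (2 * t) else \<beta> (2 * t - 1))"

definition segment_curve :: "'a::real_vector \<Rightarrow> 'a \<Rightarrow> real \<Rightarrow> 'a" where
  "segment_curve x y t = x + clamp01 t *\<^sub>R (y - x)"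

lemma lipschitz_curve_affine:
  assumes "lipschitz_curve g"
  shows "lipschitz_curve (g \<circ> (\<lambda>t. c + m * t))"
proof -
  obtain L where L: "L-lipschitz_on UNIV g" using assms by (auto simp: lipschitz_curve_def)
  have "\<bar>m\<bar>-lipschitz_on UNIV (\<lambda>t. c + m * t)"
    by (auto simp: lipschitz_on_def dist_real_def right_diff_distrib[symmetric] abs_mult)
  then have "(L * \<bar>m\<bar>)-lipschitz_on UNIV (g \<circ> (\<lambda>t. c + m * t))"
    using L by (intro lipschitz_on_compose) (auto intro: lipschitz_on_subset)
  then show ?thesis by (auto simp: lipschitz_curve_def)
qed

lemma action_affine:
  fixes g :: "real \<Rightarrow> 'a::euclidean_space"
  assumes g: "lipschitz_curve g" and \<Phi>: "lagrangian \<Phi>" and "m > 0" "a \<le> b"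
  shows "action \<Phi> (g \<circ> (\<lambda>t. c + m * t)) a b = action \<Phi> g (c + m * a) (c + m * b)"
  by (rule action_reparam[OF g \<Phi> \<open>m > 0\<close> _ _ \<open>a \<le> b\<close>, where M = m]) (simp_all add: algebra_simps)

lemma curve_subcurve:
  assumes "curve g"
  shows "curve (subcurve u v g)"
proof -
  obtain L where L: "L-lipschitz_on UNIV (g \<circ> (\<lambda>t. u + (v - u) * t))"
    using lipschitz_curve_affine[OF curve_lipschitz[OF assms]] by (auto simp: lipschitz_curve_def)
  have "subcurve u v g = (g \<circ> (\<lambda>t. u + (v - u) * t)) \<circ> clamp01"
    by (auto simp: subcurve_def)
  then show ?thesis using curveI[OF lipschitz_on_subset[OF L]] by simp
qed

lemma subcurve_ends [simp]: "subcurve u v g 0 = g u" "subcurve u v g 1 = g v"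
  by (simp_all add: subcurve_def)

lemma subcurve_image:
  assumes "u \<le> v"
  shows "subcurve u v g ` {0..1} = g ` {u..v}"
proof -
  have "(\<lambda>t. u + (v - u) * t) ` {0..1} = {u..v}"
    using image_affinity_atLeastAtMost[of "v - u" u "0::real" 1] assms by (simp add: add.commute)
  moreover have "subcurve u v g ` {0..1} = g ` (\<lambda>t. u + (v - u) * t) ` {0..1}"
    by (force simp: subcurve_def image_image)
  ultimately show ?thesis by simp
qed

lemma action_subcurve:
  fixes g :: "real \<Rightarrow> 'a::euclidean_space"
  assumes g: "curve g" and \<Phi>: "lagrangian \<Phi>" and "u \<le> v"
  shows "action \<Phi> (subcurve u v g) 0 1 = action \<Phi> g u v"
proof (cases "u = v")
  case True
  have "action \<Phi> (subcurve u v g) 0 1 = 0"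
    by (rule action_constant[OF \<Phi>, of _ _ _ "g u"]) (simp add: True subcurve_def)
  then show ?thesis using True by (simp add: action_def)
next
  case False
  have "action \<Phi> (subcurve u v g) 0 1 = action \<Phi> (g \<circ> (\<lambda>t. u + (v - u) * t)) 0 1"
    by (rule action_cong) (simp add: subcurve_def)
  also have "\<dots> = action \<Phi> g u v"
    using action_affine[OF curve_lipschitz[OF g] \<Phi>, of "v - u" 0 1 u] False \<open>u \<le> v\<close> by simp
  finally show ?thesis .
qed

lemma curve_reverse:
  assumes "curve g"
  shows "curve (reverse_curve g)"
proof -
  have "reverse_curve g = g \<circ> (\<lambda>t. 1 + (-1) * t)" by (auto simp: reverse_curve_def)
  then have "lipschitz_curve (reverse_curve g)"
    using lipschitz_curve_affine[OF curve_lipschitz[OF assms], of 1 "-1"] by simp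
  moreover have "reverse_curve g t = reverse_curve g (clamp01 t)" for t
  proof -
    have "clamp01 (1 - t) = clamp01 (1 - clamp01 t)" by (auto simp: clamp01_def)
    then show ?thesis unfolding reverse_curve_def using curve_clamp01[OF assms] by metis
  qed
  ultimately show ?thesis by (simp add: curve_def)
qed

lemma reverse_curve_image: "reverse_curve g ` {0..1} = g ` {0..1}"
proof -
  have "(\<lambda>t. 1 - t) ` {0..1} = {0..1::real}" by (simp add: image_diff_atLeastAtMost)
  then show ?thesis unfolding reverse_curve_def by (metis image_image)
qed

lemma action_reverse:
  fixes g :: "real \<Rightarrow> 'a::euclidean_space"
  assumes g: "curve g" and \<Phi>: "lagrangian \<Phi>"
  shows "action \<Phi> (reverse_curve g) 0 1 = action (\<lambda>x v. \<Phi> x (- v)) g 0 1"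
proof -
  have l: "lipschitz_curve (\<lambda>t. g (- t))"
    using lipschitz_curve_affine[OF curve_lipschitz[OF g], of 0 "-1"] by (simp add: o_def)
  have "action \<Phi> (reverse_curve g) 0 1 = action \<Phi> ((\<lambda>t. g (- t)) \<circ> (\<lambda>t. -1 + 1 * t)) 0 1"
    by (rule action_cong) (simp add: reverse_curve_def)
  also have "\<dots> = action \<Phi> (\<lambda>t. g (- t)) (-1) (-0)"
    by (subst action_affine[OF l \<Phi>]) auto
  also have "\<dots> = action (\<lambda>x v. \<Phi> x (- v)) g 0 1"
    by (rule action_reflect[OF curve_lipschitz[OF g]])
  finally show ?thesis .
qed

lemma curve_join:
  fixes g \<beta> :: "real \<Rightarrow> 'a::real_normed_vector"
  assumes "curve g" "curve \<beta>" "g 1 = \<beta> 0"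
  shows "curve (join_curves g \<beta>)"
proof -
  obtain L where L: "L-lipschitz_on UNIV (g \<circ> (\<lambda>t. 0 + 2 * t))"
    using lipschitz_curve_affine[OF curve_lipschitz[OF assms(1)], of 0 2] unfolding lipschitz_curve_def by blast
  obtain M where M: "M-lipschitz_on UNIV (\<beta> \<circ> (\<lambda>t. -1 + 2 * t))"
    using lipschitz_curve_affine[OF curve_lipschitz[OF assms(2)], of "-1" 2] unfolding lipschitz_curve_def by blast
  have "(max L M)-lipschitz_on {0..1} (\<lambda>t. if t \<le> 1/2 then (g \<circ> (\<lambda>t. 0 + 2 * t)) t else (\<beta> \<circ> (\<lambda>t. -1 + 2 * t)) t)"
    by (rule lipschitz_on_concat_max) (use L M assms(3) in \<open>auto intro: lipschitz_on_subset\<close>)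
  from curveI[OF this]
  have c: "curve ((\<lambda>t. if t \<le> 1/2 then (g \<circ> (\<lambda>t. 0 + 2 * t)) t else (\<beta> \<circ> (\<lambda>t. -1 + 2 * t)) t) \<circ> clamp01)" .
  have "join_curves g \<beta> t = (if clamp01 t \<le> 1/2 then g (0 + 2 * clamp01 t) else \<beta> (-1 + 2 * clamp01 t))" for t
  proof -
    have "g (2 * t) = g (2 * clamp01 t)" if "t \<le> 1/2"
    proof -
      have "clamp01 (2 * t) = clamp01 (2 * clamp01 t)" using that by (auto simp: clamp01_def)
      then show ?thesis using curve_clamp01[OF assms(1)] by metis
    qed
    moreover have "\<beta> (2 * t - 1) = \<beta> (-1 + 2 * clamp01 t)" if "\<not> t \<le> 1/2"
    proof -
      have "clamp01 (2 * t - 1) = clamp01 (-1 + 2 * clamp01 t)" using that by (auto simp: clamp01_def)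
      then show ?thesis using curve_clamp01[OF assms(2)] by metis
    qed
    moreover have "clamp01 t \<le> 1/2 \<longleftrightarrow> t \<le> 1/2" by (auto simp: clamp01_def)
    ultimately show ?thesis by (auto simp: join_curves_def)
  qed
  then have "join_curves g \<beta> = (\<lambda>t. if t \<le> 1/2 then (g \<circ> (\<lambda>t. 0 + 2 * t)) t else (\<beta> \<circ> (\<lambda>t. -1 + 2 * t)) t) \<circ> clamp01"
    by (auto simp: fun_eq_iff)
  then show ?thesis using c by simp
qed

lemma join_curves_ends [simp]: "join_curves g \<beta> 0 = g 0" "join_curves g \<beta> 1 = \<beta> 1"
  by (simp_all add: join_curves_def)

lemma join_curves_image: "join_curves g \<beta> ` {0..1} \<subseteq> g ` {0..1} \<union> \<beta> ` {0..1}"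
proof
  fix z assume "z \<in> join_curves g \<beta> ` {0..1}"
  then obtain t where t: "t \<in> {0..1}" "z = join_curves g \<beta> t" by blast
  show "z \<in> g ` {0..1} \<union> \<beta> ` {0..1}"
  proof (cases "t \<le> 1/2")
    case True
    then have "z = g (2 * t)" "2 * t \<in> {0..1}" using t by (auto simp: join_curves_def)
    then show ?thesis by blast
  next
    case False
    then have "z = \<beta> (2 * t - 1)" "2 * t - 1 \<in> {0..1}" using t by (auto simp: join_curves_def)
    then show ?thesis by blast
  qed
qed

lemma action_join:
  fixes g \<beta> :: "real \<Rightarrow> 'a::euclidean_space"
  assumes "curve g" "curve \<beta>" "g 1 = \<beta> 0" and \<Phi>: "lagrangian \<Phi>"
  shows "action \<Phi> (join_curves g \<beta>) 0 1 = action \<Phi> g 0 1 + action \<Phi> \<beta> 0 1"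
proof -
  have "action \<Phi> (join_curves g \<beta>) 0 (1/2) = action \<Phi> (g \<circ> (\<lambda>t. 0 + 2 * t)) 0 (1/2)"
    by (rule action_cong) (simp add: join_curves_def)
  also have "\<dots> = action \<Phi> g 0 1"
    by (subst action_affine[OF curve_lipschitz[OF assms(1)] \<Phi>]) auto
  finally have 1: "action \<Phi> (join_curves g \<beta>) 0 (1/2) = action \<Phi> g 0 1" .
  have "action \<Phi> (join_curves g \<beta>) (1/2) 1 = action \<Phi> (\<beta> \<circ> (\<lambda>t. -1 + 2 * t)) (1/2) 1"
    by (rule action_cong) (simp add: join_curves_def)
  also have "\<dots> = action \<Phi> \<beta> 0 1"
    by (subst action_affine[OF curve_lipschitz[OF assms(2)] \<Phi>]) auto
  finally have 2: "action \<Phi> (join_curves g \<beta>) (1/2) 1 = action \<Phi> \<beta> 0 1" .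
  show ?thesis
    using action_combine[OF curve_lipschitz[OF curve_join[OF assms(1-3)]] lagrangian_continuous[OF \<Phi>], of 0 "1/2" 1] 1 2 by simp
qed

lemma curve_segment:
  fixes x y :: "'a::real_normed_vector"
  shows "curve (segment_curve x y)"
proof -
  have "(norm (y - x))-lipschitz_on {0..1} (\<lambda>t. x + t *\<^sub>R (y - x))"
    by (auto simp: lipschitz_on_def dist_norm scaleR_diff_left[symmetric] mult.commute)
  from curveI[OF this] show ?thesis by (simp add: segment_curve_def[abs_def] o_def)
qed

lemma segment_curve_ends [simp]: "segment_curve x y 0 = x" "segment_curve x y 1 = y"
  by (simp_all add: segment_curve_def)

lemma segment_curve_image: "segment_curve x y ` {0..1} \<subseteq> closed_segment x y"
proof
  fix z assume "z \<in> segment_curve x y ` {0..1}"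
  then obtain t where "t \<in> {0..1}" "z = (1 - t) *\<^sub>R x + t *\<^sub>R y"
    by (auto simp: segment_curve_def algebra_simps)
  then show "z \<in> closed_segment x y" by (auto simp: closed_segment_def)
qed

lemma action_segment:
  fixes x y :: "'a::euclidean_space"
  shows "action \<Phi> (segment_curve x y) 0 1 = integral {0..1} (\<lambda>t. \<Phi> (x + t *\<^sub>R (y - x)) (y - x))"
proof -
  have "action \<Phi> (segment_curve x y) 0 1 = action \<Phi> (\<lambda>t. x + t *\<^sub>R (y - x)) 0 1"
    by (rule action_cong) (simp add: segment_curve_def)
  moreover have "vector_derivative (\<lambda>t. x + t *\<^sub>R (y - x)) (at t) = y - x" for t
    by (rule vector_derivative_at) (auto intro!: derivative_eq_intros)
  ultimately show ?thesis by (simp add: action_def)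
qed

lemma area_segment:
  "action area_density (segment_curve x y) 0 1 = - ((x $ 2 + y $ 2) / 2 * (y $ 1 - x $ 1))"
proof -
  define d where "d = y - x"
  have hi: "((\<lambda>t. - ((x $ 2 + t * d $ 2) * d $ 1)) has_integral
        (- (x $ 2 * 1 + 1\<^sup>2 / 2 * d $ 2) * d $ 1) - (- (x $ 2 * 0 + 0\<^sup>2 / 2 * d $ 2) * d $ 1)) {0..1::real}"
    by (rule fundamental_theorem_of_calculus)
       (auto simp: has_real_derivative_iff_has_vector_derivative[symmetric] algebra_simps intro!: derivative_eq_intros)
  have "action area_density (segment_curve x y) 0 1 = integral {0..1} (\<lambda>t. - ((x $ 2 + t * d $ 2) * d $ 1))"
    by (simp only: action_segment area_density_def d_def vector_add_component vector_scaleR_component real_scaleR_def)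
  also have "\<dots> = (- (x $ 2 * 1 + 1\<^sup>2 / 2 * d $ 2) * d $ 1) - (- (x $ 2 * 0 + 0\<^sup>2 / 2 * d $ 2) * d $ 1)"
    by (rule integral_unique[OF hi])
  also have "\<dots> = - ((x $ 2 + y $ 2) / 2 * (y $ 1 - x $ 1))"
    by (simp add: d_def field_simps)
  finally show ?thesis .
qed

lemma energy_segment_le:
  assumes F: "continuous_on UNIV F" and M: "\<And>z. z \<in> closed_segment x y \<Longrightarrow> F z \<le> M"
  shows "action (energy_density F) (segment_curve x y) 0 1 \<le> M * norm (y - x)"
proof -
  have "integral {0..1} (\<lambda>t. F (x + t *\<^sub>R (y - x)) * norm (y - x)) \<le> integral {0..1} (\<lambda>t::real. M * norm (y - x))"
  proof (rule integral_le)
    have "continuous_on {0..1} (\<lambda>t. F (x + t *\<^sub>R (y - x)))"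
      by (rule continuous_on_compose2[OF F]) (auto intro!: continuous_intros)
    then show "(\<lambda>t. F (x + t *\<^sub>R (y - x)) * norm (y - x)) integrable_on {0..1}"
      by (intro integrable_continuous_real continuous_intros)
    fix t :: real assume "t \<in> {0..1}"
    then have "x + t *\<^sub>R (y - x) \<in> closed_segment x y"
      by (auto simp: closed_segment_def algebra_simps intro!: exI[of _ t])
    then show "F (x + t *\<^sub>R (y - x)) * norm (y - x) \<le> M * norm (y - x)"
      by (intro mult_right_mono M) auto
  qed (rule integrable_const_ivl)
  then show ?thesis by (simp add: action_segment energy_density_def)
qed

section \<open>Joining points with prescribed area\<close>

lemma first_hitting_time:
  fixes f :: "real \<Rightarrow> real"
  assumes cont: "continuous_on {a..b} f" and "a \<le> b" "f a \<le> v" "v \<le> f b"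
  obtains t where "t \<in> {a..b}" "f t = v" "\<And>x. x \<in> {a..t} \<Longrightarrow> f x \<le> v"
proof -
  define T where "T = {t \<in> {a..b}. v \<le> f t}"
  have "closed T"
    unfolding T_def using continuous_closed_preimage[OF cont closed_atLeastAtMost closed_atLeast, of v]
    by (simp add: vimage_def Int_def)
  moreover have "b \<in> T" using assms by (simp add: T_def)
  moreover have bdd: "bdd_below T" by (auto simp: T_def intro: bdd_belowI[of _ a])
  ultimately have "Inf T \<in> T" by (intro closed_contains_Inf) auto
  then have t: "a \<le> Inf T" "Inf T \<le> b" "v \<le> f (Inf T)" by (auto simp: T_def)
  obtain x where x: "a \<le> x" "x \<le> Inf T" "f x = v"
    using IVT'[of f a v "Inf T"] assms t continuous_on_subset[OF cont, of "{a..Inf T}"] by auto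
  then have "x \<in> T" using t by (auto simp: T_def)
  then have "Inf T \<le> x" using bdd by (rule cInf_lower)
  then have "x = Inf T" using x by simp
  moreover have "f y \<le> v" if "y \<in> {a..Inf T}" for y
  proof (rule ccontr)
    assume "\<not> f y \<le> v"
    then have "y \<in> T" using that t by (auto simp: T_def)
    then have "Inf T \<le> y" using bdd by (rule cInf_lower)
    then have "y = x" using that \<open>x = Inf T\<close> by simp
    then show False using \<open>\<not> f y \<le> v\<close> x by simp
  qed
  ultimately show ?thesis using that[of "Inf T"] t x by auto
qed

lemma last_exit_time:
  fixes f :: "real \<Rightarrow> real"
  assumes cont: "continuous_on {a..b} f" and "a \<le> b" "f a \<le> v" "v \<le> f b"
  obtains t where "t \<in> {a..b}" "f t = v" "\<And>x. x \<in> {t..b} \<Longrightarrow> v \<le> f x"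
proof -
  have "continuous_on {a..b} (\<lambda>x. - f (a + b - x))"
    by (intro continuous_intros continuous_on_compose2[OF cont]) auto
  then obtain t where t: "t \<in> {a..b}" "- f (a + b - t) = - v" "\<And>x. x \<in> {a..t} \<Longrightarrow> - f (a + b - x) \<le> - v"
    using first_hitting_time[of a b "\<lambda>x. - f (a + b - x)" "- v"] assms by auto
  have "v \<le> f x" if "x \<in> {a + b - t..b}" for x
    using t(3)[of "a + b - x"] that by auto
  then show ?thesis using that[of "a + b - t"] t by auto
qed

locale weight =
  fixes F :: "real ^ 2 \<Rightarrow> real"
  assumes F_cont: "continuous_on UNIV F" and F_nonneg: "F x \<ge> 0"
begin

abbreviation en :: "(real \<Rightarrow> real ^ 2) \<Rightarrow> real \<Rightarrow> real \<Rightarrow> real" where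
  "en \<equiv> action (energy_density F)"

abbreviation ar :: "(real \<Rightarrow> real ^ 2) \<Rightarrow> real \<Rightarrow> real \<Rightarrow> real" where
  "ar \<equiv> action area_density"

text \<open>
  The area is prescribed exactly, the energy is only bounded. Under concatenation areas and energy
  bounds add, and reversal changes the sign of the area.
\<close>

definition linked :: "(real ^ 2) set \<Rightarrow> real ^ 2 \<Rightarrow> real ^ 2 \<Rightarrow> real \<Rightarrow> real \<Rightarrow> bool" where
  "linked B x y A e \<longleftrightarrow> (\<exists>g. curve g \<and> g ` {0..1} \<subseteq> B \<and> g 0 = x \<and> g 1 = y \<and> ar g 0 1 = A \<and> en g 0 1 \<le> e)"

text \<open>
  The relaxed notion, in which the energy bound is only approached. This is all that a limit of
  curves of unbounded length provides.
\<close>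

definition nearly_linked :: "(real ^ 2) set \<Rightarrow> real ^ 2 \<Rightarrow> real ^ 2 \<Rightarrow> real \<Rightarrow> real \<Rightarrow> bool" where
  "nearly_linked B x y A e \<longleftrightarrow> (\<forall>\<epsilon>>0. linked B x y A (e + \<epsilon>))"

lemma linkedI:
  assumes "curve g" "g ` {0..1} \<subseteq> B" "g 0 = x" "g 1 = y" "ar g 0 1 = A" "en g 0 1 \<le> e"
  shows "linked B x y A e"
  using assms by (auto simp: linked_def)

lemma linkedE:
  assumes "linked B x y A e"
  obtains g where "curve g" "g ` {0..1} \<subseteq> B" "g 0 = x" "g 1 = y" "ar g 0 1 = A" "en g 0 1 \<le> e"
  using assms by (auto simp: linked_def)

lemmas E_lag = lagrangian_energy_density[OF F_cont]
lemmas A_lag = lagrangian_area_density(1)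

lemma en_integrable: "lipschitz_curve g \<Longrightarrow> (\<lambda>t. F (g t) * norm (vector_derivative g (at t))) integrable_on {a..b}"
  using action_integrable[OF _ lagrangian_continuous[OF E_lag]] unfolding energy_density_def .

lemma en_nonneg: "lipschitz_curve g \<Longrightarrow> 0 \<le> en g a b"
  unfolding action_def energy_density_def
  by (intro integral_nonneg en_integrable mult_nonneg_nonneg F_nonneg norm_ge_zero)

lemma linked_mono:
  assumes "linked B x y A e" "B \<subseteq> C" "e \<le> f"
  shows "linked C x y A f"
proof -
  obtain g where "curve g" "g ` {0..1} \<subseteq> B" "g 0 = x" "g 1 = y" "ar g 0 1 = A" "en g 0 1 \<le> e"
    using assms(1) by (rule linkedE)
  then show ?thesis using assms(2,3) by (intro linkedI[of g]) auto
qed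

lemma linked_mem: "linked B x y A e \<Longrightarrow> x \<in> B \<and> y \<in> B"
proof (elim linkedE)
  fix g :: "real \<Rightarrow> real^2" assume "g ` {0..1} \<subseteq> B" "g 0 = x" "g 1 = y"
  moreover have "g 0 \<in> g ` {0..1}" "g 1 \<in> g ` {0..1}" by auto
  ultimately show "x \<in> B \<and> y \<in> B" by auto
qed

lemma linked_trans:
  assumes "linked B x y A e" "linked B y z A' e'"
  shows "linked B x z (A + A') (e + e')"
proof -
  obtain g where g: "curve g" "g ` {0..1} \<subseteq> B" "g 0 = x" "g 1 = y" "ar g 0 1 = A" "en g 0 1 \<le> e"
    using assms(1) by (rule linkedE)
  obtain \<beta> where \<beta>: "curve \<beta>" "\<beta> ` {0..1} \<subseteq> B" "\<beta> 0 = y" "\<beta> 1 = z" "ar \<beta> 0 1 = A'" "en \<beta> 0 1 \<le> e'"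
    using assms(2) by (rule linkedE)
  have eq: "g 1 = \<beta> 0" using g \<beta> by simp
  show ?thesis
  proof (rule linkedI)
    show "curve (join_curves g \<beta>)" by (rule curve_join[OF g(1) \<beta>(1) eq])
    show "join_curves g \<beta> ` {0..1} \<subseteq> B" using join_curves_image[of g \<beta>] g(2) \<beta>(2) by blast
  qed (use g \<beta> action_join[OF g(1) \<beta>(1) eq E_lag] action_join[OF g(1) \<beta>(1) eq A_lag] in auto)
qed

lemma linked_reverse:
  assumes "linked B x y A e"
  shows "linked B y x (- A) e"
proof -
  obtain g where g: "curve g" "g ` {0..1} \<subseteq> B" "g 0 = x" "g 1 = y" "ar g 0 1 = A" "en g 0 1 \<le> e"
    using assms(1) by (rule linkedE)
  have "en (reverse_curve g) 0 1 = en g 0 1"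
    using action_reverse[OF g(1) E_lag] by (simp add: energy_density_def[abs_def])
  moreover have "ar (reverse_curve g) 0 1 = - A"
    using action_reverse[OF g(1) A_lag] g(5) action_minus[of area_density g 0 1]
    by (simp add: area_density_def[abs_def])
  ultimately show ?thesis
    using g by (intro linkedI[of "reverse_curve g"])
      (simp_all add: curve_reverse reverse_curve_image, simp_all add: reverse_curve_def)
qed

lemma linked_subcurve:
  assumes "curve g" "u \<le> v" "g ` {u..v} \<subseteq> B"
  shows "linked B (g u) (g v) (ar g u v) (en g u v)"
  by (rule linkedI[of "subcurve u v g"])
     (use assms in \<open>simp_all add: curve_subcurve subcurve_image action_subcurve E_lag A_lag\<close>)

lemma linked_segment:
  assumes "\<And>z. z \<in> closed_segment x y \<Longrightarrow> F z \<le> M" "closed_segment x y \<subseteq> B"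
  shows "linked B x y (- ((x $ 2 + y $ 2) / 2 * (y $ 1 - x $ 1))) (M * norm (y - x))"
  by (rule linkedI[OF curve_segment[of x y]])
     (use segment_curve_image[of x y] assms in \<open>auto simp: area_segment intro: energy_segment_le[OF F_cont]\<close>)

lemma linked_refl: "x \<in> B \<Longrightarrow> linked B x x 0 0"
  using linked_segment[of x x "F x" B] by simp

text \<open>
  The loop is the boundary of a square of side \<open>s\<close> with corner \<open>x\<close>. It serves to correct small
  errors in the area.
\<close>

lemma linked_loop:
  assumes M: "\<And>z. z \<in> cball x (2 * s) \<Longrightarrow> F z \<le> M" and B: "cball x (2 * s) \<subseteq> B" and s: "s \<ge> 0" "\<bar>A\<bar> = s\<^sup>2"
  shows "linked B x x A (4 * M * s)"
proof -
  define b where "b = x + s *\<^sub>R axis 1 1"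
  define c where "c = x + s *\<^sub>R axis 1 1 + s *\<^sub>R axis 2 1"
  define d where "d = x + s *\<^sub>R axis 2 1"
  have nb: "norm (b - x) = s" "norm (d - x) = s" using s by (simp_all add: b_def d_def)
  have nc: "norm (c - b) = s" "norm (d - c) = s" "norm (x - d) = s"
    using s by (simp_all add: b_def c_def d_def)
  have "norm (c - x) \<le> norm (c - b) + norm (b - x)" using norm_triangle_ineq[of "c - b" "b - x"] by simp
  then have mem: "x \<in> cball x (2 * s)" "b \<in> cball x (2 * s)" "c \<in> cball x (2 * s)" "d \<in> cball x (2 * s)"
    using nb nc s by (simp_all add: dist_norm norm_minus_commute)
  have seg: "closed_segment y z \<subseteq> cball x (2 * s)" if "y \<in> cball x (2 * s)" "z \<in> cball x (2 * s)" for y z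
    using closed_segment_subset[OF that] by simp
  have ls: "linked B y z (- ((y $ 2 + z $ 2) / 2 * (z $ 1 - y $ 1))) (M * norm (z - y))"
    if "y \<in> cball x (2 * s)" "z \<in> cball x (2 * s)" for y z
    by (rule linked_segment) (use seg[OF that] M B in blast)+
  have comp: "b $ 1 = x $ 1 + s" "b $ 2 = x $ 2" "c $ 1 = x $ 1 + s" "c $ 2 = x $ 2 + s" "d $ 1 = x $ 1" "d $ 2 = x $ 2 + s"
    by (simp_all add: b_def c_def d_def axis_def)
  have sq: "linked B x x (s\<^sup>2) (4 * M * s)"
    using linked_trans[OF linked_trans[OF ls[OF mem(1,2)] ls[OF mem(2,3)]] linked_trans[OF ls[OF mem(3,4)] ls[OF mem(4,1)]]]
    by (simp add: nb nc comp) (simp add: field_simps power2_eq_square)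
  show ?thesis
  proof (cases "A \<ge> 0")
    case True
    then show ?thesis using sq s by simp
  next
    case False
    then have "A = - (s\<^sup>2)" using s by simp
    then show ?thesis using linked_reverse[OF sq] by simp
  qed
qed

lemma F_bounded_on_cball: "\<exists>M\<ge>0. \<forall>z\<in>cball x R. F z \<le> M"
proof -
  have "bounded (F ` cball x R)"
    by (intro compact_imp_bounded compact_continuous_image continuous_on_subset[OF F_cont] compact_cball) auto
  then obtain M where "\<forall>z\<in>cball x R. \<bar>F z\<bar> \<le> M" unfolding bounded_iff by auto
  then show ?thesis by (intro exI[of _ "\<bar>M\<bar>"]) force
qed

lemma linked_exists: "\<exists>e. linked UNIV x y A e"
proof -
  define R where "R = norm (y - x) + 2 * sqrt \<bar>A + (x $ 2 + y $ 2) / 2 * (y $ 1 - x $ 1)\<bar>"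
  obtain M where M: "\<And>z. z \<in> cball x (R + norm (y - x)) \<Longrightarrow> F z \<le> M" using F_bounded_on_cball by blast
  have "x \<in> cball x (R + norm (y - x))" "y \<in> cball x (R + norm (y - x))"
    by (auto simp: R_def dist_norm norm_minus_commute)
  then have "closed_segment x y \<subseteq> cball x (R + norm (y - x))" by (intro closed_segment_subset) auto
  then have 1: "linked UNIV x y (- ((x $ 2 + y $ 2) / 2 * (y $ 1 - x $ 1))) (M * norm (y - x))"
    by (intro linked_segment) (use M in auto)
  define d where "d = A + (x $ 2 + y $ 2) / 2 * (y $ 1 - x $ 1)"
  have "linked UNIV x x d (4 * M * sqrt \<bar>d\<bar>)"
  proof (rule linked_loop)
    fix z assume "z \<in> cball x (2 * sqrt \<bar>d\<bar>)"
    then show "F z \<le> M" by (intro M) (auto simp: R_def d_def intro: order_trans)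
  qed auto
  from linked_trans[OF this 1] show ?thesis by (auto simp: d_def)
qed

lemma nearly_linked_of_linked: "linked B x y A e \<Longrightarrow> nearly_linked B x y A e"
  unfolding nearly_linked_def by (auto intro: linked_mono)

lemma nearly_linked_trans:
  assumes "nearly_linked B x y A e" "nearly_linked B y z A' e'"
  shows "nearly_linked B x z (A + A') (e + e')"
  unfolding nearly_linked_def
proof (intro allI impI)
  fix \<epsilon> :: real assume "\<epsilon> > 0"
  then have "linked B x y A (e + \<epsilon>/2)" "linked B y z A' (e' + \<epsilon>/2)"
    using assms by (auto simp: nearly_linked_def)
  from linked_trans[OF this] show "linked B x z (A + A') (e + e' + \<epsilon>)"
    by (rule linked_mono) auto
qed

lemma nearly_linked_reverse: "nearly_linked B x y A e \<Longrightarrow> nearly_linked B y x (- A) e"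
  unfolding nearly_linked_def by (auto intro: linked_reverse)

text \<open>
  Segments from the limit points to the end points of the given curves correct the ends, and a
  square loop corrects the area. Both corrections have vanishing energy.
\<close>

lemma nearly_linked_limit:
  fixes X Y :: "nat \<Rightarrow> real ^ 2"
  assumes lk: "\<And>j. linked (ball p r) (X j) (Y j) (A j) (e j)"
    and lim: "X \<longlonglongrightarrow> x" "Y \<longlonglongrightarrow> y" "A \<longlonglongrightarrow> A'" "e \<longlonglongrightarrow> e'"
    and xy: "x \<in> ball p r" "y \<in> ball p r"
  shows "nearly_linked (ball p r) x y A' e'"
proof -
  obtain M where M: "M \<ge> 0" "\<And>z. z \<in> cball p r \<Longrightarrow> F z \<le> M" using F_bounded_on_cball by blast
  obtain \<rho> where \<rho>: "\<rho> > 0" "ball y \<rho> \<subseteq> ball p r" using xy(2) open_ball openE by blast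
  have XY: "X j \<in> ball p r" "Y j \<in> ball p r" for j using linked_mem[OF lk[of j]] by auto
  have seg: "linked (ball p r) u v (- ((u $ 2 + v $ 2) / 2 * (v $ 1 - u $ 1))) (M * norm (v - u))"
    if "u \<in> ball p r" "v \<in> ball p r" for u v
  proof (rule linked_segment)
    show sub: "closed_segment u v \<subseteq> ball p r" using that by (intro closed_segment_subset) auto
    then show "F z \<le> M" if "z \<in> closed_segment u v" for z using M(2)[of z] that by auto
  qed
  define ax where "ax = (\<lambda>j. - ((x $ 2 + X j $ 2) / 2 * (X j $ 1 - x $ 1)))"
  define ay where "ay = (\<lambda>j. - ((Y j $ 2 + y $ 2) / 2 * (y $ 1 - Y j $ 1)))"
  have 1: "linked (ball p r) x y (ax j + A j + ay j) (M * norm (X j - x) + e j + M * norm (y - Y j))" for j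
    unfolding ax_def ay_def by (intro linked_trans[OF linked_trans[OF seg lk] seg] xy XY)
  define d where "d = (\<lambda>j. A' - (ax j + A j + ay j))"
  define s where "s = (\<lambda>j. sqrt \<bar>d j\<bar>)"
  have "d \<longlonglongrightarrow> A' - (- ((x $ 2 + x $ 2) / 2 * (x $ 1 - x $ 1)) + A' + - ((y $ 2 + y $ 2) / 2 * (y $ 1 - y $ 1)))"
    unfolding d_def ax_def ay_def by (intro tendsto_intros lim) auto
  then have "d \<longlonglongrightarrow> 0" by simp
  then have slim: "s \<longlonglongrightarrow> 0" unfolding s_def using tendsto_real_sqrt[OF tendsto_rabs[of d 0]] by simp
  have 2: "linked (ball p r) y y (d j) (4 * M * s j)" if j: "2 * s j < \<rho>" for j
  proof (rule linked_loop)
    show sub: "cball y (2 * s j) \<subseteq> ball p r" using \<rho>(2) j by (force simp: subset_iff)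
    then show "F z \<le> M" if "z \<in> cball y (2 * s j)" for z using M(2)[of z] that by force
  qed (auto simp: s_def)
  have 3: "linked (ball p r) x y A' (M * norm (X j - x) + e j + M * norm (y - Y j) + 4 * M * s j)" if j: "2 * s j < \<rho>" for j
    using linked_trans[OF 1[of j] 2[OF j]] by (simp add: d_def)
  have elim: "(\<lambda>j. M * norm (X j - x) + e j + M * norm (y - Y j) + 4 * M * s j) \<longlonglongrightarrow>
       M * norm (x - x) + e' + M * norm (y - y) + 4 * M * 0"
    by (intro tendsto_intros lim slim)
  show ?thesis
    unfolding nearly_linked_def
  proof (intro allI impI)
    fix \<epsilon> :: real assume "\<epsilon> > 0"
    have "\<forall>\<^sub>F j in sequentially. M * norm (X j - x) + e j + M * norm (y - Y j) + 4 * M * s j < e' + \<epsilon>"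
      using order_tendstoD(2)[OF elim, of "e' + \<epsilon>"] \<open>\<epsilon> > 0\<close> by simp
    moreover have "\<forall>\<^sub>F j in sequentially. 2 * s j < \<rho>"
      using order_tendstoD(2)[OF tendsto_mult[OF tendsto_const slim], of 2 \<rho>] \<rho>(1) by simp
    ultimately have "\<forall>\<^sub>F j in sequentially. linked (ball p r) x y A' (e' + \<epsilon>)"
      by eventually_elim (rule linked_mono[OF 3], auto)
    then show "linked (ball p r) x y A' (e' + \<epsilon>)" by simp
  qed
qed

text \<open>
  The local minimizer has at most the energy of every competitor, so the approached bound is
  attained.
\<close>

lemma linked_of_minimizer:
  assumes "local_minimizers_exist F p B" "x \<in> B" "x \<noteq> p" and nl: "nearly_linked B x p A e"
  shows "linked B x p A e"
proof -
  obtain g where g: "is_arg_min (energy F) (\<lambda>g. g \<in> lipschitz_curves_in B x p A) g"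
    using assms unfolding local_minimizers_exist_def by blast
  then have mem: "g \<in> lipschitz_curves_in B x p A"
    and min: "\<And>\<beta>. \<beta> \<in> lipschitz_curves_in B x p A \<Longrightarrow> energy F g \<le> energy F \<beta>"
    by (auto simp: is_arg_min_linorder)
  obtain L where L: "L-lipschitz_on {0..1} g" using mem by (auto simp: lipschitz_curves_in_def)
  have "energy F g \<le> e"
  proof (rule field_le_epsilon)
    fix \<epsilon> :: real assume "\<epsilon> > 0"
    then have "linked B x p A (e + \<epsilon>)" using nl by (simp add: nearly_linked_def)
    then obtain \<beta> where \<beta>: "curve \<beta>" "\<beta> ` {0..1} \<subseteq> B" "\<beta> 0 = x" "\<beta> 1 = p" "ar \<beta> 0 1 = A" "en \<beta> 0 1 \<le> e + \<epsilon>"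
      by (rule linkedE)
    have id: "\<beta> \<circ> clamp01 = \<beta>" using curve_clamp01[OF \<beta>(1)] by auto
    obtain K where K: "K-lipschitz_on {0..1} \<beta>"
      using curve_lipschitz[OF \<beta>(1)] lipschitz_on_subset unfolding lipschitz_curve_def by blast
    have "\<beta> \<in> lipschitz_curves_in B x p A"
      using \<beta> K signed_area_eq_action[OF K] id by (auto simp: lipschitz_curves_in_def)
    from min[OF this] show "energy F g \<le> e + \<epsilon>"
      using \<beta>(6) id by (simp add: energy_eq_action)
  qed
  then show ?thesis
    using mem signed_area_eq_action[OF L] curveI[OF L]
    by (intro linkedI[of "g \<circ> clamp01"]) (auto simp: lipschitz_curves_in_def energy_eq_action)
qed

text \<open>
  The curve is followed up to the first time it has distance \<open>\<rho>\<close> from \<open>p\<close>. This arc stays in \<open>B\<close>,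
  and it ends at a point other than \<open>p\<close>. The loop followed by the arc can thus be replaced by a
  local minimizer, and the rest of the curve is kept.
\<close>

lemma absorb_loop:
  assumes min: "local_minimizers_exist F p B" and B: "B = ball p r" "r > 0"
    and loop: "nearly_linked B p p A' e'" and lk: "linked UNIV p w A e" and "w \<noteq> p"
  shows "linked UNIV p w (A' + A) (e' + e)"
proof -
  obtain g where g: "curve g" "g 0 = p" "g 1 = w" "ar g 0 1 = A" "en g 0 1 \<le> e"
    using lk by (rule linkedE)
  note gl = curve_lipschitz[OF g(1)]
  define \<rho> where "\<rho> = min (r/2) (dist p w)"
  have \<rho>: "\<rho> > 0" "\<rho> < r" "\<rho> \<le> dist p w" using B \<open>w \<noteq> p\<close> by (auto simp: \<rho>_def)
  have cont: "continuous_on {0..1} (\<lambda>t. dist p (g t))"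
    by (intro continuous_intros lipschitz_curve_continuous[OF gl])
  obtain t where t: "t \<in> {0..1}" "dist p (g t) = \<rho>" and upto: "\<And>s. s \<in> {0..t} \<Longrightarrow> dist p (g s) \<le> \<rho>"
    using first_hitting_time[OF cont, of \<rho>] \<rho> g(2,3) by auto
  have sub: "g ` {0..t} \<subseteq> B" using upto \<rho> by (force simp: B)
  have l1: "linked B p (g t) (ar g 0 t) (en g 0 t)"
    using linked_subcurve[OF g(1) _ sub] t g(2) by simp
  have l2: "linked UNIV (g t) w (ar g t 1) (en g t 1)"
    using linked_subcurve[OF g(1), of t 1 UNIV] t g(3) by simp
  have "nearly_linked B p (g t) (A' + ar g 0 t) (e' + en g 0 t)"
    by (rule nearly_linked_trans[OF loop nearly_linked_of_linked[OF l1]])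
  then have "nearly_linked B (g t) p (- (A' + ar g 0 t)) (e' + en g 0 t)"
    by (rule nearly_linked_reverse)
  then have "linked B (g t) p (- (A' + ar g 0 t)) (e' + en g 0 t)"
    using linked_mem[OF l1] t(2) \<rho>(1) by (intro linked_of_minimizer[OF min]) auto
  from linked_reverse[OF this] have "linked UNIV p (g t) (A' + ar g 0 t) (e' + en g 0 t)"
    using linked_mono[of B _ _ _ _ UNIV] by (simp only: minus_minus) blast
  from linked_trans[OF this l2] show ?thesis
    using action_combine[OF gl lagrangian_continuous[OF E_lag], of 0 t 1] t g
      action_combine[OF gl lagrangian_continuous[OF A_lag], of 0 t 1]
    by (auto simp: add.assoc intro: linked_mono)
qed

end

section \<open>Quadratic growth at a nondegenerate minimum\<close>

lemma positive_definite_coercive: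
  assumes "positive_definite H"
  obtains \<mu> where "\<mu> > 0" "\<And>v. \<mu> * (norm v)\<^sup>2 \<le> v \<bullet> (H *v v)"
proof -
  have cont: "continuous_on (sphere 0 1) (\<lambda>v::real^2. v \<bullet> (H *v v))"
    by (intro continuous_intros linear_continuous_on matrix_vector_mul_bounded_linear)
  have "sphere (0::real^2) 1 \<noteq> {}"
    using norm_axis_1[of "1::2"] by (metis mem_sphere_0 empty_iff)
  from continuous_attains_inf[OF compact_sphere this cont]
  obtain w where w: "norm w = 1" "\<And>v. norm v = 1 \<Longrightarrow> w \<bullet> (H *v w) \<le> v \<bullet> (H *v v)"
    by auto
  have "w \<noteq> 0" using w by auto
  then have "w \<bullet> (H *v w) > 0" using assms by (auto simp: positive_definite_def)
  moreover have "(w \<bullet> (H *v w)) * (norm v)\<^sup>2 \<le> v \<bullet> (H *v v)" for v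
  proof (cases "v = 0")
    case False
    define u where "u = (1 / norm v) *\<^sub>R v"
    have "norm u = 1" using False by (simp add: u_def)
    have v: "v = norm v *\<^sub>R u" using False by (simp add: u_def)
    have "v \<bullet> (H *v v) = (norm v)\<^sup>2 * (u \<bullet> (H *v u))"
      by (subst v, subst (2) v)
         (simp add: matrix_vector_mult_scaleR power2_eq_square)
    then show ?thesis using w(2)[OF \<open>norm u = 1\<close>] by (simp add: mult.commute mult_right_mono)
  qed simp
  ultimately show ?thesis using that by blast
qed

text \<open>
  The first partial derivatives of \<open>W\<close> vanish at the minimum \<open>p\<close>, and their first-order
  expansion there is given by the Hessian. Hence the radial derivative of \<open>W\<close> at \<open>x\<close> is at least a
  fixed multiple of the squared distance to \<open>p\<close>, and integrating it along rays yields the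
  growth.
\<close>

lemma nondegenerate_minimum_quadratic_growth:
  fixes W :: "real ^ 2 \<Rightarrow> real"
  assumes "r > 0" and smooth: "smooth_on (ball p r) W" and pd: "positive_definite (hessian W p)"
    and W0: "W p = 0" and Wnn: "\<And>x. W x \<ge> 0"
  obtains c \<rho> where "c > 0" "\<rho> > 0" "\<rho> < r" "\<And>x. dist p x \<le> \<rho> \<Longrightarrow> c * (norm (x - p))\<^sup>2 \<le> W x"
proof -
  have C2: "C_k_on (Suc (Suc 0)) (ball p r) W" using smooth by (simp add: smooth_on_def)
  have dW: "W differentiable (at x)" if "x \<in> ball p r" for x using C2 that by simp
  define g where "g = (\<lambda>j. partial_deriv j W)"
  have dg: "g j differentiable (at p)" for j
    using C2 \<open>r > 0\<close> by (simp add: g_def partial_deriv_def[abs_def])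
  have fW: "frechet_derivative W (at x) v = (\<Sum>j\<in>UNIV. v $ j * g j x)" if "x \<in> ball p r" for x v
  proof -
    have lin: "linear (frechet_derivative W (at x))" using dW[OF that] by (rule linear_frechet_derivative)
    have "v = (\<Sum>j\<in>UNIV. v $ j *\<^sub>R axis j 1)"
      using basis_expansion[of v] by (simp add: scalar_mult_eq_scaleR)
    then have "frechet_derivative W (at x) v = frechet_derivative W (at x) (\<Sum>j\<in>UNIV. v $ j *\<^sub>R axis j 1)" by simp
    also have "\<dots> = (\<Sum>j\<in>UNIV. v $ j * g j x)"
      by (simp add: linear_sum[OF lin] linear_scale[OF lin] g_def partial_deriv_def)
    finally show ?thesis .
  qed
  have "frechet_derivative W (at p) = (\<lambda>v. 0)"
    using differential_zero_maxmin[of p "ball p r" W "frechet_derivative W (at p)"]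
      frechet_derivative_works[THEN iffD1, OF dW[of p]] W0 Wnn \<open>r > 0\<close> by auto
  then have gp: "g j p = 0" for j by (simp add: g_def partial_deriv_def)
  have Dg: "frechet_derivative (g j) (at p) v = (\<Sum>i\<in>UNIV. v $ i * hessian W p $ i $ j)" for j v
  proof -
    have lin: "linear (frechet_derivative (g j) (at p))" using dg by (rule linear_frechet_derivative)
    have "v = (\<Sum>i\<in>UNIV. v $ i *\<^sub>R axis i 1)"
      using basis_expansion[of v] by (simp add: scalar_mult_eq_scaleR)
    then have "frechet_derivative (g j) (at p) v = frechet_derivative (g j) (at p) (\<Sum>i\<in>UNIV. v $ i *\<^sub>R axis i 1)" by simp
    also have "\<dots> = (\<Sum>i\<in>UNIV. v $ i * hessian W p $ i $ j)"
      by (simp add: linear_sum[OF lin] linear_scale[OF lin]) (simp add: g_def partial_deriv_def hessian_def)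
    finally show ?thesis .
  qed
  obtain \<mu> where \<mu>: "\<mu> > 0" "\<And>v. \<mu> * (norm v)\<^sup>2 \<le> v \<bullet> (hessian W p *v v)"
    using positive_definite_coercive[OF pd] by blast
  have "\<forall>j. \<exists>d. d > 0 \<and> (\<forall>x. norm (x - p) < d \<longrightarrow>
      \<bar>g j x - (\<Sum>i\<in>UNIV. (x - p) $ i * hessian W p $ i $ j)\<bar> \<le> (\<mu>/4) * norm (x - p))"
  proof
    fix j
    have "(g j has_derivative frechet_derivative (g j) (at p)) (at p)"
      using dg frechet_derivative_works by blast
    then show "\<exists>d. d > 0 \<and> (\<forall>x. norm (x - p) < d \<longrightarrow>
      \<bar>g j x - (\<Sum>i\<in>UNIV. (x - p) $ i * hessian W p $ i $ j)\<bar> \<le> (\<mu>/4) * norm (x - p))"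
      using \<mu>(1) unfolding has_derivative_at_alt by (force simp: gp Dg dest!: spec[of _ "\<mu>/4"])
  qed
  then obtain d where d: "\<And>j. d j > 0" "\<And>j x. norm (x - p) < d j \<Longrightarrow>
      \<bar>g j x - (\<Sum>i\<in>UNIV. (x - p) $ i * hessian W p $ i $ j)\<bar> \<le> (\<mu>/4) * norm (x - p)"
    unfolding choice_iff by blast
  define \<rho> where "\<rho> = min r (Min (range d)) / 2"
  have Mind: "Min (range d) \<le> d j" for j by simp
  have "Min (range d) > 0" using d by simp
  then have \<rho>: "\<rho> > 0" "\<rho> < r" "\<And>j. \<rho> < d j"
    using \<open>r > 0\<close> Mind by (auto simp: \<rho>_def min_def not_le intro: less_le_trans)
       (smt (verit, best) Mind field_sum_of_halves)+
  have radial: "frechet_derivative W (at x) (x - p) \<ge> (\<mu>/2) * (norm (x - p))\<^sup>2" if x: "dist p x \<le> \<rho>" for x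
  proof -
    define u where "u = x - p"
    have nu: "norm u \<le> \<rho>" using x by (simp add: u_def dist_norm norm_minus_commute)
    have xb: "x \<in> ball p r" using x \<rho> by simp
    define R where "R = (\<lambda>j. g j x - (\<Sum>i\<in>UNIV. u $ i * hessian W p $ i $ j))"
    have R: "\<bar>R j\<bar> \<le> (\<mu>/4) * norm u" for j
      using d(2)[of x j] nu \<rho>(3)[of j] by (simp add: R_def u_def)
    have "frechet_derivative W (at x) u = (\<Sum>j\<in>UNIV. u $ j * ((\<Sum>i\<in>UNIV. u $ i * hessian W p $ i $ j) + R j))"
      by (simp add: fW[OF xb] R_def)
    also have "\<dots> = u \<bullet> (hessian W p *v u) + (\<Sum>j\<in>UNIV. u $ j * R j)"
      by (simp add: sum_2 inner_vec_def matrix_vector_mult_def algebra_simps)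
    also have "\<dots> \<ge> \<mu> * (norm u)\<^sup>2 - (\<mu>/2) * (norm u)\<^sup>2"
    proof -
      have "\<bar>\<Sum>j\<in>UNIV. u $ j * R j\<bar> \<le> (\<Sum>j\<in>(UNIV::2 set). norm u * ((\<mu>/4) * norm u))"
      proof (rule order_trans[OF sum_abs sum_mono])
        fix j
        show "\<bar>u $ j * R j\<bar> \<le> norm u * ((\<mu>/4) * norm u)"
          unfolding abs_mult using R component_le_norm_cart[of u j] by (intro mult_mono) auto
      qed
      also have "\<dots> = (\<mu>/2) * (norm u)\<^sup>2" by (simp add: power2_eq_square)
      finally show ?thesis using \<mu>(2)[of u] by (simp add: abs_le_iff)
    qed
    finally show ?thesis by (simp add: u_def)
  qed
  have growth: "\<mu>/4 * (norm (x - p))\<^sup>2 \<le> W x" if x: "dist p x \<le> \<rho>" for x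
  proof -
    define u where "u = x - p"
    define \<phi> where "\<phi> = (\<lambda>t. W (p + t *\<^sub>R u) - (\<mu>/4) * t\<^sup>2 * (norm u)\<^sup>2)"
    have inb: "dist p (p + t *\<^sub>R u) \<le> \<rho>" if "0 \<le> t" "t \<le> 1" for t
    proof -
      have "\<bar>t\<bar> * norm u \<le> 1 * norm u" using that by (intro mult_right_mono) auto
      then show ?thesis using x by (simp add: dist_norm u_def norm_minus_commute)
    qed
    \<comment> \<open>the radial derivative bound says that \<open>\<phi>\<close> is nondecreasing\<close>
    have "\<phi> 0 \<le> \<phi> 1"
    proof (rule DERIV_nonneg_imp_nondecreasing[where f = \<phi> and a = 0 and b = 1])
      fix t :: real assume t: "0 \<le> t" "t \<le> 1"
      let ?y = "p + t *\<^sub>R u"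
      have yb: "?y \<in> ball p r" using inb[OF t] \<rho> by simp
      have "(W has_derivative frechet_derivative W (at ?y)) (at ?y)"
        using dW[OF yb] frechet_derivative_works by blast
      moreover have "((\<lambda>t. p + t *\<^sub>R u) has_derivative (\<lambda>h. h *\<^sub>R u)) (at t)"
        by (auto intro!: derivative_eq_intros)
      ultimately have "((\<lambda>t. W (p + t *\<^sub>R u)) has_derivative (\<lambda>h. frechet_derivative W (at ?y) (h *\<^sub>R u))) (at t)"
        by (rule has_derivative_compose[rotated])
      then have "((\<lambda>t. W (p + t *\<^sub>R u)) has_derivative (\<lambda>h. frechet_derivative W (at ?y) u * h)) (at t)"
        using linear_scale[OF linear_frechet_derivative[OF dW[OF yb]]] by (simp add: mult.commute)
      then have D: "((\<lambda>t. W (p + t *\<^sub>R u)) has_real_derivative frechet_derivative W (at ?y) u) (at t)"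
        by (simp add: has_field_derivative_def)
      have "(\<phi> has_real_derivative frechet_derivative W (at ?y) u - (\<mu>/2) * t * (norm u)\<^sup>2) (at t)"
        unfolding \<phi>_def by (rule derivative_eq_intros D refl | simp)+
      moreover have "frechet_derivative W (at ?y) u - (\<mu>/2) * t * (norm u)\<^sup>2 \<ge> 0"
      proof (cases "t = 0")
        case True
        then show ?thesis using \<open>frechet_derivative W (at p) = (\<lambda>v. 0)\<close> by simp
      next
        case False
        then have "t > 0" using t by simp
        have "t * (frechet_derivative W (at ?y) u) = frechet_derivative W (at ?y) (?y - p)"
          using linear_scale[OF linear_frechet_derivative[OF dW[OF yb]], of t u] by simp
        moreover have "(norm (?y - p))\<^sup>2 = t * (t * (norm u)\<^sup>2)" by (simp add: power2_eq_square)
        ultimately have "(\<mu>/2) * (t * (t * (norm u)\<^sup>2)) \<le> t * (frechet_derivative W (at ?y) u)"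
          using radial[OF inb[OF t]] by simp
        then have "t * ((\<mu>/2) * t * (norm u)\<^sup>2) \<le> t * (frechet_derivative W (at ?y) u)"
          by (simp add: mult_ac)
        then show ?thesis using \<open>t > 0\<close> by simp
      qed
      ultimately show "\<exists>y. (\<phi> has_real_derivative y) (at t) \<and> y \<ge> 0" by blast
    qed simp
    then show ?thesis by (simp add: \<phi>_def W0 u_def)
  qed
  show ?thesis by (rule that[of "\<mu>/4" \<rho>]) (use \<mu> \<rho> growth in auto)
qed

text \<open>
  Finitely many of the given neighbourhoods cover the interval, and on an interval a uniform
  local Lipschitz bound is a global one.
\<close>

lemma locally_lipschitz_on_compact_imp_lipschitz:
  assumes "locally_lipschitz_on {0..1} g"
  shows "\<exists>L. L-lipschitz_on {0..1} g"
proof -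
  have "\<forall>t\<in>{0..1}. \<exists>u. u > 0 \<and> (\<exists>L. L-lipschitz_on (cball t u \<inter> {0..1}) g)"
    using assms by (auto simp: locally_lipschitz_on_def)
  then obtain u where u: "\<And>t. t \<in> {0..1} \<Longrightarrow> u t > 0" "\<And>t. t \<in> {0..1} \<Longrightarrow> \<exists>L. L-lipschitz_on (cball t (u t) \<inter> {0..1}) g"
    by metis
  then obtain K where K: "\<And>t. t \<in> {0..1} \<Longrightarrow> (K t)-lipschitz_on (cball t (u t) \<inter> {0..1}) g"
    by metis
  have cov: "{0..1} \<subseteq> (\<Union>t\<in>{0..1}. ball t (u t))" using u(1) by force
  obtain T where T: "T \<subseteq> {0..1}" "finite T" "{0..1} \<subseteq> (\<Union>t\<in>T. ball t (u t))"
    using compactE_image[OF compact_Icc _ cov] by auto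
  define L where "L = (\<Sum>t\<in>T. K t)"
  have Knn: "K t \<ge> 0" if "t \<in> T" for t using K T(1) that lipschitz_on_nonneg by blast
  then have L0: "L \<ge> 0" unfolding L_def by (rule sum_nonneg)
  have KL: "K t \<le> L" if "t \<in> T" for t
    unfolding L_def using that T(2) Knn by (meson member_le_sum DiffD1)
  have cont: "continuous_on {0..1} g"
    unfolding continuous_on_eq_continuous_within
  proof
    fix t :: real assume t: "t \<in> {0..1}"
    have "continuous_on (cball t (u t) \<inter> {0..1}) g" using K[OF t] by (rule lipschitz_on_continuous_on)
    then have "continuous (at t within (cball t (u t) \<inter> {0..1})) g"
      using t u(1)[OF t] by (simp add: continuous_on_eq_continuous_within)
    moreover have "at t within (cball t (u t) \<inter> {0..1}) = at t within {0..1}"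
      by (rule at_within_nhd[of t "ball t (u t)"]) (use u(1)[OF t] in auto)
    ultimately show "continuous (at t within {0..1}) g" by simp
  qed
  have "L-lipschitz_on {0..1} g"
  proof (rule locally_lipschitz_imp_lipschitz[OF cont _ L0])
    fix x y :: real assume x: "x \<in> {0..<1}" and "y > x"
    then obtain t where t: "t \<in> T" "dist t x < u t" using T(3) by force
    define z where "z = min (min y 1) (x + (u t - dist t x))"
    have z: "z \<in> {x<..y}" "z \<le> 1" "z - x \<le> u t - dist t x" using x \<open>y > x\<close> t by (auto simp: z_def)
    have "dist t z \<le> dist t x + dist x z" by (rule dist_triangle)
    then have "dist t z \<le> u t" using z by (simp add: dist_real_def)
    then have "dist (g z) (g x) \<le> K t * dist z x"
      using x z t T(1) by (intro lipschitz_onD[OF K[of t]]) auto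
    also have "\<dots> \<le> L * (z - x)" using KL[OF t(1)] z by (auto simp: dist_real_def intro: mult_right_mono)
    finally show "\<exists>z\<in>{x<..y}. dist (g z) (g x) \<le> L * (z - x)" using z by blast
  qed
  then show ?thesis by blast
qed

section \<open>Limits of curves of bounded energy\<close>

context weight
begin

lemma en_combine: "lipschitz_curve g \<Longrightarrow> a \<le> b \<Longrightarrow> b \<le> c \<Longrightarrow> en g a c = en g a b + en g b c"
  by (rule action_combine[OF _ lagrangian_continuous[OF E_lag]])

lemma ar_combine: "lipschitz_curve g \<Longrightarrow> a \<le> b \<Longrightarrow> b \<le> c \<Longrightarrow> ar g a c = ar g a b + ar g b c"
  by (rule action_combine[OF _ lagrangian_continuous[OF A_lag]])

lemma length_le_energy:
  assumes g: "lipschitz_curve g" and \<mu>: "\<And>t. t \<in> {a..b} \<Longrightarrow> \<mu> \<le> F (g t)"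
  shows "\<mu> * path_length g a b \<le> en g a b"
proof -
  have int: "(\<lambda>t. norm (vector_derivative g (at t))) integrable_on {a..b}"
    by (rule action_integrable[OF g lagrangian_continuous[OF lagrangian_norm]])
  have "\<mu> * path_length g a b = integral {a..b} (\<lambda>t. \<mu> * norm (vector_derivative g (at t)))"
    by (simp add: action_def)
  also have "\<dots> \<le> en g a b"
    unfolding action_def energy_density_def
    by (intro integral_le en_integrable[OF g] integrable_on_mult_right int mult_right_mono \<mu>) auto
  finally show ?thesis .
qed

text \<open>
  Subtracting the constant \<open>z $ 2\<close> from the second coordinate changes the area only by a term in
  the end points; the remaining integrand is dominated by that of the energy.
\<close>

lemma area_le_energy:
  assumes g: "lipschitz_curve g" and "a \<le> b" and F: "\<And>t. t \<in> {a..b} \<Longrightarrow> norm (g t - z) \<le> F (g t)"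
  shows "\<bar>ar g a b\<bar> \<le> en g a b + norm z * norm (g b - g a)"
proof -
  have lag: "lagrangian (\<lambda>x v. (x - z) $ 2 * v $ 1)" "lagrangian (\<lambda>(x::real^2) v. v $ 1)"
    unfolding lagrangian_def by (auto simp: case_prod_unfold intro!: continuous_intros)
  note i1 = action_integrable[OF g lagrangian_continuous[OF lag(1)], of a b]
  note i2 = action_integrable[OF g lagrangian_continuous[OF lag(2)], of a b]
  have "ar g a b = integral {a..b} (\<lambda>t. - ((g t - z) $ 2 * vector_derivative g (at t) $ 1) - z $ 2 * vector_derivative g (at t) $ 1)"
    unfolding action_def area_density_def by (rule integral_cong) (simp add: algebra_simps)
  also have "\<dots> = - integral {a..b} (\<lambda>t. (g t - z) $ 2 * vector_derivative g (at t) $ 1) - z $ 2 * (g b $ 1 - g a $ 1)"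
    using i1 i2 integral_vector_derivative_component[OF g \<open>a \<le> b\<close>, of 1]
    by (subst integral_diff) (auto intro: integrable_neg integrable_on_mult_right)
  finally have eq: "ar g a b = - integral {a..b} (\<lambda>t. (g t - z) $ 2 * vector_derivative g (at t) $ 1) - z $ 2 * (g b $ 1 - g a $ 1)" .
  have "norm (integral {a..b} (\<lambda>t. (g t - z) $ 2 * vector_derivative g (at t) $ 1)) \<le> en g a b"
    unfolding action_def energy_density_def
  proof (rule integral_norm_bound_integral[OF i1 en_integrable[OF g]])
    fix t assume t: "t \<in> {a..b}"
    have "\<bar>(g t - z) $ 2\<bar> * \<bar>vector_derivative g (at t) $ 1\<bar> \<le> F (g t) * norm (vector_derivative g (at t))"
      using F[OF t] component_le_norm_cart[of "g t - z" 2] component_le_norm_cart[of "vector_derivative g (at t)" 1]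
      by (intro mult_mono) (auto simp: F_nonneg)
    then show "norm ((g t - z) $ 2 * vector_derivative g (at t) $ 1) \<le> F (g t) * norm (vector_derivative g (at t))"
      by (simp add: abs_mult)
  qed
  moreover have "\<bar>z $ 2 * (g b $ 1 - g a $ 1)\<bar> \<le> norm z * norm (g b - g a)"
    unfolding abs_mult using component_le_norm_cart[of z 2] component_le_norm_cart[of "g b - g a" 1]
    by (intro mult_mono) auto
  ultimately show ?thesis unfolding eq by simp
qed

end

text \<open>
  The wells \<open>p\<close> and \<open>q\<close> with their balls of radius \<open>R\<close>. Inside distance \<open>2 * \<delta>\<close> of a well the
  weight grows at least linearly, with rate \<open>c\<close>; outside distance \<open>\<delta>\<close> from both wells it is at
  least \<open>m\<close>, so \<open>m * \<delta>\<close> is a lower bound for the energy of crossing one of the annuli.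
\<close>

locale double_well = weight F for F +
  fixes p q :: "real ^ 2" and R :: "real ^ 2 \<Rightarrow> real" and \<delta> c m :: real
  assumes \<delta>: "\<delta> > 0" and c: "c > 0" and m: "m > 0"
    and room: "z \<in> {p, q} \<Longrightarrow> 2 * \<delta> < R z"
    and growth: "z \<in> {p, q} \<Longrightarrow> dist z x \<le> 2 * \<delta> \<Longrightarrow> c * norm (x - z) \<le> F x"
    and apart: "cball p (2 * \<delta>) \<inter> cball q (2 * \<delta>) = {}"
    and away: "(\<And>z. z \<in> {p, q} \<Longrightarrow> \<delta> \<le> dist z x) \<Longrightarrow> m \<le> F x"
    and coercive: "\<eta> > 0 \<Longrightarrow> \<exists>\<mu>>0. \<forall>x. (\<forall>z\<in>{p, q}. \<eta> \<le> dist z x) \<longrightarrow> \<mu> \<le> F x"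
    and minimizers: "z \<in> {p, q} \<Longrightarrow> local_minimizers_exist F z (ball z (R z))"
begin

text \<open>
  Area \<open>A\<close> concentrated at the well \<open>z\<close> at the price \<open>e\<close>. No single curve need realize it.
\<close>

definition loop :: "real ^ 2 \<Rightarrow> real \<Rightarrow> real \<Rightarrow> bool" where
  "loop z A e \<longleftrightarrow> nearly_linked (ball z (R z)) z z A e"

text \<open>
  The form in which limits of curves appear: a genuine curve, and what has concentrated at the
  wells. The loops are collected regardless of when the curves visited the wells, since only the
  total area and energy matter.
\<close>

definition linked_with_loops :: "real ^ 2 \<Rightarrow> real ^ 2 \<Rightarrow> real \<Rightarrow> real \<Rightarrow> bool" where
  "linked_with_loops x y A e \<longleftrightarrow> (\<exists>A0 e0 Ap ep Aq eq. linked UNIV x y A0 e0 \<and> loop p Ap ep \<and> loop q Aq eq \<and>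
                      A = A0 + Ap + Aq \<and> e = e0 + ep + eq)"

lemma R_pos: "z \<in> {p, q} \<Longrightarrow> 0 < R z"
  using room[of z] \<delta> by linarith

lemma loop_zero: "z \<in> {p, q} \<Longrightarrow> loop z 0 0"
  unfolding loop_def by (rule nearly_linked_of_linked, rule linked_refl) (simp add: R_pos)

lemma loop_add: "loop z A e \<Longrightarrow> loop z A' e' \<Longrightarrow> loop z (A + A') (e + e')"
  unfolding loop_def by (rule nearly_linked_trans)

lemma loop_reverse: "loop z A e \<Longrightarrow> loop z (- A) e"
  unfolding loop_def by (rule nearly_linked_reverse)

lemma linked_with_loopsI:
  assumes "linked UNIV x y A0 e0" "loop p Ap ep" "loop q Aq eq" "A = A0 + Ap + Aq" "e = e0 + ep + eq"
  shows "linked_with_loops x y A e"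
  unfolding linked_with_loops_def using assms by blast

lemma linked_with_loops_linked: "linked UNIV x y A e \<Longrightarrow> linked_with_loops x y A e"
  by (rule linked_with_loopsI[OF _ loop_zero loop_zero]) auto

lemma linked_with_loops_loop:
  assumes "z \<in> {p, q}" "loop z A e"
  shows "linked_with_loops z z A e"
proof (cases "z = p")
  case True
  then show ?thesis using assms linked_with_loopsI[OF linked_refl[of z UNIV] _ loop_zero[of q], of A e] by auto
next
  case False
  then show ?thesis using assms linked_with_loopsI[OF linked_refl[of z UNIV] loop_zero[of p], of A e] by auto
qed

lemma linked_with_loops_trans:
  assumes "linked_with_loops x y A e" "linked_with_loops y z A' e'"
  shows "linked_with_loops x z (A + A') (e + e')"
proof -
  obtain A0 e0 Ap ep Aq eq where 1: "linked UNIV x y A0 e0" "loop p Ap ep" "loop q Aq eq"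
      "A = A0 + Ap + Aq" "e = e0 + ep + eq"
    using assms(1) unfolding linked_with_loops_def by blast
  obtain B0 f0 Bp fp Bq fq where 2: "linked UNIV y z B0 f0" "loop p Bp fp" "loop q Bq fq"
      "A' = B0 + Bp + Bq" "e' = f0 + fp + fq"
    using assms(2) unfolding linked_with_loops_def by blast
  show ?thesis
    by (rule linked_with_loopsI[OF linked_trans[OF 1(1) 2(1)] loop_add[OF 1(2) 2(2)] loop_add[OF 1(3) 2(3)]])
       (use 1 2 in auto)
qed

lemma linked_with_loops_reverse:
  assumes "linked_with_loops x y A e"
  shows "linked_with_loops y x (- A) e"
proof -
  obtain A0 e0 Ap ep Aq eq where 1: "linked UNIV x y A0 e0" "loop p Ap ep" "loop q Aq eq"
      "A = A0 + Ap + Aq" "e = e0 + ep + eq"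
    using assms(1) unfolding linked_with_loops_def by blast
  show ?thesis
    by (rule linked_with_loopsI[OF linked_reverse[OF 1(1)] loop_reverse[OF 1(2)] loop_reverse[OF 1(3)]])
       (use 1 in auto)
qed

text \<open>
  A piece ending at a well is either a loop, or starts at a point where a local minimizer
  exists.
\<close>

lemma linked_with_loops_to_well:
  assumes z: "z \<in> {p, q}" and x: "x \<in> ball z (R z)" and nl: "nearly_linked (ball z (R z)) x z A e"
  shows "linked_with_loops x z A e"
proof (cases "x = z")
  case True
  then show ?thesis using linked_with_loops_loop[OF z] nl by (simp add: loop_def)
next
  case False
  have "linked (ball z (R z)) x z A e"
    by (rule linked_of_minimizer[OF minimizers[OF z] x False nl])
  then have "linked UNIV x z A e" by (rule linked_mono) auto
  then show ?thesis by (rule linked_with_loops_linked)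
qed

text \<open>
  Otherwise the curve crosses the annulus between the circles of radius \<open>\<delta>\<close> and \<open>2 * \<delta>\<close>, and
  in the annulus the weight is at least \<open>m\<close>.
\<close>

lemma crossing_forward:
  assumes g: "lipschitz_curve g" and en: "en g 0 1 < m * \<delta>" and z: "z \<in> {p, q}"
    and "0 \<le> s" "s \<le> t" "t \<le> 1" and s: "dist z (g s) \<le> \<delta>"
  shows "dist z (g t) \<le> 2 * \<delta>"
proof (rule ccontr)
  assume far: "\<not> dist z (g t) \<le> 2 * \<delta>"
  have cont: "continuous_on S (\<lambda>t. dist z (g t))" for S
    by (intro continuous_intros lipschitz_curve_continuous[OF g])
  obtain v where v: "v \<in> {s..t}" "dist z (g v) = 2 * \<delta>" "\<And>x. x \<in> {s..v} \<Longrightarrow> dist z (g x) \<le> 2 * \<delta>"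
    using first_hitting_time[OF cont \<open>s \<le> t\<close>, where v = "2 * \<delta>"] s far \<delta> by auto
  obtain u where u: "u \<in> {s..v}" "dist z (g u) = \<delta>" "\<And>x. x \<in> {u..v} \<Longrightarrow> \<delta> \<le> dist z (g x)"
    using last_exit_time[OF cont, of s v \<delta>] s v \<delta> by auto
  have "m \<le> F (g x)" if x: "x \<in> {u..v}" for x
  proof (rule away)
    fix w assume w: "w \<in> {p, q}"
    show "\<delta> \<le> dist w (g x)"
    proof (cases "w = z")
      case True
      then show ?thesis using u(3)[OF x] by simp
    next
      case False
      have "g x \<in> cball z (2 * \<delta>)" using v(3)[of x] u x by simp
      then have "g x \<notin> cball w (2 * \<delta>)" using apart z w False by auto
      then show ?thesis using \<delta> by simp
    qed
  qed
  then have "m * path_length g u v \<le> en g u v" by (rule length_le_energy[OF g])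
  moreover have "m * \<delta> \<le> m * path_length g u v"
  proof (rule mult_left_mono)
    have "dist z (g v) \<le> dist z (g u) + dist (g u) (g v)" by (rule dist_triangle)
    then have "\<delta> \<le> norm (g v - g u)" using u(2) v(2) by (simp add: dist_norm norm_minus_commute)
    then show "\<delta> \<le> path_length g u v" using dist_le_length[OF g, of u v] u by simp
  qed (use m in simp)
  moreover have "en g 0 1 = en g 0 u + (en g u v + en g v 1)"
    using en_combine[OF g, of 0 u 1] en_combine[OF g, of u v 1] u v assms by auto
  ultimately show False using en en_nonneg[OF g, of 0 u] en_nonneg[OF g, of v 1] by linarith
qed

lemma crossing:
  assumes g: "curve g" and en: "en g 0 1 < m * \<delta>" and z: "z \<in> {p, q}"
    and s: "s \<in> {0..1}" "dist z (g s) \<le> \<delta>"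
  shows "g ` {0..1} \<subseteq> cball z (2 * \<delta>)"
proof
  fix y assume "y \<in> g ` {0..1}"
  then obtain t where t: "t \<in> {0..1}" "y = g t" by blast
  have "dist z (g t) \<le> 2 * \<delta>"
  proof (cases "s \<le> t")
    case True
    then show ?thesis using crossing_forward[OF curve_lipschitz[OF g] en z] s t by auto
  next
    case False
    have r: "curve (reverse_curve g)" using g by (rule curve_reverse)
    have "en (reverse_curve g) 0 1 < m * \<delta>"
      using action_reverse[OF g E_lag] en by (simp add: energy_density_def[abs_def])
    from crossing_forward[OF curve_lipschitz[OF r] this z, of "1 - s" "1 - t"]
    show ?thesis using False s t by (auto simp: reverse_curve_def)
  qed
  then show "y \<in> cball z (2 * \<delta>)" using t by simp
qed

text \<open>
  The subsequence is chosen such that end points, areas and energies converge to data that are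
  realized up to loops. Convergence of the curves themselves is not claimed, because near the
  wells they are replaced.
\<close>

definition subconverges :: "(nat \<Rightarrow> real \<Rightarrow> real ^ 2) \<Rightarrow> real ^ 2 \<Rightarrow> bool" where
  "subconverges g x \<longleftrightarrow> (\<exists>k y A e. strict_mono (k :: nat \<Rightarrow> nat) \<and> (\<lambda>j. g (k j) 1) \<longlonglongrightarrow> y \<and>
      (\<lambda>j. ar (g (k j)) 0 1) \<longlonglongrightarrow> A \<and> (\<lambda>j. en (g (k j)) 0 1) \<longlonglongrightarrow> e \<and> linked_with_loops x y A e)"

lemma subconverges_subseq:
  assumes "strict_mono k" "subconverges (\<lambda>j. g (k j)) x"
  shows "subconverges g x"
proof -
  obtain r y A e where r: "strict_mono (r :: nat \<Rightarrow> nat)" "(\<lambda>j. g (k (r j)) 1) \<longlonglongrightarrow> y"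
      "(\<lambda>j. ar (g (k (r j))) 0 1) \<longlonglongrightarrow> A" "(\<lambda>j. en (g (k (r j))) 0 1) \<longlonglongrightarrow> e" "linked_with_loops x y A e"
    using assms(2) unfolding subconverges_def by blast
  have "strict_mono (k \<circ> r)" using assms(1) r(1) by (rule strict_mono_o)
  then show ?thesis unfolding subconverges_def using r(2-5) by (intro exI[of _ "k \<circ> r"]) auto
qed

text \<open>
  Lower semicontinuity is used three times: for the energy, and for the area density together
  with its negative.
\<close>

lemma subconverges_bounded_length:
  assumes g: "\<And>j. curve (g j)" and en: "\<And>j. en (g j) 0 1 \<le> \<kappa>" and x: "(\<lambda>j. g j 0) \<longlonglongrightarrow> x"
    and len: "\<And>j. path_length (g j) 0 1 \<le> \<Lambda>"
  shows "subconverges g x"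
proof -
  note gl = curve_lipschitz[OF g]
  obtain R0 where R0: "\<And>j. norm (g j 0) \<le> R0"
    using convergent_imp_bounded[OF x] unfolding bounded_iff by auto
  define K where "K = R0 + \<Lambda>"
  have near: "norm (g j t) \<le> K" if "t \<in> {0..1}" for j t
  proof -
    have "path_length (g j) 0 1 = path_length (g j) 0 t + path_length (g j) t 1"
      using action_combine[OF gl lagrangian_continuous[OF lagrangian_norm]] that by auto
    moreover have "norm (g j t - g j 0) \<le> path_length (g j) 0 t"
      using dist_le_length[OF gl] that by auto
    moreover have "0 \<le> norm (g j 1 - g j t)" "norm (g j 1 - g j t) \<le> path_length (g j) t 1"
      using dist_le_length[OF gl, of t 1 j] that by auto
    ultimately have "norm (g j t - g j 0) \<le> \<Lambda>" using len[of j] by linarith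
    then show ?thesis using R0[of j] norm_triangle_sub[of "g j t" "g j 0"] by (simp add: K_def)
  qed
  have K0: "K \<ge> 0" using order_trans[OF norm_ge_zero near[of 0 0]] by simp
  interpret const: weight "\<lambda>x. K" by standard (auto simp: K0)
  have ar: "\<bar>ar (g j) 0 1\<bar> \<le> K * \<Lambda>" for j
  proof -
    have "\<bar>ar (g j) 0 1\<bar> \<le> action (energy_density (\<lambda>x. K)) (g j) 0 1 + norm (0::real^2) * norm (g j 1 - g j 0)"
      by (rule const.area_le_energy[OF gl]) (use near in auto)
    also have "action (energy_density (\<lambda>x. K)) (g j) 0 1 = K * path_length (g j) 0 1"
      by (simp add: action_def energy_density_def)
    finally show ?thesis using mult_left_mono[OF len[of j] K0] by simp
  qed
  have "bounded (range (\<lambda>j. (g j 1, ar (g j) 0 1, en (g j) 0 1)))"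
  proof (rule bounded_subset)
    show "bounded (cball (0::real^2) K \<times> {- (K * \<Lambda>)..K * \<Lambda>} \<times> {0..\<kappa>})"
      by (intro bounded_Times bounded_cball bounded_closed_interval)
    show "range (\<lambda>j. (g j 1, ar (g j) 0 1, en (g j) 0 1)) \<subseteq> cball (0::real^2) K \<times> {- (K * \<Lambda>)..K * \<Lambda>} \<times> {0..\<kappa>}"
      using near ar en en_nonneg[OF gl] by (auto simp: abs_le_iff) (metis abs_le_D2 abs_minus_cancel abs_minus_commute minus_le_iff)
  qed
  then obtain k l where k: "strict_mono (k :: nat \<Rightarrow> nat)"
      "((\<lambda>j. (g j 1, ar (g j) 0 1, en (g j) 0 1)) \<circ> k) \<longlonglongrightarrow> l"
    using bounded_imp_convergent_subsequence by blast
  obtain y A e where l: "l = (y, A, e)" by (cases l) auto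
  have lim: "(\<lambda>j. g (k j) 1) \<longlonglongrightarrow> y" "(\<lambda>j. ar (g (k j)) 0 1) \<longlonglongrightarrow> A" "(\<lambda>j. en (g (k j)) 0 1) \<longlonglongrightarrow> e"
    using tendsto_fst[OF k(2)] tendsto_fst[OF tendsto_snd[OF k(2)]] tendsto_snd[OF tendsto_snd[OF k(2)]]
    by (simp_all add: l o_def)
  obtain \<alpha> r where \<alpha>: "strict_mono (r :: nat \<Rightarrow> nat)" "curve \<alpha>"
    "(\<lambda>j. g (k (r j)) 0) \<longlonglongrightarrow> \<alpha> 0" "(\<lambda>j. g (k (r j)) 1) \<longlonglongrightarrow> \<alpha> 1"
    "\<And>\<Phi> E. convex_lagrangian \<Phi> \<Longrightarrow>
       (\<lambda>j. action \<Phi> (g (k (r j))) 0 1) \<longlonglongrightarrow> E \<Longrightarrow> action \<Phi> \<alpha> 0 1 \<le> E"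
    by (rule curves_compactness[of "\<lambda>j. g (k j)" \<Lambda> R0, OF g len R0]) (rule that, assumption+)
  have kr: "strict_mono (k \<circ> r)" using k(1) \<alpha>(1) by (rule strict_mono_o)
  have 0: "\<alpha> 0 = x"
    using LIMSEQ_unique[OF \<alpha>(3)] LIMSEQ_subseq_LIMSEQ[OF x kr] by (simp add: o_def)
  have 1: "\<alpha> 1 = y"
    using LIMSEQ_unique[OF \<alpha>(4)] LIMSEQ_subseq_LIMSEQ[OF lim(1) \<alpha>(1)] by (simp add: o_def)
  have e: "en \<alpha> 0 1 \<le> e"
    using LIMSEQ_subseq_LIMSEQ[OF lim(3) \<alpha>(1)]
    by (intro \<alpha>(5)[OF convex_lagrangian_energy_density[OF F_cont F_nonneg]]) (simp add: o_def)
  have arr: "(\<lambda>j. ar (g (k (r j))) 0 1) \<longlonglongrightarrow> A"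
    using LIMSEQ_subseq_LIMSEQ[OF lim(2) \<alpha>(1)] by (simp add: o_def)
  have A1: "ar \<alpha> 0 1 \<le> A"
    by (rule \<alpha>(5)[OF convex_lagrangian_area_density(1) arr])
  have "action (\<lambda>x v. - area_density x v) \<alpha> 0 1 \<le> - A"
    by (rule \<alpha>(5)[OF convex_lagrangian_area_density(2)])
       (auto simp: action_minus intro: tendsto_minus arr)
  then have "ar \<alpha> 0 1 = A" using A1 by (simp add: action_minus)
  then have "linked UNIV x y A e" using \<alpha>(2) 0 1 e by (intro linkedI[of \<alpha>]) auto
  then have "linked_with_loops x y A e" by (rule linked_with_loops_linked)
  then show ?thesis unfolding subconverges_def using k(1) lim by blast
qed

lemma area_near_well:
  assumes "lipschitz_curve g" "z \<in> {p, q}" "a \<le> b" "g ` {a..b} \<subseteq> cball z (2 * \<delta>)"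
  shows "\<bar>ar g a b\<bar> \<le> en g a b / c + norm z * (4 * \<delta>)"
proof -
  interpret scaled: weight "\<lambda>x. F x / c"
    by standard (use F_cont F_nonneg c in \<open>auto intro!: continuous_intros\<close>)
  have "\<bar>ar g a b\<bar> \<le> action (energy_density (\<lambda>x. F x / c)) g a b + norm z * norm (g b - g a)"
  proof (rule scaled.area_le_energy[OF assms(1,3)])
    fix t assume "t \<in> {a..b}"
    then have "dist z (g t) \<le> 2 * \<delta>" using assms(4) by (simp add: image_subset_iff)
    then show "norm (g t - z) \<le> F (g t) / c"
      using growth[OF assms(2), of "g t"] c by (simp add: pos_le_divide_eq mult.commute)
  qed
  also have "action (energy_density (\<lambda>x. F x / c)) g a b = en g a b / c"
    by (simp add: action_def energy_density_def)
  also have "norm z * norm (g b - g a) \<le> norm z * (4 * \<delta>)"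
  proof (rule mult_left_mono)
    have "dist z (g a) \<le> 2 * \<delta>" "dist z (g b) \<le> 2 * \<delta>"
      using assms(3,4) by (simp_all add: image_subset_iff)
    then show "norm (g b - g a) \<le> 4 * \<delta>"
      using dist_triangle2[of "g b" "g a" z] by (simp add: dist_norm dist_commute norm_minus_commute)
  qed simp
  finally show ?thesis by simp
qed

text \<open>
  The arcs are cut at parameters whose points tend to the well. Both halves have bounded areas,
  because near the well the energy controls the area, so limits of areas and energies exist along
  a subsequence. By \<open>nearly_linked_limit\<close> the limits are approached by curves that end, or start,
  exactly at the well.
\<close>

lemma subconverges_near_well:
  assumes g: "\<And>j. curve (g j)" and en: "\<And>j. en (g j) 0 1 \<le> \<kappa>" and x: "(\<lambda>j. g j 0) \<longlonglongrightarrow> x"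
    and z: "z \<in> {p, q}" and im: "\<And>j. g j ` {0..1} \<subseteq> cball z (2 * \<delta>)"
    and t: "\<And>j. t j \<in> {0..1}" and lim: "(\<lambda>j. g j (t j)) \<longlonglongrightarrow> z"
  shows "subconverges g x"
proof -
  note gl = curve_lipschitz[OF g]
  have split: "en (g j) 0 1 = en (g j) 0 (t j) + en (g j) (t j) 1"
              "ar (g j) 0 1 = ar (g j) 0 (t j) + ar (g j) (t j) 1" for j
    using en_combine[OF gl] ar_combine[OF gl] t[of j] by auto
  have e12: "0 \<le> en (g j) 0 (t j)" "0 \<le> en (g j) (t j) 1" "en (g j) 0 (t j) \<le> \<kappa>" "en (g j) (t j) 1 \<le> \<kappa>" for j
    using en_nonneg[OF gl, of j 0 "t j"] en_nonneg[OF gl, of j "t j" 1] en[of j] split(1)[of j] by linarith+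
  have im': "g j ` {0..t j} \<subseteq> cball z (2 * \<delta>)" "g j ` {t j..1} \<subseteq> cball z (2 * \<delta>)" for j
    using im[of j] t[of j] by (auto simp: image_subset_iff)
  define K where "K = \<kappa> / c + norm z * (4 * \<delta>)"
  have a12: "\<bar>ar (g j) 0 (t j)\<bar> \<le> K" "\<bar>ar (g j) (t j) 1\<bar> \<le> K" for j
  proof -
    have "en (g j) 0 (t j) / c \<le> \<kappa> / c" "en (g j) (t j) 1 / c \<le> \<kappa> / c"
      using e12 c by (auto intro: divide_right_mono)
    then show "\<bar>ar (g j) 0 (t j)\<bar> \<le> K" "\<bar>ar (g j) (t j) 1\<bar> \<le> K"
      using area_near_well[OF gl z _ im'(1), of j] area_near_well[OF gl z _ im'(2), of j] t[of j]
      by (auto simp: K_def)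
  qed
  let ?X = "\<lambda>j. (g j 1, ar (g j) 0 (t j), ar (g j) (t j) 1, en (g j) 0 (t j), en (g j) (t j) 1)"
  have "bounded (range ?X)"
  proof (rule bounded_subset)
    show "bounded (cball z (2 * \<delta>) \<times> cball (0::real) K \<times> cball (0::real) K \<times> {0..\<kappa>} \<times> {0..\<kappa>})"
      by (intro bounded_Times bounded_cball bounded_closed_interval)
    have "g j 1 \<in> cball z (2 * \<delta>)" for j using im[of j] by (simp add: image_subset_iff)
    then show "range ?X \<subseteq> cball z (2 * \<delta>) \<times> cball (0::real) K \<times> cball (0::real) K \<times> {0..\<kappa>} \<times> {0..\<kappa>}"
      using e12 a12 by auto
  qed
  then obtain k l where k: "strict_mono (k :: nat \<Rightarrow> nat)" "(?X \<circ> k) \<longlonglongrightarrow> l"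
    using bounded_imp_convergent_subsequence by blast
  obtain y A A' e e' where l: "l = (y, A, A', e, e')" by (cases l) auto
  note s2 = tendsto_snd[OF k(2)]
  note s3 = tendsto_snd[OF s2]
  note s4 = tendsto_snd[OF s3]
  have L: "(\<lambda>j. g (k j) 1) \<longlonglongrightarrow> y" "(\<lambda>j. ar (g (k j)) 0 (t (k j))) \<longlonglongrightarrow> A" "(\<lambda>j. ar (g (k j)) (t (k j)) 1) \<longlonglongrightarrow> A'"
      "(\<lambda>j. en (g (k j)) 0 (t (k j))) \<longlonglongrightarrow> e" "(\<lambda>j. en (g (k j)) (t (k j)) 1) \<longlonglongrightarrow> e'"
    using tendsto_fst[OF k(2)] tendsto_fst[OF s2] tendsto_fst[OF s3] tendsto_fst[OF s4] tendsto_snd[OF s4]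
    by (simp_all add: l o_def)
  have x': "(\<lambda>j. g (k j) 0) \<longlonglongrightarrow> x" and z': "(\<lambda>j. g (k j) (t (k j))) \<longlonglongrightarrow> z"
    using LIMSEQ_subseq_LIMSEQ[OF x k(1)] LIMSEQ_subseq_LIMSEQ[OF lim k(1)] by (simp_all add: o_def)
  have sub: "cball z (2 * \<delta>) \<subseteq> ball z (R z)" using room[OF z] by auto
  have xB: "x \<in> ball z (R z)"
    using closed_sequentially[OF closed_cball _ x, of z "2 * \<delta>"] im sub by (auto simp: image_subset_iff)
  have yB: "y \<in> ball z (R z)"
    using closed_sequentially[OF closed_cball _ L(1), of z "2 * \<delta>"] im sub by (auto simp: image_subset_iff)
  have zB: "z \<in> ball z (R z)" using R_pos[OF z] by simp
  have l1: "linked (ball z (R z)) (g (k j) 0) (g (k j) (t (k j))) (ar (g (k j)) 0 (t (k j))) (en (g (k j)) 0 (t (k j)))" for j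
    using t[of "k j"] by (intro linked_subcurve[OF g] order_trans[OF im'(1) sub]) auto
  have l2: "linked (ball z (R z)) (g (k j) (t (k j))) (g (k j) 1) (ar (g (k j)) (t (k j)) 1) (en (g (k j)) (t (k j)) 1)" for j
    using t[of "k j"] by (intro linked_subcurve[OF g] order_trans[OF im'(2) sub]) auto
  have g1: "linked_with_loops x z A e"
    by (rule linked_with_loops_to_well[OF z xB nearly_linked_limit[OF l1 x' z' L(2) L(4) xB zB]])
  have "nearly_linked (ball z (R z)) y z (- A') e'"
    by (rule nearly_linked_reverse[OF nearly_linked_limit[OF l2 z' L(1) L(3) L(5) zB yB]])
  from linked_with_loops_reverse[OF linked_with_loops_to_well[OF z yB this]] have g2: "linked_with_loops z y A' e'" by simp
  have "linked_with_loops x y (A + A') (e + e')" using g1 g2 by (rule linked_with_loops_trans)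
  moreover have "(\<lambda>j. ar (g (k j)) 0 1) \<longlonglongrightarrow> A + A'" "(\<lambda>j. en (g (k j)) 0 1) \<longlonglongrightarrow> e + e'"
    unfolding split by (intro tendsto_intros L)+
  ultimately show ?thesis unfolding subconverges_def using k(1) L(1) by blast
qed

lemma infinite_subsequence:
  fixes S :: "nat set"
  assumes "infinite S"
  obtains k :: "nat \<Rightarrow> nat" where "strict_mono k" "\<And>j. k j \<in> S"
  using infinite_enumerate[OF assms] by blast

text \<open>
  If no subsequence has bounded lengths, then almost all arcs enter every neighbourhood of the
  wells, since away from the wells the energy controls the length. By \<open>crossing\<close> an arc that comes
  close to one well stays near it, so infinitely many arcs belong to the same well and approach
  it.
\<close>

lemma subconverges_small_energy:
  assumes g: "\<And>j. curve (g j)" and en: "\<And>j. en (g j) 0 1 \<le> \<kappa>" and \<kappa>: "\<kappa> < m * \<delta>"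
    and x: "(\<lambda>j. g j 0) \<longlonglongrightarrow> x"
  shows "subconverges g x"
proof (cases "\<exists>\<Lambda>. infinite {j. path_length (g j) 0 1 \<le> \<Lambda>}")
  case True
  then obtain \<Lambda> k where k: "strict_mono (k :: nat \<Rightarrow> nat)" "\<And>j. path_length (g (k j)) 0 1 \<le> \<Lambda>"
    using infinite_subsequence by (metis (mono_tags, lifting) mem_Collect_eq)
  have "(\<lambda>j. g (k j) 0) \<longlonglongrightarrow> x" using LIMSEQ_subseq_LIMSEQ[OF x k(1)] by (simp add: o_def)
  from subconverges_bounded_length[OF g en this k(2)] show ?thesis by (rule subconverges_subseq[OF k(1)])
next
  case False
  note gl = curve_lipschitz[OF g]
  have far: "finite {j. \<forall>t\<in>{0..1}. \<forall>z\<in>{p, q}. \<eta> \<le> dist z (g j t)}" if "\<eta> > 0" for \<eta>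
  proof -
    obtain \<mu> where \<mu>: "\<mu> > 0" "\<And>x. (\<forall>z\<in>{p, q}. \<eta> \<le> dist z x) \<Longrightarrow> \<mu> \<le> F x"
      using coercive[OF \<open>\<eta> > 0\<close>] by blast
    have "{j. \<forall>t\<in>{0..1}. \<forall>z\<in>{p, q}. \<eta> \<le> dist z (g j t)} \<subseteq> {j. path_length (g j) 0 1 \<le> \<kappa> / \<mu>}"
    proof safe
      fix j assume j: "\<forall>t\<in>{0..1}. \<forall>z\<in>{p, q}. \<eta> \<le> dist z (g j t)"
      have "\<mu> * path_length (g j) 0 1 \<le> en (g j) 0 1"
        by (rule length_le_energy[OF gl]) (use j \<mu>(2) in blast)
      then show "path_length (g j) 0 1 \<le> \<kappa> / \<mu>"
        using en[of j] \<mu>(1) by (simp add: field_simps)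
    qed
    then show ?thesis using False finite_subset by blast
  qed
  \<comment> \<open>the arcs that come close to the well \<open>z\<close>\<close>
  define N where "N = (\<lambda>z. {j. \<exists>t\<in>{0..1}. dist z (g j t) < \<delta>})"
  have "- {j. \<forall>t\<in>{0..1}. \<forall>z\<in>{p, q}. \<delta> \<le> dist z (g j t)} \<subseteq> N p \<union> N q"
    by (auto simp: N_def not_le)
  moreover have "infinite (- {j. \<forall>t\<in>{0..1}. \<forall>z\<in>{p, q}. \<delta> \<le> dist z (g j t)})"
    using far[OF \<delta>] by (simp add: Compl_eq_Diff_UNIV Diff_infinite_finite)
  ultimately have "infinite (N p) \<or> infinite (N q)" using finite_subset by blast
  then obtain z where z: "z \<in> {p, q}" "infinite (N z)" by blast
  obtain k where k: "strict_mono (k :: nat \<Rightarrow> nat)" "\<And>j. k j \<in> N z"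
    using infinite_subsequence[OF z(2)] by blast
  have im: "g (k j) ` {0..1} \<subseteq> cball z (2 * \<delta>)" for j
  proof -
    obtain s where "s \<in> {0..1}" "dist z (g (k j) s) < \<delta>" using k(2)[of j] by (auto simp: N_def)
    then show ?thesis using en[of "k j"] \<kappa> by (intro crossing[OF g _ z(1)]) auto
  qed
  have "\<exists>t\<in>{0..1}. \<forall>s\<in>{0..1}. dist z (g (k j) t) \<le> dist z (g (k j) s)" for j
    by (rule continuous_attains_inf)
       (auto intro!: continuous_intros lipschitz_curve_continuous[OF gl])
  then obtain t where t: "\<And>j. t j \<in> {0..1}" "\<And>j s. s \<in> {0..1} \<Longrightarrow> dist z (g (k j) (t j)) \<le> dist z (g (k j) s)"
    by metis
  have lim: "(\<lambda>j. g (k j) (t j)) \<longlonglongrightarrow> z"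
  proof (rule metric_LIMSEQ_I)
    fix \<eta>' :: real assume "\<eta>' > 0"
    define \<eta> where "\<eta> = min \<eta>' \<delta>"
    have \<eta>: "\<eta> > 0" "\<eta> \<le> \<eta>'" "\<eta> \<le> \<delta>" using \<open>\<eta>' > 0\<close> \<delta> by (auto simp: \<eta>_def)
    define S where "S = {j. \<forall>t\<in>{0..1}. \<forall>z\<in>{p, q}. \<eta> \<le> dist z (g j t)}"
    have "finite S" unfolding S_def by (rule far[OF \<eta>(1)])
    then obtain J where J: "\<And>j. j \<in> S \<Longrightarrow> j < J"
      unfolding finite_nat_set_iff_bounded by blast
    have "dist (g (k j) (t j)) z < \<eta>'" if "j \<ge> J" for j
    proof -
      have "k j \<ge> J" using that strict_mono_imp_increasing[OF k(1)] order_trans by blast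
      then have "\<not> (\<forall>t\<in>{0..1}. \<forall>z\<in>{p, q}. \<eta> \<le> dist z (g (k j) t))" using J[of "k j"] by (auto simp: S_def)
      then obtain s w where s: "s \<in> {0..1}" "w \<in> {p, q}" "dist w (g (k j) s) < \<eta>" by (meson not_le)
      have "g (k j) s \<in> cball z (2 * \<delta>)" using im[of j] s(1) by (simp only: image_subset_iff)
      moreover have "g (k j) s \<in> cball w (2 * \<delta>)" using s(3) \<eta> \<delta> by simp
      ultimately have "w = z" using apart z(1) s(2) by auto
      then show ?thesis using t(2)[OF s(1), of j] s(3) \<eta> by (simp add: dist_commute)
    qed
    then show "\<exists>no. \<forall>n\<ge>no. dist (g (k n) (t n)) z < \<eta>'" by blast
  qed
  have "(\<lambda>j. g (k j) 0) \<longlonglongrightarrow> x" using LIMSEQ_subseq_LIMSEQ[OF x k(1)] by (simp add: o_def)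
  from subconverges_near_well[OF g en this z(1) im t(1) lim] show ?thesis
    by (rule subconverges_subseq[OF k(1)])
qed

text \<open>
  By induction on the number of arcs: the first arc ends where the energy spent reaches \<open>\<kappa>\<close>, and
  its limit provides the starting point for the remaining ones.
\<close>

lemma subconverges_finite_energy:
  assumes \<kappa>: "0 < \<kappa>" "\<kappa> < m * \<delta>"
    and g: "\<And>j. curve (g j)" and en: "\<And>j. en (g j) 0 1 \<le> real n * \<kappa>" and x: "(\<lambda>j. g j 0) \<longlonglongrightarrow> x"
  shows "subconverges g x"
  using g en x
proof (induction n arbitrary: g x)
  case 0
  have "en (g j) 0 1 \<le> \<kappa>" for j using "0.prems"(2)[of j] \<kappa> by simp
  then show ?case by (rule subconverges_small_energy[OF "0.prems"(1) _ \<kappa>(2) "0.prems"(3)])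
next
  case (Suc n)
  note gl = curve_lipschitz[OF Suc.prems(1)]
  have "\<exists>s\<in>{0..1}. en (g j) 0 s \<le> \<kappa> \<and> en (g j) s 1 \<le> real n * \<kappa>" for j
  proof (cases "en (g j) 0 1 \<le> \<kappa>")
    case True
    have "en (g j) 1 1 = 0" by (simp add: action_def)
    then show ?thesis using True \<kappa> by (intro bexI[of _ 1]) auto
  next
    case False
    have "continuous_on {0..1} (\<lambda>s. en (g j) 0 s)"
      unfolding action_def energy_density_def by (rule indefinite_integral_continuous_1[OF en_integrable[OF gl]])
    moreover have "en (g j) 0 0 \<le> \<kappa>" using \<kappa> by (simp add: action_def)
    ultimately obtain s where s: "0 \<le> s" "s \<le> 1" "en (g j) 0 s = \<kappa>"
      using IVT'[of "\<lambda>s. en (g j) 0 s" 0 \<kappa> 1] False by auto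
    then have "en (g j) s 1 \<le> real n * \<kappa>"
      using en_combine[OF gl, of 0 s 1 j] Suc.prems(2)[of j] by (simp add: algebra_simps)
    then show ?thesis using s by (intro bexI[of _ s]) auto
  qed
  then obtain s where s: "\<And>j. s j \<in> {0..1}" "\<And>j. en (g j) 0 (s j) \<le> \<kappa>" "\<And>j. en (g j) (s j) 1 \<le> real n * \<kappa>"
    by metis
  define \<beta> where "\<beta> = (\<lambda>j. subcurve 0 (s j) (g j))"
  define \<beta>' where "\<beta>' = (\<lambda>j. subcurve (s j) 1 (g j))"
  have \<beta>: "curve (\<beta> j)" "curve (\<beta>' j)" "en (\<beta> j) 0 1 = en (g j) 0 (s j)" "en (\<beta>' j) 0 1 = en (g j) (s j) 1"
    "ar (\<beta> j) 0 1 = ar (g j) 0 (s j)" "ar (\<beta>' j) 0 1 = ar (g j) (s j) 1"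
    "\<beta> j 0 = g j 0" "\<beta> j 1 = g j (s j)" "\<beta>' j 0 = g j (s j)" "\<beta>' j 1 = g j 1" for j
    unfolding \<beta>_def \<beta>'_def using s(1)[of j] Suc.prems(1)[of j]
    by (simp_all add: curve_subcurve action_subcurve E_lag A_lag)
  have "subconverges \<beta> x"
    by (rule subconverges_small_energy[OF \<beta>(1) _ \<kappa>(2)]) (use s Suc.prems(3) in \<open>simp_all add: \<beta>\<close>)
  then obtain k y A e where k: "strict_mono (k :: nat \<Rightarrow> nat)" "(\<lambda>j. \<beta> (k j) 1) \<longlonglongrightarrow> y"
      "(\<lambda>j. ar (\<beta> (k j)) 0 1) \<longlonglongrightarrow> A" "(\<lambda>j. en (\<beta> (k j)) 0 1) \<longlonglongrightarrow> e" "linked_with_loops x y A e"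
    unfolding subconverges_def by blast
  have "subconverges (\<lambda>j. \<beta>' (k j)) y"
    by (rule Suc.IH) (use s k(2) in \<open>simp_all add: \<beta>\<close>)
  then obtain r y' A' e' where r: "strict_mono (r :: nat \<Rightarrow> nat)" "(\<lambda>j. \<beta>' (k (r j)) 1) \<longlonglongrightarrow> y'"
      "(\<lambda>j. ar (\<beta>' (k (r j))) 0 1) \<longlonglongrightarrow> A'" "(\<lambda>j. en (\<beta>' (k (r j))) 0 1) \<longlonglongrightarrow> e'" "linked_with_loops y y' A' e'"
    unfolding subconverges_def by blast
  have "(\<lambda>j. ar (\<beta> (k (r j))) 0 1) \<longlonglongrightarrow> A" "(\<lambda>j. en (\<beta> (k (r j))) 0 1) \<longlonglongrightarrow> e"
    using LIMSEQ_subseq_LIMSEQ[OF k(3) r(1)] LIMSEQ_subseq_LIMSEQ[OF k(4) r(1)] by (simp_all add: o_def)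
  then have "(\<lambda>j. ar (\<beta> (k (r j))) 0 1 + ar (\<beta>' (k (r j))) 0 1) \<longlonglongrightarrow> A + A'"
     "(\<lambda>j. en (\<beta> (k (r j))) 0 1 + en (\<beta>' (k (r j))) 0 1) \<longlonglongrightarrow> e + e'"
    using r(3,4) by (auto intro: tendsto_add)
  moreover have "ar (\<beta> j) 0 1 + ar (\<beta>' j) 0 1 = ar (g j) 0 1" "en (\<beta> j) 0 1 + en (\<beta>' j) 0 1 = en (g j) 0 1" for j
    using en_combine[OF gl, of 0 "s j" 1 j] ar_combine[OF gl, of 0 "s j" 1 j] s(1)[of j] by (auto simp: \<beta>)
  ultimately have "(\<lambda>j. ar (g ((k \<circ> r) j)) 0 1) \<longlonglongrightarrow> A + A'" "(\<lambda>j. en (g ((k \<circ> r) j)) 0 1) \<longlonglongrightarrow> e + e'"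
    by simp_all
  moreover have "(\<lambda>j. g ((k \<circ> r) j) 1) \<longlonglongrightarrow> y'" using r(2) by (simp add: \<beta>)
  moreover have "strict_mono (k \<circ> r)" using k(1) r(1) by (rule strict_mono_o)
  moreover have "linked_with_loops x y' (A + A') (e + e')" using k(5) r(5) by (rule linked_with_loops_trans)
  ultimately show ?case unfolding subconverges_def by blast
qed

text \<open>
  The limit of the curves is a curve with loops at the wells, and \<open>absorb_loop\<close> removes the loops,
  the one at \<open>q\<close> after reversal of the curve.
\<close>

theorem linked_limit:
  assumes lk: "\<And>j. linked UNIV p q A (E j)" and E: "E \<longlonglongrightarrow> E'"
  shows "linked UNIV p q A E'"
proof -
  have "\<exists>g. curve g \<and> g 0 = p \<and> g 1 = q \<and> ar g 0 1 = A \<and> en g 0 1 \<le> E j" for j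
    using lk[of j] unfolding linked_def by (elim exE conjE) (intro exI conjI, assumption+)
  then obtain g where g: "\<And>j. curve (g j)" "\<And>j. g j 0 = p" "\<And>j. g j 1 = q" "\<And>j. ar (g j) 0 1 = A" "\<And>j. en (g j) 0 1 \<le> E j"
    by metis
  define \<kappa> where "\<kappa> = m * \<delta> / 2"
  have \<kappa>: "0 < \<kappa>" "\<kappa> < m * \<delta>" using m \<delta> by (auto simp: \<kappa>_def)
  obtain M where M: "\<And>j. E j \<le> M"
    using convergent_imp_bounded[OF E] unfolding bounded_iff by (auto simp: abs_le_iff)
  obtain n :: nat where n: "M / \<kappa> \<le> real n" using real_arch_simple by blast
  have "en (g j) 0 1 \<le> real n * \<kappa>" for j
    using g(5)[of j] M[of j] n \<kappa> by (simp add: field_simps)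
  then have "subconverges g p"
    by (rule subconverges_finite_energy[OF \<kappa> g(1)]) (simp add: g(2))
  then obtain k y A' e where k: "strict_mono (k :: nat \<Rightarrow> nat)" "(\<lambda>j. g (k j) 1) \<longlonglongrightarrow> y"
      "(\<lambda>j. ar (g (k j)) 0 1) \<longlonglongrightarrow> A'" "(\<lambda>j. en (g (k j)) 0 1) \<longlonglongrightarrow> e" "linked_with_loops p y A' e"
    unfolding subconverges_def by blast
  have "y = q" "A' = A" using k(2,3) by (simp_all add: g LIMSEQ_const_iff)
  have "e \<le> E'"
  proof (rule LIMSEQ_le[OF k(4)])
    show "(\<lambda>j. E (k j)) \<longlonglongrightarrow> E'" using LIMSEQ_subseq_LIMSEQ[OF E k(1)] by (simp add: o_def)
  qed (use g(5) in auto)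
  obtain A0 e0 Ap ep Aq eq where lw: "linked UNIV p q A0 e0" "loop p Ap ep" "loop q Aq eq"
      "A = A0 + Ap + Aq" "e = e0 + ep + eq"
    using k(5) unfolding linked_with_loops_def \<open>y = q\<close> \<open>A' = A\<close> by blast
  have pq: "p \<noteq> q" using apart \<delta> by auto
  have "linked UNIV p q (Ap + A0) (ep + e0)"
    using lw(2) pq unfolding loop_def by (intro absorb_loop[OF minimizers refl R_pos _ lw(1)]) auto
  from linked_reverse[OF this] have 1: "linked UNIV q p (- (Ap + A0)) (ep + e0)" .
  have "linked UNIV q p (- Aq + - (Ap + A0)) (eq + (ep + e0))"
    using loop_reverse[OF lw(3)] pq unfolding loop_def by (intro absorb_loop[OF minimizers refl R_pos _ 1]) auto
  from linked_reverse[OF this] have "linked UNIV p q A e" using lw(4,5) by (simp add: algebra_simps)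
  then show ?thesis using \<open>e \<le> E'\<close> by (rule linked_mono[OF _ subset_UNIV])
qed

end

section \<open>Existence of a minimizer\<close>

context weight
begin

lemma linked_of_admissible:
  assumes "\<gamma> \<in> admissible_curves x y A"
  shows "linked UNIV x y A (energy F \<gamma>)"
proof -
  obtain L where L: "L-lipschitz_on {0..1} \<gamma>"
    using assms locally_lipschitz_on_compact_imp_lipschitz by (auto simp: admissible_curves_def)
  show ?thesis
    using assms signed_area_eq_action[OF L] curveI[OF L]
    by (intro linkedI[of "\<gamma> \<circ> clamp01"]) (auto simp: admissible_curves_def energy_eq_action)
qed

lemma admissible_of_linked:
  assumes "linked UNIV x y A e"
  obtains \<gamma> where "\<gamma> \<in> admissible_curves x y A" "energy F \<gamma> \<le> e"
proof -
  obtain \<gamma> where \<gamma>: "curve \<gamma>" "\<gamma> 0 = x" "\<gamma> 1 = y" "ar \<gamma> 0 1 = A" "en \<gamma> 0 1 \<le> e"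
    using assms by (rule linkedE)
  obtain L where L: "L-lipschitz_on UNIV \<gamma>"
    using curve_lipschitz[OF \<gamma>(1)] by (auto simp: lipschitz_curve_def)
  have id: "\<gamma> \<circ> clamp01 = \<gamma>" using curve_clamp01[OF \<gamma>(1)] by auto
  have "locally_lipschitz_on {0..1} \<gamma>"
    unfolding locally_lipschitz_on_def using lipschitz_on_subset[OF L subset_UNIV] zero_less_one by blast
  then have "\<gamma> \<in> admissible_curves x y A"
    using \<gamma> signed_area_eq_action[OF lipschitz_on_subset[OF L subset_UNIV]] id by (simp add: admissible_curves_def)
  moreover have "energy F \<gamma> \<le> e" using \<gamma>(5) id by (simp add: energy_eq_action)
  ultimately show ?thesis by (rule that)
qed

lemma energy_nonneg: "\<gamma> \<in> admissible_curves x y A \<Longrightarrow> 0 \<le> energy F \<gamma>"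
  using linked_of_admissible[of \<gamma> x y A] en_nonneg curve_lipschitz order_trans unfolding linked_def by metis

end

context double_well
begin

lemma admissible_minimizer_exists:
  "\<exists>\<gamma>\<in>admissible_curves p q A. energy F \<gamma> = (INF \<gamma>'\<in>admissible_curves p q A. energy F \<gamma>')"
proof -
  let ?S = "admissible_curves p q A"
  let ?I = "INF \<gamma>\<in>?S. energy F \<gamma>"
  have ne: "?S \<noteq> {}" using linked_exists[of p q A] admissible_of_linked by (metis empty_iff)
  have bdd: "bdd_below (energy F ` ?S)" by (rule bdd_belowI[of _ 0]) (auto intro: energy_nonneg)
  have "linked UNIV p q A (?I + 1 / real (Suc j))" for j
  proof -
    have "?I < ?I + 1 / real (Suc j)" by simp
    then obtain \<gamma> where "\<gamma> \<in> ?S" "energy F \<gamma> < ?I + 1 / real (Suc j)"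
      using cINF_less_iff[OF ne bdd] by blast
    then show ?thesis using linked_mono[OF linked_of_admissible subset_UNIV] less_imp_le by blast
  qed
  moreover have "(\<lambda>j. ?I + 1 / real (Suc j)) \<longlonglongrightarrow> ?I + 0"
    using LIMSEQ_inverse_real_of_nat by (intro tendsto_add tendsto_const) (simp add: inverse_eq_divide)
  ultimately have "linked UNIV p q A (?I + 0)" by (rule linked_limit)
  then obtain \<gamma> where \<gamma>: "\<gamma> \<in> ?S" "energy F \<gamma> \<le> ?I" using admissible_of_linked by force
  moreover have "?I \<le> energy F \<gamma>" by (rule cINF_lower[OF bdd \<gamma>(1)])
  ultimately show ?thesis by force
qed

end

theorem theorem3p1:
  fixes W F :: "real ^ 2 \<Rightarrow> real"
    and p_plus p_minus :: "real ^ 2"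
    and r_plus r_minus :: real
    and B_plus B_minus :: "(real ^ 2) set"
  assumes "continuous_on UNIV W"
    and "\<And>p. W p \<ge> 0"
    and "{p. W p = 0} = {p_plus, p_minus}"
    and "p_plus \<noteq> p_minus"
    and "F = (\<lambda>p. sqrt (W p))"
    and "r_plus > 0" and "B_plus = ball p_plus r_plus"
    and "r_minus > 0" and "B_minus = ball p_minus r_minus"
    and "B_plus \<inter> B_minus = {}"
    and "smooth_on B_plus W" and "smooth_on B_minus W"
    and "positive_definite (hessian W p_plus)"
    and "positive_definite (hessian W p_minus)"
    and "local_minimizers_exist F p_plus B_plus"
    and "local_minimizers_exist F p_minus B_minus"
    and "\<exists>m\<^sub>0>0. \<forall>p \<in> UNIV - (B_plus \<union> B_minus). F p \<ge> m\<^sub>0"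
  shows "\<forall>A\<^sub>0. \<exists>\<gamma> \<in> admissible_curves p_minus p_plus A\<^sub>0.
           energy F \<gamma> = (INF \<gamma>' \<in> admissible_curves p_minus p_plus A\<^sub>0. energy F \<gamma>')"
proof
  fix A\<^sub>0
  note W_cont = assms(1) and W_nonneg = assms(2) and F_def = assms(5) and B = assms(7) assms(9)
  have zero: "W x = 0 \<longleftrightarrow> x \<in> {p_plus, p_minus}" for x using assms(3) by blast
  have F_cont: "continuous_on UNIV F" unfolding F_def by (intro continuous_intros W_cont)
  have F_nonneg: "0 \<le> F x" for x by (simp add: F_def W_nonneg)
  have F_pos: "0 < F x" if "x \<notin> {p_plus, p_minus}" for x
    using that zero[of x] W_nonneg[of x] by (auto simp: F_def)
  obtain cp \<rho>p where P: "cp > 0" "\<rho>p > 0" "\<rho>p < r_plus"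
      "\<And>x. dist p_plus x \<le> \<rho>p \<Longrightarrow> cp * (norm (x - p_plus))\<^sup>2 \<le> W x"
    using nondegenerate_minimum_quadratic_growth[of r_plus p_plus W] assms zero by auto
  obtain cm \<rho>m where M: "cm > 0" "\<rho>m > 0" "\<rho>m < r_minus"
      "\<And>x. dist p_minus x \<le> \<rho>m \<Longrightarrow> cm * (norm (x - p_minus))\<^sup>2 \<le> W x"
    using nondegenerate_minimum_quadratic_growth[of r_minus p_minus W] assms zero by auto
  define \<delta> where "\<delta> = min \<rho>p \<rho>m / 2"
  define c where "c = sqrt (min cp cm)"
  define R where "R = (\<lambda>z. if z = p_plus then r_plus else r_minus)"
  have \<delta>: "0 < \<delta>" "2 * \<delta> \<le> \<rho>p" "2 * \<delta> \<le> \<rho>m" using P M by (auto simp: \<delta>_def)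
  have c: "0 < c" using P M by (simp add: c_def)
  have R: "ball p_plus (R p_plus) = B_plus" "ball p_minus (R p_minus) = B_minus"
    using assms(4) B by (auto simp: R_def)
  have sqrt_growth: "c * norm (x - z) \<le> F x" if "k * (norm (x - z))\<^sup>2 \<le> W x" "min cp cm \<le> k" for k x z
  proof -
    have "min cp cm * (norm (x - z))\<^sup>2 \<le> W x"
      using mult_right_mono[OF that(2), of "(norm (x - z))\<^sup>2"] that(1) by simp
    then have "sqrt (min cp cm * (norm (x - z))\<^sup>2) \<le> F x" unfolding F_def by (rule real_sqrt_le_mono)
    then show ?thesis by (simp add: real_sqrt_mult c_def)
  qed
  obtain m\<^sub>0 where m\<^sub>0: "m\<^sub>0 > 0" "\<And>x. x \<notin> B_plus \<union> B_minus \<Longrightarrow> m\<^sub>0 \<le> F x" using assms(17) by auto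
  have coercive: "\<exists>\<mu>>0. \<forall>x. (\<forall>z\<in>{p_minus, p_plus}. \<eta> \<le> dist z x) \<longrightarrow> \<mu> \<le> F x" if "\<eta> > 0" for \<eta>
  proof -
    \<comment> \<open>away from the wells, \<open>F\<close> has a positive minimum on the closed balls and is at least \<open>m\<^sub>0\<close> outside\<close>
    define K where "K = (cball p_plus r_plus \<union> cball p_minus r_minus) - (ball p_plus \<eta> \<union> ball p_minus \<eta>)"
    have K: "compact K" unfolding K_def by (intro compact_diff compact_Un compact_cball open_Un open_ball)
    obtain \<mu> where \<mu>: "\<mu> > 0" "\<And>x. x \<in> K \<Longrightarrow> \<mu> \<le> F x"
    proof (cases "K = {}")
      case False
      obtain y where y: "y \<in> K" "\<And>x. x \<in> K \<Longrightarrow> F y \<le> F x"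
        using continuous_attains_inf[OF K False continuous_on_subset[OF F_cont subset_UNIV]] by blast
      have "F y > 0" using y(1) \<open>\<eta> > 0\<close> by (intro F_pos) (auto simp: K_def)
      then show ?thesis using y(2) that by blast
    qed (use that[of 1] in auto)
    have "min \<mu> m\<^sub>0 \<le> F x" if "\<forall>z\<in>{p_minus, p_plus}. \<eta> \<le> dist z x" for x
    proof (cases "x \<in> B_plus \<union> B_minus")
      case True
      then have "x \<in> K" using that B by (auto simp: K_def)
      then show ?thesis using \<mu>(2) by force
    next
      case False
      then show ?thesis using m\<^sub>0(2)[of x] by simp
    qed
    then show ?thesis using \<mu>(1) m\<^sub>0(1) by (intro exI[of _ "min \<mu> m\<^sub>0"]) auto
  qed
  obtain m where m: "m > 0" "\<And>x. (\<forall>z\<in>{p_minus, p_plus}. \<delta> \<le> dist z x) \<Longrightarrow> m \<le> F x"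
    using coercive[OF \<delta>(1)] by blast
  interpret double_well F p_minus p_plus R \<delta> c m
  proof
    show "2 * \<delta> < R z" if "z \<in> {p_minus, p_plus}" for z
      using that \<delta> P(3) M(3) assms(4) by (auto simp: R_def)
    show "c * norm (x - z) \<le> F x" if z: "z \<in> {p_minus, p_plus}" and x: "dist z x \<le> 2 * \<delta>" for z x
    proof (cases "z = p_plus")
      case True
      then show ?thesis using sqrt_growth[OF P(4)[of x]] x \<delta> by simp
    next
      case False
      then show ?thesis using sqrt_growth[OF M(4)[of x]] x z \<delta> by simp
    qed
    have "cball p_minus (2 * \<delta>) \<subseteq> B_minus" "cball p_plus (2 * \<delta>) \<subseteq> B_plus"
      using \<delta> P(3) M(3) B by auto
    then show "cball p_minus (2 * \<delta>) \<inter> cball p_plus (2 * \<delta>) = {}" using assms(10) by blast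
    show "local_minimizers_exist F z (ball z (R z))" if "z \<in> {p_minus, p_plus}" for z
      using that assms(15,16) R by auto
  qed (use F_cont F_nonneg \<delta> c m coercive in auto)
  show "\<exists>\<gamma>\<in>admissible_curves p_minus p_plus A\<^sub>0.
           energy F \<gamma> = (INF \<gamma>'\<in>admissible_curves p_minus p_plus A\<^sub>0. energy F \<gamma>')"
    by (rule admissible_minimizer_exists)
qed

end
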